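(* Let $u$ be the mild solution, for each noise level $\lambda>0$, of the stochastic heat equation on $(0,L)$ with Dirichlet boundary conditions $$\partial_t u_t(x)=\tfrac12\Delta u_t(x)+\lambda\,\sigma(u_t(x))\,\dot w(t,x),\qquad u_t(0)=u_t(L)=0,$$ with initial function $u_0$. Then the nonlinear noise excitation index of the solution is $4$; that is, for every $t>0$, $$\overline e(t)=\underline e(t)=4 .$$
   Context: Fix $L>0$. $\dot w$ denotes space-time white noise on $(0,\infty)\times(0,L)$ and $\lambda>0$ is the level of the noise. Assumptions on $\sigma$: $\sigma:\mathbf R\to\mathbf R$ is Lipschitz continuous, $\sigma(0)=0$, and with $l_\sigma:=\inf_{x\ne0}|\sigma(x)/x|$ and $L_\sigma:=\sup_{x\neq 0}|\sigma(x)/x|$ one has $0<l_\sigma\le L_\sigma<\infty$. Assumptions on $u_0$: $u_0:[0,L]\to[0,\infty)$ is a nonrandom, bounded, measurable function, compactly supported in $[0,L]$, and not almost everywhere zero. Neither $\sigma$ nor $u_0$ depends on $\lambda$. Mild solution: let $p_D(t,x,y)$ be the Dirichlet heat kernel on $(0,L)$ (the fundamental solution of $\partial_t=\frac12\Delta$ on $(0,L)$ with zero boundary conditions). The mild solution is the unique predictable random field $u$ (with respect to the filtration of the white noise) with initial function $u_0$ such that $\sup_{x\in[0,L]}\sup_{t\in[0,T]}\mathrm E|u_t(x)|^k<\infty$ for all $T>0$ and $k\in[2,\infty)$ and, almost surely for each $t>0$ and $x\in[0,L]$, $$u_t(x)=\int_0^L u_0(y)p_D(t,x,y)\,dy+\lambda\int_0^L\int_0^t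 p_D(t-s,x,y)\,\sigma(u_s(y))\,w(ds\,dy),$$ the last integral being a Walsh stochastic integral. Existence and uniqueness of this solution are known. Energy of the solution at time $t$: $\mathcal E_t(\lambda):=\sqrt{\mathrm E\left(\|u_t\|_{L^2[0,L]}^2\right)}$. Upper and lower excitation indices at time $t$: $$\overline e(t):=\limsup_{\lambda\to\infty}\frac{\log\log\mathcal E_t(\lambda)}{\log\lambda},\qquad \underline e(t):=\liminf_{\lambda\to\infty}\frac{\log\log\mathcal E_t(\lambda)}{\log\lambda}.$$ When they are equal, the common value (required to be strictly positive) is called the nonlinear noise excitation index at time $t$. Convention: $\log\log r:=-\infty$ for $r\le1$. *)

theory Defs
  imports "HOL-Probability.Probability"
begin

text \<open>Points of space-time are pairs (time, position); \<open>'w\<close> is the sample space.\<close>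

definition noise_sets :: "real \<Rightarrow> (real \<times> real) set set" where
  "noise_sets L = {A \<in> sets borel. A \<subseteq> {0<..} \<times> {0<..<L} \<and> emeasure lborel A < \<infinity>}"

text \<open>The first disjunct is the degenerate normal law of variance zero.\<close>

definition centered_gaussian :: "'w measure \<Rightarrow> ('w \<Rightarrow> real) \<Rightarrow> bool" where
  "centered_gaussian M X \<longleftrightarrow> X \<in> borel_measurable M \<and>
     ((AE \<omega> in M. X \<omega> = 0) \<or> (\<exists>s>0. distributed M lborel X (normal_density 0 s)))"

definition white_noise :: "'w measure \<Rightarrow> real \<Rightarrow> ((real \<times> real) set \<Rightarrow> 'w \<Rightarrow> real) \<Rightarrow> bool" where
  "white_noise M L W \<longleftrightarrow>
     (\<forall>\<A> c. finite \<A> \<and> \<A> \<subseteq> noise_sets L \<longrightarrow> centered_gaussian M (\<lambda>\<omega>. \<Sum>A\<in>\<A>. c A * W A \<omega>)) \<and>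
     (\<forall>A\<in>noise_sets L. \<forall>B\<in>noise_sets L.
        (\<integral>\<omega>. W A \<omega> * W B \<omega> \<partial>M) = measure lborel (A \<inter> B))"

text \<open>The filtration is augmented by the null sets of \<open>M\<close>, as usual.\<close>

definition noise_filtration ::
  "'w measure \<Rightarrow> real \<Rightarrow> ((real \<times> real) set \<Rightarrow> 'w \<Rightarrow> real) \<Rightarrow> real \<Rightarrow> 'w measure" where
  "noise_filtration M L W t = sigma (space M)
     ({W A -` B \<inter> space M | A B. A \<in> noise_sets L \<and> A \<subseteq> {0<..t} \<times> UNIV \<and> B \<in> sets borel}
      \<union> null_sets M)"

definition predictable_sigma ::
  "'w measure \<Rightarrow> (real \<Rightarrow> 'w measure) \<Rightarrow> real set \<Rightarrow> ((real \<times> real) \<times> 'w) measure" where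
  "predictable_sigma M F S = sigma (({0<..} \<times> S) \<times> space M)
     {({a<..b} \<times> A) \<times> G | a b A G. 0 \<le> a \<and> a \<le> b \<and> A \<in> sets borel \<and> A \<subseteq> S \<and> G \<in> sets (F a)}"

text \<open>A tuple \<open>(a, b, A, X)\<close> encodes the elementary process \<open>X(\<omega>) 1\<^bsub>(a,b]\<^esub>(s) 1\<^bsub>A\<^esub>(y)\<close>;
  a simple process is a finite sum of these, encoded as a list.\<close>

type_synonym 'w elementary = "real \<times> real \<times> real set \<times> ('w \<Rightarrow> real)"

fun elementary_process ::
  "'w measure \<Rightarrow> real \<Rightarrow> ((real \<times> real) set \<Rightarrow> 'w \<Rightarrow> real) \<Rightarrow> 'w elementary \<Rightarrow> bool" where
  "elementary_process M L W (a, b, A, X) \<longleftrightarrow>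
     0 \<le> a \<and> a \<le> b \<and> A \<in> sets borel \<and> A \<subseteq> {0<..<L} \<and>
     X \<in> borel_measurable (noise_filtration M L W a) \<and> bounded (X ` space M)"

fun elementary_value :: "'w elementary \<Rightarrow> (real \<times> real) \<times> 'w \<Rightarrow> real" where
  "elementary_value (a, b, A, X) ((s, y), \<omega>) = X \<omega> * indicator {a<..b} s * indicator A y"

fun elementary_integral ::
  "((real \<times> real) set \<Rightarrow> 'w \<Rightarrow> real) \<Rightarrow> 'w elementary \<Rightarrow> 'w \<Rightarrow> real" where
  "elementary_integral W (a, b, A, X) \<omega> = X \<omega> * W ({a<..b} \<times> A) \<omega>"

definition simple_value :: "'w elementary list \<Rightarrow> (real \<times> real) \<times> 'w \<Rightarrow> real" where
  "simple_value es z = (\<Sum>e\<leftarrow>es. elementary_value e z)"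

definition simple_integral ::
  "((real \<times> real) set \<Rightarrow> 'w \<Rightarrow> real) \<Rightarrow> 'w elementary list \<Rightarrow> 'w \<Rightarrow> real" where
  "simple_integral W es \<omega> = (\<Sum>e\<leftarrow>es. elementary_integral W e \<omega>)"

definition integrand_norm2 ::
  "'w measure \<Rightarrow> real \<Rightarrow> ((real \<times> real) \<times> 'w \<Rightarrow> real) \<Rightarrow> ennreal" where
  "integrand_norm2 M L \<Phi> =
     (\<integral>\<^sup>+z\<in>({0<..} \<times> {0<..<L}) \<times> space M. ennreal ((\<Phi> z)\<^sup>2) \<partial>(lborel \<Otimes>\<^sub>M M))"

text \<open>\<open>has_walsh_integral M L W \<Phi> I\<close>: the random variable \<open>I\<close> is (a version of) the Walsh integral
  of the predictable, square-integrable \<open>\<Phi>\<close> over \<open>(0,\<infinity>) \<times> (0,L)\<close>, that is, the limit in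
  \<open>L\<^sup>2(M)\<close> of the integrals of simple processes which approximate \<open>\<Phi>\<close>.
  By the Ito-Walsh isometry \<open>I\<close> is determined almost surely.\<close>

definition has_walsh_integral ::
  "'w measure \<Rightarrow> real \<Rightarrow> ((real \<times> real) set \<Rightarrow> 'w \<Rightarrow> real) \<Rightarrow>
   ((real \<times> real) \<times> 'w \<Rightarrow> real) \<Rightarrow> ('w \<Rightarrow> real) \<Rightarrow> bool" where
  "has_walsh_integral M L W \<Phi> I \<longleftrightarrow>
     \<Phi> \<in> borel_measurable (predictable_sigma M (noise_filtration M L W) {0<..<L}) \<and>
     integrand_norm2 M L \<Phi> < \<infinity> \<and>
     I \<in> borel_measurable M \<and>
     (\<exists>S. (\<forall>n::nat. \<forall>e\<in>set (S n). elementary_process M L W e) \<and>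
        (\<lambda>n. integrand_norm2 M L (\<lambda>z. simple_value (S n) z - \<Phi> z)) \<longlonglongrightarrow> 0 \<and>
        (\<lambda>n. \<integral>\<^sup>+\<omega>. ennreal ((simple_integral W (S n) \<omega> - I \<omega>)\<^sup>2) \<partial>M) \<longlonglongrightarrow> 0)"

text \<open>Fundamental solution of \<open>\<partial>\<^sub>t = \<onehalf> \<partial>\<^sub>x\<^sub>x\<close> on \<open>(0,L)\<close> with zero boundary values.  The initial
  condition is required uniformly in \<open>x\<close>: mere pointwise convergence would still allow one to add
  solutions such as the normal derivative of the kernel at a boundary point, whereas with uniform
  convergence the maximum principle determines \<open>p\<close> for \<open>t > 0\<close> and \<open>x, y\<close> in \<open>[0,L]\<close>.\<close>

definition dirichlet_heat_kernel :: "real \<Rightarrow> (real \<Rightarrow> real \<Rightarrow> real \<Rightarrow> real) \<Rightarrow> bool" where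
  "dirichlet_heat_kernel L p \<longleftrightarrow>
     continuous_on ({0<..} \<times> {0..L} \<times> {0..L}) (\<lambda>(t, x, y). p t x y) \<and>
     (\<exists>pt px pxx.
        continuous_on ({0<..} \<times> {0<..<L} \<times> {0<..<L}) (\<lambda>(t, x, y). pt t x y) \<and>
        continuous_on ({0<..} \<times> {0<..<L} \<times> {0<..<L}) (\<lambda>(t, x, y). px t x y) \<and>
        continuous_on ({0<..} \<times> {0<..<L} \<times> {0<..<L}) (\<lambda>(t, x, y). pxx t x y) \<and>
        (\<forall>t>0. \<forall>x\<in>{0<..<L}. \<forall>y\<in>{0<..<L}.
           ((\<lambda>s. p s x y) has_real_derivative pt t x y) (at t) \<and>
           ((\<lambda>z. p t z y) has_real_derivative px t x y) (at x) \<and>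
           ((\<lambda>z. px t z y) has_real_derivative pxx t x y) (at x) \<and>
           pt t x y = 1 / 2 * pxx t x y)) \<and>
     (\<forall>t>0. \<forall>y\<in>{0..L}. p t 0 y = 0 \<and> p t L y = 0) \<and>
     (\<forall>f. continuous_on {0..L} f \<and> f 0 = 0 \<and> f L = 0 \<longrightarrow>
        uniform_limit {0..L} (\<lambda>t x. LINT y:{0..L}|lborel. p t x y * f y) f (at_right 0))"

definition lower_slope :: "(real \<Rightarrow> real) \<Rightarrow> ereal" where
  "lower_slope \<sigma> = (INF x\<in>-{0}. ereal \<bar>\<sigma> x / x\<bar>)"

definition upper_slope :: "(real \<Rightarrow> real) \<Rightarrow> ereal" where
  "upper_slope \<sigma> = (SUP x\<in>-{0}. ereal \<bar>\<sigma> x / x\<bar>)"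

definition admissible_coefficient :: "(real \<Rightarrow> real) \<Rightarrow> bool" where
  "admissible_coefficient \<sigma> \<longleftrightarrow>
     (\<exists>C. C-lipschitz_on UNIV \<sigma>) \<and> \<sigma> 0 = 0 \<and>
     0 < lower_slope \<sigma> \<and> lower_slope \<sigma> \<le> upper_slope \<sigma> \<and> upper_slope \<sigma> < \<infinity>"

text \<open>Only the values of \<open>u0\<close> on \<open>[0,L]\<close> matter.\<close>

definition admissible_initial :: "real \<Rightarrow> (real \<Rightarrow> real) \<Rightarrow> bool" where
  "admissible_initial L u0 \<longleftrightarrow>
     (\<forall>x\<in>{0..L}. 0 \<le> u0 x) \<and>
     bounded (u0 ` {0..L}) \<and>
     u0 \<in> borel_measurable (lebesgue_on {0..L}) \<and>
     compact (closure {x\<in>{0..L}. u0 x \<noteq> 0}) \<and> closure {x\<in>{0..L}. u0 x \<noteq> 0} \<subseteq> {0..L} \<and>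
     \<not> (AE x in lebesgue_on {0..L}. u0 x = 0)"

text \<open>\<open>u t x \<omega>\<close> is the random field.  Predictability is required on \<open>(0,\<infinity>) \<times> [0,L]\<close>, since the
  (merely Lebesgue measurable) initial function is prescribed at time zero.  The Walsh integral over
  \<open>(0,t) \<times> (0,L)\<close> is the integral over \<open>(0,\<infinity>) \<times> (0,L)\<close> of the integrand cut off at time \<open>t\<close>.\<close>

definition mild_solution ::
  "'w measure \<Rightarrow> real \<Rightarrow> ((real \<times> real) set \<Rightarrow> 'w \<Rightarrow> real) \<Rightarrow> (real \<Rightarrow> real \<Rightarrow> real \<Rightarrow> real) \<Rightarrow>
   (real \<Rightarrow> real) \<Rightarrow> (real \<Rightarrow> real) \<Rightarrow> real \<Rightarrow> (real \<Rightarrow> real \<Rightarrow> 'w \<Rightarrow> real) \<Rightarrow> bool" where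
  "mild_solution M L W p \<sigma> u0 lam u \<longleftrightarrow>
     (\<lambda>((t, x), \<omega>). u t x \<omega>)
        \<in> borel_measurable (predictable_sigma M (noise_filtration M L W) {0..L}) \<and>
     (\<forall>x\<in>{0..L}. \<forall>\<omega>\<in>space M. u 0 x \<omega> = u0 x) \<and>
     (\<forall>T>0. \<forall>k\<ge>2.
        (SUP x\<in>{0..L}. SUP t\<in>{0..T}. \<integral>\<^sup>+\<omega>. ennreal (\<bar>u t x \<omega>\<bar> powr k) \<partial>M) < \<infinity>) \<and>
     (\<forall>t>0. \<forall>x\<in>{0..L}. \<exists>I.
        has_walsh_integral M L W
          (\<lambda>((s, y), \<omega>). indicator {0<..<t} s * p (t - s) x y * \<sigma> (u s y \<omega>)) I \<and>
        (AE \<omega> in M. u t x \<omega> = (LINT y:{0..L}|lebesgue. u0 y * p t x y) + lam * I \<omega>))"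

definition energy :: "'w measure \<Rightarrow> real \<Rightarrow> (real \<Rightarrow> real \<Rightarrow> 'w \<Rightarrow> real) \<Rightarrow> real \<Rightarrow> real" where
  "energy M L u t = sqrt (\<integral>\<omega>. (LINT x:{0..L}|lborel. (u t x \<omega>)\<^sup>2) \<partial>M)"

definition loglog :: "real \<Rightarrow> ereal" where
  "loglog r = (if r \<le> 1 then -\<infinity> else ereal (ln (ln r)))"

text \<open>Here \<open>u lam\<close> is the solution for the noise level \<open>lam\<close>.\<close>

definition upper_excitation_index ::
  "'w measure \<Rightarrow> real \<Rightarrow> (real \<Rightarrow> real \<Rightarrow> real \<Rightarrow> 'w \<Rightarrow> real) \<Rightarrow> real \<Rightarrow> ereal" where
  "upper_excitation_index M L u t =
     Limsup at_top (\<lambda>lam. loglog (energy M L (u lam) t) / ereal (ln lam))"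

definition lower_excitation_index ::
  "'w measure \<Rightarrow> real \<Rightarrow> (real \<Rightarrow> real \<Rightarrow> real \<Rightarrow> 'w \<Rightarrow> real) \<Rightarrow> real \<Rightarrow> ereal" where
  "lower_excitation_index M L u t =
     Liminf at_top (\<lambda>lam. loglog (energy M L (u lam) t) / ereal (ln lam))"

end

theory Submission
  imports Defs "HOL-Real_Asymp.Real_Asymp"
begin

text \<open>By the Walsh isometry the second moments \<open>v\<^sub>t(x)\<close> of the solution satisfy a Volterra equation
  with kernel \<open>\<lambda>\<^sup>2 p(t-s,x,y)\<^sup>2\<close>, up to the factor \<open>(\<sigma>(u)/u)\<^sup>2\<close>, which lies between two positive
  constants.  Integrating the square of the kernel over \<open>x\<close> gives at most \<open>(t-s)\<^sup>-\<^sup>1\<^sup>/\<^sup>2\<close>, and integrating it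
  against \<open>sin\<^sup>2(\<pi>x/L)\<close> gives at least a constant times \<open>(t-s)\<^sup>-\<^sup>1\<^sup>/\<^sup>2 sin\<^sup>2(\<pi>y/L)\<close> for short times.
  So \<open>\<integral>v\<^sub>t\<close> and \<open>\<integral>v\<^sub>t sin\<^sup>2\<close> obey scalar renewal inequalities whose kernel \<open>\<lambda>\<^sup>2 (t-s)\<^sup>-\<^sup>1\<^sup>/\<^sup>2\<close> has
  exponential growth rate of order \<open>\<lambda>\<^sup>4\<close>, and the energy lies between two functions of the form
  \<open>a exp(k \<lambda>\<^sup>4)\<close>.  The heat kernel bounds come from its sine series: the minimum principle shows
  that the kernel maps each sine to a multiple of itself, and the sines are complete.  The isometry
  rests on the independence of the noise after time \<open>a\<close> from the filtration at time \<open>a\<close>.\<close>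

section \<open>The Dirichlet heat kernel\<close>

text \<open>\<open>dirichlet_heat_kernel\<close> is a characterisation and not a formula, so
  symmetry and the series have to be earned from the equation, the boundary values and the uniform
  initial condition. The weight sin^2 in the lower bound is forced by the boundary: the integral of
  p(r,x,y)^2 over x vanishes as y approaches 0 or L, so no lower bound by a multiple of r^(-1/2) is
  uniform in y, whereas sin^2 reappears on the other side of the weighted estimate, which can
  therefore be iterated. The power four is the scaling of lam^2 r^(-1/2): its integral over a window
  of length delta has order lam^2 delta^(1/2), which is of order one when delta has order lam^(-4).
  The double logarithm removes the constants a and k, so rough constants suffice. Second moments are
  kept in \<open>ennreal\<close>, where Tonelli applies freely; finiteness enters through the moment
  condition of the mild solution and allows half of the unknown to be absorbed in the upper
  bound.\<close>

lemma second_deriv_nonneg_at_min: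
  fixes f f' :: "real \<Rightarrow> real"
  assumes x: "a < x" "x < b"
    and f: "\<And>z. a < z \<Longrightarrow> z < b \<Longrightarrow> (f has_real_derivative f' z) (at z)"
    and f': "(f' has_real_derivative d) (at x)"
    and min: "\<And>z. a < z \<Longrightarrow> z < b \<Longrightarrow> f x \<le> f z"
  shows "d \<ge> 0"
proof (rule ccontr)
  assume "\<not> d \<ge> 0"
  then have d: "d < 0" by simp
  define r where "r = min (x - a) (b - x)"
  have r: "r > 0" using x by (simp add: r_def)
  have "f' x = 0"
    by (rule DERIV_local_min[OF f[OF x] r]) (auto simp: r_def abs_if split: if_splits intro!: min)
  obtain e where e: "e > 0" "\<And>h. 0 < h \<Longrightarrow> h < e \<Longrightarrow> f' (x + h) < f' x"
    using DERIV_neg_dec_right[OF f' d] by blast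
  define h where "h = min e (b - x) / 2"
  have h: "0 < h" "h < e" "x + h < b" using e x by (auto simp: h_def min_def field_simps)
  obtain z where z: "x < z" "z < x + h" "f (x + h) - f x = h * f' z"
    using MVT2[of x "x + h" f f'] f h x by force
  have "f' z < 0" using e(2)[of "z - x"] z h \<open>f' x = 0\<close> by auto
  then have "f (x + h) < f x" using z h by (smt (verit) mult_pos_neg)
  then show False using min[of "x + h"] h x by auto
qed

text \<open>At a minimum of \<open>w + \<eta> * t\<close> over a space-time cylinder the second
  space derivative is nonnegative and the time derivative of \<open>w\<close> is at most
  \<open>-\<eta>\<close>, against the heat equation. The positive \<open>\<eta>\<close> makes the
  contradiction strict. Initial data enter as an eventual uniform inequality, the form in which the
  kernel supplies them.\<close>

lemma heat_minimum_principle: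
  fixes w wt wx wxx :: "real \<Rightarrow> real \<Rightarrow> real"
  assumes cont: "continuous_on ({0<..} \<times> {0..L}) (\<lambda>(t, x). w t x)"
    and wt: "\<And>t x. t > 0 \<Longrightarrow> x \<in> {0<..<L} \<Longrightarrow> ((\<lambda>s. w s x) has_real_derivative wt t x) (at t)"
    and wx: "\<And>t x. t > 0 \<Longrightarrow> x \<in> {0<..<L} \<Longrightarrow> ((\<lambda>z. w t z) has_real_derivative wx t x) (at x)"
    and wxx: "\<And>t x. t > 0 \<Longrightarrow> x \<in> {0<..<L} \<Longrightarrow> ((\<lambda>z. wx t z) has_real_derivative wxx t x) (at x)"
    and heat: "\<And>t x. t > 0 \<Longrightarrow> x \<in> {0<..<L} \<Longrightarrow> wt t x = 1 / 2 * wxx t x"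
    and bdry: "\<And>t. t > 0 \<Longrightarrow> m \<le> w t 0" "\<And>t. t > 0 \<Longrightarrow> m \<le> w t L"
    and init: "eventually (\<lambda>t. \<forall>x\<in>{0..L}. m \<le> w t x) (at_right 0)"
    and t: "t > 0" and x: "x \<in> {0..L}"
  shows "m \<le> w t x"
proof (rule ccontr)
  assume "\<not> m \<le> w t x"
  then have less: "w t x < m" by simp
  \<comment> \<open>Half of the gap divided by \<open>t\<close>: the added term lifts
    \<open>w t x\<close> only to the midpoint between \<open>w t x\<close> and \<open>m\<close>,
    still below \<open>m\<close>.\<close>
  define \<eta> where "\<eta> = (m - w t x) / (2 * t)"
  have \<eta>: "\<eta> > 0" "w t x + \<eta> * t < m" using less t by (auto simp: \<eta>_def field_simps)
  obtain b where b: "b > 0" "\<And>s. 0 < s \<Longrightarrow> s < b \<Longrightarrow> \<forall>x\<in>{0..L}. m \<le> w s x"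
    using init unfolding eventually_at_right_field by auto
  \<comment> \<open>Continuity is given for positive times only, so the compact cylinder starts at a
    positive time at which \<open>w\<close> is already at least \<open>m\<close>.\<close>
  define \<tau> where "\<tau> = min b t / 2"
  have \<tau>: "0 < \<tau>" "\<tau> < t" "\<forall>x\<in>{0..L}. m \<le> w \<tau> x" using b t by (auto simp: \<tau>_def min_def)
  let ?K = "{\<tau>..t} \<times> {0..L}"
  let ?z = "\<lambda>(s, x). w s x + \<eta> * s"
  have "continuous_on ?K (\<lambda>(s, x). w s x)" by (rule continuous_on_subset[OF cont]) (use \<tau> in auto)
  then have cz: "continuous_on ?K ?z" by (simp add: case_prod_unfold) (intro continuous_intros, auto)
  have "compact ?K" by (intro compact_Times) auto
  then obtain q where q: "q \<in> ?K" "\<forall>y\<in>?K. ?z q \<le> ?z y"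
    using continuous_attains_inf[OF _ _ cz] \<tau> x by fastforce
  obtain t1 x1 where [simp]: "q = (t1, x1)" by (cases q)
  have mn: "w t1 x1 + \<eta> * t1 \<le> w s y + \<eta> * s" if "s \<in> {\<tau>..t}" "y \<in> {0..L}" for s y
    using q(2) that by auto
  have lt: "w t1 x1 + \<eta> * t1 < m" using mn[of t x] \<tau> x \<eta> by auto
  have in1: "t1 \<in> {\<tau>..t}" "x1 \<in> {0..L}" using q(1) by auto
  have t1p: "t1 > 0" using in1 \<tau> by auto
  have "\<eta> * t1 > 0" using t1p \<eta> by simp
  then have w1: "w t1 x1 < m" using lt by linarith
  have "t1 \<noteq> \<tau>" using w1 \<tau>(3) in1 by force
  then have t1: "\<tau> < t1" using in1 by simp
  have "x1 \<noteq> 0" "x1 \<noteq> L" using w1 bdry[OF t1p] by auto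
  then have x1: "x1 \<in> {0<..<L}" using in1 by auto
  have "wxx t1 x1 \<ge> 0"
    by (rule second_deriv_nonneg_at_min[of 0 x1 L "w t1" "wx t1"])
       (use x1 wx[OF t1p] wxx[OF t1p] mn[of t1] in1 in auto)
  \<comment> \<open>The minimum may sit at the final time \<open>t\<close>, so it is compared with
    earlier times only; this gives an inequality instead of a vanishing time derivative.\<close>
  moreover have "wt t1 x1 + \<eta> \<le> 0"
  proof (rule ccontr)
    assume pos: "\<not> wt t1 x1 + \<eta> \<le> 0"
    have "((\<lambda>s. w s x1 + \<eta> * s) has_real_derivative wt t1 x1 + \<eta>) (at t1)"
      by (auto intro!: derivative_eq_intros wt[OF t1p x1])
    from DERIV_pos_inc_left[OF this] pos obtain e where e: "e > 0"
      "\<And>h. 0 < h \<Longrightarrow> h < e \<Longrightarrow> w (t1 - h) x1 + \<eta> * (t1 - h) < w t1 x1 + \<eta> * t1" by auto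
    define h where "h = min e (t1 - \<tau>) / 2"
    have h: "0 < h" "h < e" "t1 - h \<in> {\<tau>..t}" using e t1 in1 by (auto simp: h_def min_def field_simps)
    then show False using e(2)[of h] mn[of "t1 - h" x1] in1 by force
  qed
  ultimately show False using heat[OF t1p x1] \<eta> by linarith
qed

section \<open>The Dirichlet sines and their decay rates\<close>

definition dsin :: "real \<Rightarrow> nat \<Rightarrow> real \<Rightarrow> real" where
  "dsin L n x = sin (real n * pi / L * x)"

text \<open>The eigenvalue of minus half the second derivative for \<open>dsin L n\<close>. Index 0
  is kept, with the zero function as its sine, so that series run over all natural numbers.\<close>

definition rate :: "real \<Rightarrow> nat \<Rightarrow> real" where
  "rate L n = (real n * pi / L)\<^sup>2 / 2"

lemma dsin_0 [simp]: "dsin L n 0 = 0" "dsin L 0 x = 0"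
  by (simp_all add: dsin_def)

lemma dsin_L [simp]: "L > 0 \<Longrightarrow> dsin L n L = 0"
  by (simp add: dsin_def)

lemma abs_dsin_le_1: "\<bar>dsin L n x\<bar> \<le> 1"
  by (simp add: dsin_def)

lemma continuous_on_dsin [continuous_intros]: "continuous_on A (dsin L n)"
  unfolding dsin_def by (intro continuous_intros)

lemma isCont_dsin: "isCont (dsin L n) x"
  unfolding dsin_def by (intro continuous_intros)

lemma borel_measurable_dsin [measurable]: "dsin L n \<in> borel_measurable borel"
  by (intro borel_measurable_continuous_onI continuous_intros)

section \<open>Action of the kernel on the sines, and their completeness\<close>

lemma
  assumes "dirichlet_heat_kernel L p"
  shows dirichlet_heat_kernel_continuous:
      "continuous_on ({0<..} \<times> {0..L} \<times> {0..L}) (\<lambda>(t, x, y). p t x y)"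
    and dirichlet_heat_kernel_boundary:
      "\<And>t y. t > 0 \<Longrightarrow> y \<in> {0..L} \<Longrightarrow> p t 0 y = 0 \<and> p t L y = 0"
    and dirichlet_heat_kernel_initial:
      "\<And>f. continuous_on {0..L} f \<Longrightarrow> f 0 = 0 \<Longrightarrow> f L = 0 \<Longrightarrow>
        uniform_limit {0..L} (\<lambda>t x. LINT y:{0..L}|lborel. p t x y * f y) f (at_right 0)"
  using assms unfolding dirichlet_heat_kernel_def by blast+

lemma dirichlet_heat_kernel_continuous_section:
  assumes "dirichlet_heat_kernel L p" "t > 0" "x \<in> {0..L}"
  shows "continuous_on {0..L} (p t x)"
proof -
  have "continuous_on {0..L} (\<lambda>y. (\<lambda>(t, x, y). p t x y) (t, x, y))"
    by (rule continuous_on_compose2[OF dirichlet_heat_kernel_continuous[OF assms(1)]])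
       (use assms in \<open>auto intro!: continuous_intros\<close>)
  then show ?thesis by simp
qed

text \<open>The minimum principle for the difference of two heat flows: the kernel applied to
  \<open>f\<close>, and \<open>k\<close> times a decaying sine. The function \<open>f\<close>
  vanishes outside a compact subinterval because the derivatives of \<open>p\<close> are controlled
  only for interior \<open>y\<close>; on \<open>{a..b}\<close> they are continuous and may be taken
  under the integral. The sign of \<open>m\<close> reflects the zero boundary values of both
  flows.\<close>

lemma dirichlet_heat_kernel_comparison:
  assumes L: "L > 0" and p: "dirichlet_heat_kernel L p"
    and f: "continuous_on {0..L} f" and ab: "0 < a" "a \<le> b" "b < L"
    and f0: "\<And>y. y \<in> {0..L} \<Longrightarrow> y \<notin> {a..b} \<Longrightarrow> f y = 0"
    and init: "\<And>x. x \<in> {0..L} \<Longrightarrow> m \<le> f x - k * dsin L n x" and m: "m \<le> 0"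
    and t: "t > 0" and x: "x \<in> {0..L}"
  shows "m \<le> integral {0..L} (\<lambda>y. p t x y * f y) - k * exp (- rate L n * t) * dsin L n x"
proof (rule field_le_epsilon)
  fix \<epsilon> :: real
  assume \<epsilon>: "\<epsilon> > 0"
  let ?D = "{0<..} \<times> {0<..<L} \<times> {0<..<L}"
  have "\<exists>pt px pxx.
     continuous_on ?D (\<lambda>(t, x, y). pt t x y) \<and>
     continuous_on ?D (\<lambda>(t, x, y). px t x y) \<and>
     continuous_on ?D (\<lambda>(t, x, y). pxx t x y) \<and>
     (\<forall>t>0. \<forall>x\<in>{0<..<L}. \<forall>y\<in>{0<..<L}.
       ((\<lambda>s. p s x y) has_real_derivative pt t x y) (at t) \<and>
       ((\<lambda>z. p t z y) has_real_derivative px t x y) (at x) \<and>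
       ((\<lambda>z. px t z y) has_real_derivative pxx t x y) (at x) \<and>
       pt t x y = 1 / 2 * pxx t x y)"
    using p unfolding dirichlet_heat_kernel_def by (elim conjE)
  then obtain pt px pxx where
    "continuous_on ?D (\<lambda>(t, x, y). pt t x y) \<and>
     continuous_on ?D (\<lambda>(t, x, y). px t x y) \<and>
     continuous_on ?D (\<lambda>(t, x, y). pxx t x y) \<and>
     (\<forall>t>0. \<forall>x\<in>{0<..<L}. \<forall>y\<in>{0<..<L}.
       ((\<lambda>s. p s x y) has_real_derivative pt t x y) (at t) \<and>
       ((\<lambda>z. p t z y) has_real_derivative px t x y) (at x) \<and>
       ((\<lambda>z. px t z y) has_real_derivative pxx t x y) (at x) \<and>
       pt t x y = 1 / 2 * pxx t x y)"
    by (elim exE) (rule that)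
  then have
    cpt: "continuous_on ?D (\<lambda>(t, x, y). pt t x y)" and
    cpx: "continuous_on ?D (\<lambda>(t, x, y). px t x y)" and
    cpxx: "continuous_on ?D (\<lambda>(t, x, y). pxx t x y)" and
    pde: "\<And>t x y. t>0 \<Longrightarrow> x\<in>{0<..<L} \<Longrightarrow> y\<in>{0<..<L} \<Longrightarrow>
           ((\<lambda>s. p s x y) has_real_derivative pt t x y) (at t) \<and>
           ((\<lambda>z. p t z y) has_real_derivative px t x y) (at x) \<and>
           ((\<lambda>z. px t z y) has_real_derivative pxx t x y) (at x) \<and>
           pt t x y = 1 / 2 * pxx t x y"
    by blast+
  note cp = dirichlet_heat_kernel_continuous[OF p]
  have cf: "continuous_on {a..b} f" by (rule continuous_on_subset[OF f]) (use ab in auto)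
  have restr: "integral {0..L} (\<lambda>y. p t x y * f y) = integral {a..b} (\<lambda>y. p t x y * f y)" for t x
  proof -
    have "integral {0..L} (\<lambda>y. p t x y * f y) = integral {0..L} (\<lambda>y. if y \<in> {a..b} then p t x y * f y else 0)"
      by (rule integral_cong) (use f0 in auto)
    also have "\<dots> = integral {a..b} (\<lambda>y. p t x y * f y)"
      by (subst integral_restrict_Int) (use ab in \<open>auto simp: Int_absorb1\<close>)
    finally show ?thesis .
  qed
  define w where "w t x = integral {a..b} (\<lambda>y. p t x y * f y) - k * exp (- rate L n * t) * dsin L n x" for t x
  \<comment> \<open>One statement serves \<open>p\<close> itself, with \<open>V\<close> the closed
    interval, and its derivatives, with \<open>V\<close> the open one.\<close>
  have cint: "continuous_on (U \<times> {a..b}) (\<lambda>(q, y). case q of (t, x) \<Rightarrow> h t x y * f y)"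
    if h: "continuous_on ({0<..} \<times> V \<times> V) (\<lambda>(t, x, y). h t x y :: real)" and "{a..b} \<subseteq> V" "U \<subseteq> {0<..} \<times> V"
    for h U V
  proof -
    have "continuous_on (U \<times> {a..b}) (\<lambda>q. (\<lambda>(t, x, y). h t x y) (fst (fst q), snd (fst q), snd q))"
      by (rule continuous_on_compose2[OF h]) (use that in \<open>auto intro!: continuous_intros\<close>)
    moreover have "continuous_on (U \<times> {a..b}) (\<lambda>q. f (snd q))"
      by (rule continuous_on_compose2[OF cf]) (auto intro!: continuous_intros)
    ultimately show ?thesis by (auto simp: case_prod_unfold intro!: continuous_intros)
  qed
  have csec: "(\<lambda>y. h t x y * f y) integrable_on {a..b}"
    if h: "continuous_on ({0<..} \<times> V \<times> V) (\<lambda>(t, x, y). h t x y :: real)" and "{a..b} \<subseteq> V" "t > 0" "x \<in> V"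
    for h V t x
  proof -
    have "continuous_on {a..b} (\<lambda>y. (\<lambda>(t, x, y). h t x y) (t, x, y))"
      by (rule continuous_on_compose2[OF h]) (use that in \<open>auto intro!: continuous_intros\<close>)
    then show ?thesis by (intro integrable_continuous_interval continuous_intros cf) simp
  qed
  have ab1: "{a..b} \<subseteq> {0..L}" "{a..b} \<subseteq> {0<..<L}" using ab by auto
  have cpi: "continuous_on ({0<..} \<times> {0<..<L} \<times> {0<..<L}) (\<lambda>(t, x, y). p t x y)"
    by (rule continuous_on_subset[OF cp]) auto
  have exp_d: "((\<lambda>s. k * exp (- rate L n * s) * dsin L n x) has_real_derivative
      - rate L n * (k * exp (- rate L n * t) * dsin L n x)) (at t)" for t x
    by (auto intro!: derivative_eq_intros)
  have sin_d: "((\<lambda>z. c * dsin L n z) has_real_derivative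
      c * (real n * pi / L) * cos (real n * pi / L * x)) (at x)" for c x
    using L unfolding dsin_def by (auto intro!: derivative_eq_intros)
  have cos_d: "((\<lambda>z. c * (real n * pi / L) * cos (real n * pi / L * z)) has_real_derivative
      - (2 * rate L n) * (c * dsin L n x)) (at x)" for c x
    using L unfolding dsin_def rate_def by (auto intro!: derivative_eq_intros simp: power2_eq_square)
  have d1: "((\<lambda>s. integral {a..b} (\<lambda>y. p s x y * f y)) has_real_derivative
      integral {a..b} (\<lambda>y. pt t x y * f y)) (at t)" if "t > 0" "x \<in> {0<..<L}" for t x
  proof -
    have "((\<lambda>s. integral (cbox a b) (\<lambda>y. p s x y * f y)) has_field_derivative
      integral (cbox a b) (\<lambda>y. pt t x y * f y)) (at t within {0<..})"
    proof (rule leibniz_rule_field_derivative)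
      fix s y :: real assume "s \<in> {0<..}" "y \<in> cbox a b"
      then show "((\<lambda>s. p s x y * f y) has_real_derivative pt s x y * f y) (at s within {0<..})"
        using pde[of s x y] that ab1 by (auto intro!: DERIV_cmult_right simp: at_within_open[of _ "{0<..}"])
    next
      have "continuous_on ({0<..} \<times> {a..b}) (\<lambda>q. (\<lambda>(q, y). case q of (t, x) \<Rightarrow> pt t x y
          * f y) ((fst q, x), snd q))"
        by (rule continuous_on_compose2[OF cint[OF cpt ab1(2), of "{0<..} \<times> {0<..<L}"]])
           (use that in \<open>auto intro!: continuous_intros\<close>)
      then show "continuous_on ({0<..} \<times> cbox a b) (\<lambda>(t, y). pt t x y * f y)"
        by (simp add: case_prod_unfold)
    qed (use that csec[OF cpi ab1(2)] in auto)
    then show ?thesis using that by (simp add: at_within_open[of _ "{0<..}"])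
  qed
  have dx: "((\<lambda>z. integral {a..b} (\<lambda>y. h t z y * f y)) has_real_derivative
      integral {a..b} (\<lambda>y. h' t x y * f y)) (at x)" if "t > 0" "x \<in> {0<..<L}"
      and h: "continuous_on ({0<..} \<times> {0<..<L} \<times> {0<..<L}) (\<lambda>(t, x, y). h t x y :: real)"
      and h': "continuous_on ({0<..} \<times> {0<..<L} \<times> {0<..<L}) (\<lambda>(t, x, y). h' t x y :: real)"
      and d: "\<And>z y. z \<in> {0<..<L} \<Longrightarrow> y \<in> {0<..<L} \<Longrightarrow> ((\<lambda>z. h t z y) has_real_derivative h' t z y) (at z)"
    for t x h h'
  proof -
    have "((\<lambda>z. integral (cbox a b) (\<lambda>y. h t z y * f y)) has_field_derivative
      integral (cbox a b) (\<lambda>y. h' t x y * f y)) (at x within {0<..<L})"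
    proof (rule leibniz_rule_field_derivative)
      fix z y :: real assume "z \<in> {0<..<L}" "y \<in> cbox a b"
      then show "((\<lambda>z. h t z y * f y) has_real_derivative h' t z y * f y) (at z within {0<..<L})"
        using d[of z y] ab1 by (auto intro!: DERIV_cmult_right simp: at_within_open[of _ "{0<..<L}"])
    next
      have "continuous_on ({0<..<L} \<times> {a..b}) (\<lambda>q. (\<lambda>(q, y). case q of (t, x) \<Rightarrow> h' t x y
          * f y) ((t, fst q), snd q))"
        by (rule continuous_on_compose2[OF cint[OF h' ab1(2), of "{0<..} \<times> {0<..<L}"]])
           (use that in \<open>auto intro!: continuous_intros\<close>)
      then show "continuous_on ({0<..<L} \<times> cbox a b) (\<lambda>(x, y). h' t x y * f y)"
        by (simp add: case_prod_unfold)
    qed (use that csec[OF h ab1(2)] in auto)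
    then show ?thesis using that by (simp add: at_within_open[of _ "{0<..<L}"])
  qed
  \<comment> \<open>The initial data are attained only in the limit, so the principle is applied at
    level \<open>m - \<epsilon>\<close>: half of \<open>\<epsilon>\<close> pays for the convergence
    of the kernel integral, half for that of the exponential factor.\<close>
  have "m - \<epsilon> \<le> w t x"
  proof (rule heat_minimum_principle[where L = L and m = "m - \<epsilon>" and w = w and
      wt = "\<lambda>t x. integral {a..b} (\<lambda>y. pt t x y * f y) + rate L n * (k * exp (- rate L n * t) * dsin L n x)" and
      wx = "\<lambda>t x. integral {a..b} (\<lambda>y. px t x y * f y) - k * exp (- rate L n * t) * (real n * pi / L)
          * cos (real n * pi / L * x)" and
      wxx = "\<lambda>t x. integral {a..b} (\<lambda>y. pxx t x y * f y) + 2 * rate L n * (k * exp (- rate L n * t)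
          * dsin L n x)"])
    have "continuous_on ({0<..} \<times> {0..L}) (\<lambda>q. integral (cbox a b) ((\<lambda>q y. case q of (t, x) \<Rightarrow> p t x y
        * f y) q))"
      by (rule integral_continuous_on_param) (use cint[OF cp ab1(1)] in auto)
    moreover have "continuous_on ({0<..} \<times> {0..L}) (\<lambda>q. dsin L n (snd q))"
      by (rule continuous_on_compose2[OF continuous_on_dsin[of UNIV]]) (auto intro!: continuous_intros)
    ultimately show "continuous_on ({0<..} \<times> {0..L}) (\<lambda>(t, x). w t x)"
      unfolding w_def by (auto simp: case_prod_unfold intro!: continuous_intros)
  next
    fix t x :: real assume tx: "t > 0" "x \<in> {0<..<L}"
    show "((\<lambda>s. w s x) has_real_derivative
          integral {a..b} (\<lambda>y. pt t x y * f y) + rate L n * (k * exp (- rate L n * t) * dsin L n x)) (at t)"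
      using DERIV_diff[OF d1[OF tx] exp_d[of x t]] by (simp add: w_def[abs_def])
    show "((\<lambda>z. w t z) has_real_derivative
          integral {a..b} (\<lambda>y. px t x y * f y) - k * exp (- rate L n * t) * (real n * pi / L) * cos (real n
              * pi / L * x)) (at x)"
      using DERIV_diff[OF dx[OF tx cpi cpx] sin_d[of "k * exp (- rate L n * t)" x]] pde[OF tx(1)]
      by (simp add: w_def[abs_def])
    show "((\<lambda>z. integral {a..b} (\<lambda>y. px t z y * f y) - k * exp (- rate L n * t) * (real n * pi / L)
        * cos (real n * pi / L * z))
        has_real_derivative integral {a..b} (\<lambda>y. pxx t x y * f y) + 2 * rate L n * (k * exp (- rate L n * t)
            * dsin L n x)) (at x)"
      using DERIV_diff[OF dx[OF tx cpx cpxx] cos_d[of "k * exp (- rate L n * t)" x]] pde[OF tx(1)]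
      by simp
    have "integral {a..b} (\<lambda>y. pt t x y * f y) = integral {a..b} (\<lambda>y. 1 / 2 * (pxx t x y * f y))"
      by (rule integral_cong) (use pde[OF tx] ab1 in auto)
    then show "integral {a..b} (\<lambda>y. pt t x y * f y) + rate L n * (k * exp (- rate L n * t) * dsin L n x) =
       1 / 2 * (integral {a..b} (\<lambda>y. pxx t x y * f y) + 2 * rate L n * (k * exp (- rate L n * t) * dsin L n x))"
      by simp
  next
    fix t :: real assume t: "t > 0"
    have z: "integral {a..b} (\<lambda>y. p t x y * f y) = 0" if "x = 0 \<or> x = L" for x
    proof -
      have "integral {a..b} (\<lambda>y. p t x y * f y) = integral {a..b} (\<lambda>y. 0)"
        by (rule integral_cong) (use dirichlet_heat_kernel_boundary[OF p t] ab1 that in auto)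
      then show ?thesis by simp
    qed
    show "m - \<epsilon> \<le> w t 0" "m - \<epsilon> \<le> w t L" using z m \<epsilon> L by (auto simp: w_def)
  next
    have lint: "(LINT y:{0..L}|lborel. p t x y * f y) = integral {0..L} (\<lambda>y. p t x y * f y)"
      if "t > 0" "x \<in> {0..L}" for t x
      by (rule set_borel_integral_eq_integral(2)[OF borel_integrable_atLeastAtMost'])
         (intro continuous_intros f dirichlet_heat_kernel_continuous_section[OF p that])
    have f0L: "f 0 = 0" "f L = 0" using f0 ab L by auto
    have e1: "\<forall>\<^sub>F t in at_right 0. \<forall>x\<in>{0..L}. dist (LINT y:{0..L}|lborel. p t x y * f y) (f x) < \<epsilon> / 2"
      by (rule uniform_limitD[OF dirichlet_heat_kernel_initial[OF p f f0L] half_gt_zero[OF \<epsilon>]])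
    have "((\<lambda>t. \<bar>k\<bar> * \<bar>exp (- rate L n * t) - 1\<bar>) \<longlongrightarrow> \<bar>k\<bar> * \<bar>exp (- rate L n * 0) - 1\<bar>) (at_right 0)"
      by (intro tendsto_intros)
    then have lim: "((\<lambda>t. \<bar>k\<bar> * \<bar>exp (- rate L n * t) - 1\<bar>) \<longlongrightarrow> 0) (at_right 0)" by simp
    note e2 = order_tendstoD(2)[OF lim half_gt_zero[OF \<epsilon>]]
    have e3: "\<forall>\<^sub>F t in at_right (0::real). t > 0" by (rule eventually_at_right_less)
    show "\<forall>\<^sub>F t in at_right 0. \<forall>x\<in>{0..L}. m - \<epsilon> \<le> w t x"
      using e1 e2 e3
    proof eventually_elim
      case (elim t)
      show ?case
      proof
        fix x assume x: "x \<in> {0..L}"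
        have "\<bar>k * (exp (- rate L n * t) - 1) * dsin L n x\<bar> \<le> \<bar>k\<bar> * \<bar>exp (- rate L n * t) - 1\<bar> * 1"
          unfolding abs_mult by (intro mult_left_mono abs_dsin_le_1) auto
        then have "\<bar>k * exp (- rate L n * t) * dsin L n x - k * dsin L n x\<bar> < \<epsilon> / 2"
          using elim by (simp add: algebra_simps)
        moreover have "\<bar>integral {a..b} (\<lambda>y. p t x y * f y) - f x\<bar> < \<epsilon> / 2"
          using elim(1)[rule_format, OF x] lint[OF elim(3) x] restr[of t x] by (simp add: dist_real_def)
        ultimately show "m - \<epsilon> \<le> w t x" using init[OF x] unfolding w_def abs_less_iff by linarith
      qed
    qed
  qed (use t x in auto)
  then show "m \<le> integral {0..L} (\<lambda>y. p t x y * f y) - k * exp (- rate L n * t) * dsin L n x + \<epsilon>"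
    using restr[of t x] by (simp add: w_def)
qed

lemma continuous_on_interval_bounded:
  fixes f :: "real \<Rightarrow> real"
  assumes "continuous_on {a..b} f"
  obtains B where "B \<ge> 0" "\<And>y. y \<in> {a..b} \<Longrightarrow> \<bar>f y\<bar> \<le> B"
proof -
  have "bounded (f ` {a..b})"
    by (rule compact_imp_bounded[OF compact_continuous_image[OF assms]]) simp
  then obtain B where "\<forall>y\<in>{a..b}. \<bar>f y\<bar> \<le> B" unfolding bounded_iff by auto
  then show ?thesis by (intro that[of "max B 0"]) (auto simp: le_max_iff_disj)
qed

text \<open>The defining property controls the kernel only in the interior, so the sine is first replaced by its
  soft thresholding at level \<open>\<epsilon>\<close>, which has compact support in the open interval.\<close>

lemma dirichlet_heat_kernel_dsin:
  assumes L: "L > 0" and p: "dirichlet_heat_kernel L p" and t: "t > 0" and x: "x \<in> {0..L}"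
  shows "integral {0..L} (\<lambda>y. p t x y * dsin L n y) = exp (- rate L n * t) * dsin L n x"
proof -
  let ?I = "integral {0..L} (\<lambda>y. p t x y * dsin L n y)"
  let ?E = "exp (- rate L n * t) * dsin L n x"
  note cp = dirichlet_heat_kernel_continuous_section[OF p t x]
  obtain B where B0: "B \<ge> 0" and B: "\<And>y. y \<in> {0..L} \<Longrightarrow> \<bar>p t x y\<bar> \<le> B"
    using continuous_on_interval_bounded[OF cp] by blast
  \<comment> \<open>The values 1 and -1 of \<open>k\<close> give the two inequalities. Thresholding
    costs \<open>\<epsilon>\<close> in the initial data and at most
    \<open>L * B * \<epsilon>\<close> in the integral.\<close>
  have *: "k * ?E - (1 + L * B) * \<epsilon> \<le> k * ?I" if k: "\<bar>k\<bar> = 1" and e: "\<epsilon> > 0" for k \<epsilon>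
  proof -
    define f where "f y = k * (dsin L n y - max (-\<epsilon>) (min \<epsilon> (dsin L n y)))" for y
    have cf: "continuous_on {0..L} f" unfolding f_def by (intro continuous_intros)
    obtain d1 where d1: "d1 > 0" "\<And>y. \<bar>y\<bar> < d1 \<Longrightarrow> \<bar>dsin L n y\<bar> < \<epsilon>"
    proof -
      obtain d where "d > 0" "\<forall>y. dist y 0 < d \<longrightarrow> dist (dsin L n y) (dsin L n 0) < \<epsilon>"
        using isCont_dsin[of 0 L n, unfolded continuous_at_eps_delta, rule_format, OF e] by blast
      then show thesis by - (rule that[of d], auto simp: dist_real_def)
    qed
    obtain d2 where d2: "d2 > 0" "\<And>y. \<bar>y - L\<bar> < d2 \<Longrightarrow> \<bar>dsin L n y\<bar> < \<epsilon>"
    proof -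
      obtain d where "d > 0" "\<forall>y. dist y L < d \<longrightarrow> dist (dsin L n y) (dsin L n L) < \<epsilon>"
        using isCont_dsin[of L L n, unfolded continuous_at_eps_delta, rule_format, OF e] by blast
      then show thesis using L by - (rule that[of d], auto simp: dist_real_def)
    qed
    define d where "d = min (min d1 d2) L / 2"
    have d: "d > 0" "d < d1" "d < d2" "d \<le> L / 2" using d1 d2 L by (auto simp: d_def min_def)
    have fe: "\<bar>f y - k * dsin L n y\<bar> \<le> \<epsilon>" for y
    proof -
      have "f y - k * dsin L n y = k * (- max (-\<epsilon>) (min \<epsilon> (dsin L n y)))"
        by (simp add: f_def algebra_simps)
      then have "\<bar>f y - k * dsin L n y\<bar> = \<bar>max (-\<epsilon>) (min \<epsilon> (dsin L n y))\<bar>" using k by (simp add: abs_mult)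
      then show ?thesis using e by (auto simp: max_def min_def)
    qed
    have I: "- \<epsilon> \<le> integral {0..L} (\<lambda>y. p t x y * f y) - k * exp (- rate L n * t) * dsin L n x"
    proof (rule dirichlet_heat_kernel_comparison[OF L p cf, of d "L - d"])
      show "f y = 0" if "y \<in> {0..L}" "y \<notin> {d..L-d}" for y
      proof -
        have "\<bar>y\<bar> < d1 \<or> \<bar>y - L\<bar> < d2" using that d by auto
        then have "\<bar>dsin L n y\<bar> < \<epsilon>" using d1(2) d2(2) by blast
        then show ?thesis by (auto simp: f_def max_def min_def abs_if split: if_splits)
      qed
      show "- \<epsilon> \<le> f y - k * dsin L n y" for y using fe[of y] by linarith
    qed (use d e t x in auto)
    have ci: "(\<lambda>y. p t x y * h y) integrable_on {0..L}" if "continuous_on {0..L} h" for h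
      by (intro integrable_continuous_interval continuous_intros cp that)
    have "integral {0..L} (\<lambda>y. p t x y * f y) - k * ?I
        = integral {0..L} (\<lambda>y. p t x y * f y - k * (p t x y * dsin L n y))"
      using ci[OF cf] ci[OF continuous_on_dsin] by (subst integral_diff) (auto intro: integrable_on_mult_right)
    also have "\<dots> = integral {0..L} (\<lambda>y. p t x y * (f y - k * dsin L n y))"
      by (simp add: algebra_simps)
    also have "\<dots> \<le> integral {0..L} (\<lambda>y. B * \<epsilon>)"
    proof (rule integral_le)
      fix y assume y: "y \<in> {0..L}"
      have "\<bar>p t x y * (f y - k * dsin L n y)\<bar> \<le> B * \<epsilon>"
        unfolding abs_mult using B[OF y] fe[of y] B0 by (intro mult_mono) auto
      then show "p t x y * (f y - k * dsin L n y) \<le> B * \<epsilon>" by linarith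
    qed (auto intro!: ci continuous_intros cf)
    also have "\<dots> = L * B * \<epsilon>" using L by simp
    finally show ?thesis using I by (simp add: algebra_simps)
  qed
  have **: "k * ?E \<le> k * ?I" if "\<bar>k\<bar> = 1" for k
  proof (rule field_le_epsilon)
    fix e :: real assume e: "e > 0"
    have pos: "1 + L * B > 0" using L B0 by (simp add: add_pos_nonneg)
    show "k * ?E \<le> k * ?I + e"
      using *[OF that, of "e / (1 + L * B)"] e pos by auto
  qed
  show ?thesis using **[of 1] **[of "-1"] by simp
qed

text \<open>The hypothesis extends to all \<open>sin (\<pi> y / L) P (cos (\<pi> y / L))\<close> with \<open>P\<close> a polynomial, and these
  approximate \<open>h y sin (\<pi> y / L)\<close> by the Weierstrass theorem in the variable \<open>cos (\<pi> y / L)\<close>.\<close>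

lemma dsin_complete:
  assumes L: "L > 0" and h: "continuous_on {0..L} h"
    and 0: "\<And>n. integral {0..L} (\<lambda>y. h y * dsin L n y) = 0"
    and x: "x \<in> {0..L}"
  shows "h x = (0::real)"
proof -
  define c where "c y = cos (pi / L * y)" for y
  define s where "s y = dsin L 1 y" for y
  have cc [continuous_intros]: "continuous_on A c" "continuous_on A s" for A
    unfolding c_def s_def by (intro continuous_intros)+
  have int: "(\<lambda>y. h y * g y) integrable_on {0..L}" if "continuous_on {0..L} g" for g
    by (intro integrable_continuous_interval continuous_intros h that)
  \<comment> \<open>Induction on the power: a factor \<open>c\<close> turns \<open>dsin L n\<close>
    into the mean of its two neighbours, so the hypothesis for all \<open>n\<close> carries
    over.\<close>
  have mono: "integral {0..L} (\<lambda>y. h y * (dsin L n y * c y ^ k)) = 0" for n k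
  proof (induction k arbitrary: n)
    case (Suc k)
    show ?case
    proof (cases n)
      case (Suc m)
      have *: "dsin L n y * c y = (dsin L (Suc n) y + dsin L m y) / 2" for y
      proof -
        have "real n * pi / L * y + pi / L * y = real (Suc n) * pi / L * y"
          "real n * pi / L * y - pi / L * y = real m * pi / L * y"
          by (simp_all add: Suc algebra_simps add_divide_distrib)
        then show ?thesis unfolding dsin_def c_def by (simp only: sin_times_cos)
      qed
      have "h y * (dsin L n y * c y ^ Suc k)
          = 1/2 * (h y * (dsin L (Suc n) y * c y ^ k)) + 1/2 * (h y * (dsin L m y * c y ^ k))" for y
      proof -
        have "h y * (dsin L n y * c y ^ Suc k) = h y * ((dsin L n y * c y) * c y ^ k)" by simp
        then show ?thesis unfolding * by (simp add: field_simps)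
      qed
      then have "integral {0..L} (\<lambda>y. h y * (dsin L n y * c y ^ Suc k))
          = integral {0..L} (\<lambda>y. 1/2 * (h y * (dsin L (Suc n) y * c y ^ k))) + integral {0..L} (\<lambda>y. 1/2
              * (h y * (dsin L m y * c y ^ k)))"
        by (subst integral_add[symmetric])
           (auto intro!: integrable_on_mult_right int continuous_intros)
      also have "\<dots> = 0" unfolding integral_mult_right Suc.IH by simp
      finally show ?thesis .
    qed simp
  qed (simp add: 0)
  define g where "g y = h y * s y" for y
  have cg: "continuous_on {0..L} g" unfolding g_def by (intro continuous_intros h)
  obtain B where B0: "B \<ge> 0" and B: "\<And>y. y \<in> {0..L} \<Longrightarrow> \<bar>h y\<bar> \<le> B"
    using continuous_on_interval_bounded[OF h] by blast
  have "integral {0..L} (\<lambda>y. g y * g y) \<le> 0"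
  proof (rule field_le_epsilon)
    fix e :: real assume e: "e > 0"
    define \<epsilon> where "\<epsilon> = e / (L * B + 1)"
    have LB: "L * B + 1 > 0" using L B0 by (simp add: add_nonneg_pos)
    have \<epsilon>: "\<epsilon> > 0" "L * B * \<epsilon> \<le> e"
      using e LB by (auto simp: \<epsilon>_def field_simps)
    \<comment> \<open>This is \<open>g\<close> as a function of the cosine:
      \<open>H (c y) = g y\<close> on \<open>{0..L}\<close>, where the cosine is injective.\<close>
    define H where "H z = g (L / pi * arccos z)" for z
    have "continuous_on {-1..1} H"
      unfolding H_def
    proof (rule continuous_on_compose2[OF cg])
      show "continuous_on {-1..1} (\<lambda>z. L / pi * arccos z)" by (intro continuous_intros) auto
      show "(\<lambda>z. L / pi * arccos z) ` {-1..1} \<subseteq> {0..L}"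
        using L by (auto simp: arccos_lbound arccos_ubound field_simps intro!: mult_right_mono)
    qed
    then obtain P where P: "real_polynomial_function P" "\<And>z. z \<in> {-1..1} \<Longrightarrow> \<bar>H z - P z\<bar> < \<epsilon>"
      using Stone_Weierstrass_real_polynomial_function[of "{-1..1}" H \<epsilon>] \<epsilon> by auto
    obtain a N where Pa: "P = (\<lambda>z. \<Sum>i\<le>N. a i * z ^ i)" using P(1) real_polynomial_function_iff_sum by blast
    have app: "\<bar>g y - P (c y)\<bar> \<le> \<epsilon>" if y: "y \<in> {0..L}" for y
    proof -
      have "0 \<le> pi / L * y" "pi / L * y \<le> pi" using y L by (auto simp: field_simps)
      then have "H (c y) = g y" unfolding H_def c_def using L by (simp add: arccos_cos)
      then show ?thesis using P(2)[of "c y"] by (simp add: c_def less_imp_le)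
    qed
    have "integral {0..L} (\<lambda>y. g y * P (c y)) = integral {0..L} (\<lambda>y. \<Sum>i\<le>N. a i * (h y * (dsin L 1 y
        * c y ^ i)))"
      by (simp add: Pa g_def s_def sum_distrib_left mult_ac)
    also have "\<dots> = (\<Sum>i\<le>N. integral {0..L} (\<lambda>y. a i * (h y * (dsin L 1 y * c y ^ i))))"
      by (intro integral_sum integrable_on_mult_right int continuous_intros) auto
    also have "\<dots> = 0" by (simp only: integral_mult_right mono) simp
    finally have P0: "integral {0..L} (\<lambda>y. g y * P (c y)) = 0" .
    have cP: "continuous_on {0..L} (\<lambda>y. P (c y))" unfolding Pa by (intro continuous_intros)
    \<comment> \<open>Since \<open>g\<close> is orthogonal to the approximating polynomial in
      \<open>c\<close>, one factor \<open>g\<close> may be replaced by the approximation error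
      without changing the integral.\<close>
    have "integral {0..L} (\<lambda>y. g y * g y) = integral {0..L} (\<lambda>y. g y * g y) - integral {0..L} (\<lambda>y. g y
        * P (c y))"
      using P0 by simp
    also have "\<dots> = integral {0..L} (\<lambda>y. g y * g y - g y * P (c y))"
      by (rule integral_diff[symmetric]) (intro integrable_continuous_interval continuous_intros cg cP)+
    also have "\<dots> \<le> integral {0..L} (\<lambda>y. B * \<epsilon>)"
    proof (rule integral_le)
      fix y assume y: "y \<in> {0..L}"
      have "\<bar>s y\<bar> \<le> 1" by (simp add: s_def abs_dsin_le_1)
      then have "\<bar>g y\<bar> \<le> B * 1" unfolding g_def abs_mult using B[OF y] B0 by (intro mult_mono) auto
      then have "\<bar>g y * (g y - P (c y))\<bar> \<le> B * \<epsilon>"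
        unfolding abs_mult using app[OF y] B0 by (intro mult_mono) auto
      then show "g y * g y - g y * P (c y) \<le> B * \<epsilon>" by (simp add: algebra_simps)
    qed (auto intro!: integrable_continuous_interval continuous_intros cg cP)
    also have "\<dots> = L * B * \<epsilon>" using L by simp
    finally show "integral {0..L} (\<lambda>y. g y * g y) \<le> 0 + e" using \<epsilon> by simp
  qed
  moreover have "integral {0..L} (\<lambda>y. g y * g y) \<ge> 0"
    by (intro integral_nonneg integrable_continuous_interval continuous_intros cg) auto
  ultimately have "integral {0..L} (\<lambda>y. g y * g y) = 0" by (rule antisym)
  moreover have "(\<lambda>y. g y * g y) integrable_on {0..L}"
    by (intro integrable_continuous_interval continuous_intros cg)
  ultimately have "((\<lambda>y. g y * g y) has_integral 0) {0..L}"
    using integrable_integral by fastforce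
  then have g0: "g y = 0" if "y \<in> {0..L}" for y
    using has_integral_0_cbox_imp_0[of 0 L "\<lambda>y. g y * g y" y] that L cg by (auto intro!: continuous_intros)
  have h0: "h y = 0" if "y \<in> {0<..<L}" for y
  proof -
    have "sin (pi / L * y) > 0" using that L by (intro sin_gt_zero) (auto simp: field_simps)
    then show ?thesis using g0[of y] that by (simp add: g_def s_def dsin_def)
  qed
  \<comment> \<open>The sine factor vanishes at 0 and \<open>L\<close>, so the endpoints are reached
    by continuity.\<close>
  show "h x = 0"
  proof (rule continuous_constant_on_closure[of "{0<..<L}" h 0])
    show "continuous_on (closure {0<..<L}) h" using h L by simp
  qed (use h0 x L in auto)
qed

section \<open>Integration over the interval, orthogonality and Bessel's inequality\<close>

abbreviation itv :: "real \<Rightarrow> real measure" where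
  "itv L \<equiv> restrict_space lborel {0..L}"

lemma finite_measure_itv: "finite_measure (itv L)"
  by (rule finite_measureI) (simp add: emeasure_restrict_space space_restrict_space emeasure_lborel_Icc_eq)

lemma borel_measurable_itv_continuous:
  assumes "continuous_on {0..L} f"
  shows "f \<in> borel_measurable (itv L)"
proof -
  have "f \<in> borel_measurable (restrict_space borel {0..L})"
    by (rule borel_measurable_continuous_on_restrict[OF assms])
  then show ?thesis by (simp add: measurable_def space_restrict_space sets_restrict_space)
qed

lemma borel_measurable_itvI: "f \<in> borel_measurable borel \<Longrightarrow> f \<in> borel_measurable (itv L)"
  by (simp add: measurable_restrict_space1)

lemma integrable_itv_bounded:
  fixes f :: "real \<Rightarrow> real"
  assumes "f \<in> borel_measurable (itv L)" "\<And>x. x \<in> {0..L} \<Longrightarrow> \<bar>f x\<bar> \<le> B"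
  shows "integrable (itv L) f"
  by (rule finite_measure.integrable_const_bound[OF finite_measure_itv, of _ B])
     (use assms in \<open>auto simp: space_restrict_space\<close>)

lemma integrable_itv_continuous:
  fixes f :: "real \<Rightarrow> real"
  assumes "continuous_on {0..L} f"
  shows "integrable (itv L) f"
proof -
  obtain B where "\<And>y. y \<in> {0..L} \<Longrightarrow> \<bar>f y\<bar> \<le> B"
    using continuous_on_interval_bounded[OF assms] by blast
  then show ?thesis by (intro integrable_itv_bounded borel_measurable_itv_continuous assms)
qed

lemma integral_itv:
  fixes f :: "real \<Rightarrow> real"
  shows "(LINT x|itv L. f x) = (LINT x:{0..L}|lborel. f x)"
  by (simp add: integral_restrict_space set_lebesgue_integral_def)

lemma integral_itv_continuous:
  fixes f :: "real \<Rightarrow> real"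
  assumes "continuous_on {0..L} f"
  shows "(LINT x|itv L. f x) = integral {0..L} f"
  unfolding integral_itv
  by (rule set_borel_integral_eq_integral(2)[OF borel_integrable_atLeastAtMost'[OF assms]])

lemma integral_itv_cong:
  fixes f :: "real \<Rightarrow> real"
  assumes "\<And>x. x \<in> {0..L} \<Longrightarrow> f x = g x"
  shows "(LINT x|itv L. f x) = (LINT x|itv L. g x)"
  by (rule Bochner_Integration.integral_cong) (auto simp: space_restrict_space assms)

definition dcos :: "real \<Rightarrow> nat \<Rightarrow> real \<Rightarrow> real" where
  "dcos L n x = cos (real n * pi / L * x)"

lemma continuous_on_dcos [continuous_intros]: "continuous_on A (dcos L n)"
  unfolding dcos_def by (intro continuous_intros)

lemma integral_dcos:
  assumes L: "L > 0"
  shows "(LINT x|itv L. dcos L n x) = (if n = 0 then L else 0)"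
proof (cases "n = 0")
  case True
  then show ?thesis using L by (simp add: dcos_def measure_restrict_space)
next
  case False
  let ?k = "real n * pi / L"
  have k: "?k > 0" using L False by simp
  have d: "((\<lambda>x. sin (?k * x) / ?k) has_real_derivative cos (?k * x)) (at x within S)" for x S
    using L False by (auto intro!: derivative_eq_intros)
  have "((\<lambda>x. cos (?k * x)) has_integral (sin (?k * L) / ?k - sin (?k * 0) / ?k)) {0..L}"
    by (rule fundamental_theorem_of_calculus)
       (use L d in \<open>auto simp: has_real_derivative_iff_has_vector_derivative[symmetric]\<close>)
  then have "integral {0..L} (dcos L n) = 0"
    using L by (simp add: dcos_def[abs_def] integral_unique)
  then show ?thesis using False by (subst integral_itv_continuous) (auto intro!: continuous_intros)
qed

lemma
  assumes L: "L > 0"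
  shows dsin_orthogonal: "(LINT x|itv L. dsin L n x * dsin L m x) = (if n = m \<and> n > 0 then L / 2 else 0)"
    and dcos_orthogonal: "0 < n \<Longrightarrow> (LINT x|itv L. dcos L n x * dcos L m x) = (if n = m then L / 2 else 0)"
proof -
  have ss: "(LINT x|itv L. dsin L n x * dsin L m x) = (if n = m \<and> n > 0 then L / 2 else 0) \<and>
    (0 < n \<longrightarrow> (LINT x|itv L. dcos L n x * dcos L m x) = (if n = m then L / 2 else 0)) \<and>
    (0 < m \<longrightarrow> (LINT x|itv L. dcos L n x * dcos L m x) = (if n = m then L / 2 else 0))"
    if "m \<le> n" for n m
  proof -
    have a: "real n * pi / L * x - real m * pi / L * x = real (n - m) * pi / L * x"
      "real n * pi / L * x + real m * pi / L * x = real (n + m) * pi / L * x" for x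
      using that by (simp_all add: of_nat_diff algebra_simps diff_divide_distrib add_divide_distrib)
    have s: "dsin L n x * dsin L m x = 1/2 * dcos L (n - m) x - 1/2 * dcos L (n + m) x" for x
      unfolding dsin_def dcos_def sin_times_sin a by simp
    have c: "dcos L n x * dcos L m x = 1/2 * dcos L (n - m) x + 1/2 * dcos L (n + m) x" for x
      unfolding dsin_def dcos_def cos_times_cos a by simp
    have i: "integrable (itv L) (\<lambda>x. 1/2 * dcos L k x)" for k
      by (intro integrable_itv_continuous continuous_intros)
    show ?thesis unfolding s c
      using that L by (auto simp: Bochner_Integration.integral_diff[OF i i]
          Bochner_Integration.integral_add[OF i i] integral_dcos
          simp del: times_divide_eq_left)
  qed
  show "(LINT x|itv L. dsin L n x * dsin L m x) = (if n = m \<and> n > 0 then L / 2 else 0)"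
    using ss[of m n] ss[of n m] by (cases "m \<le> n") (auto simp: mult.commute)
  show "(LINT x|itv L. dcos L n x * dcos L m x) = (if n = m then L / 2 else 0)" if "0 < n"
    using ss[of m n] ss[of n m] that by (cases "m \<le> n") (auto simp: mult.commute)
qed

text \<open>The terms are dominated by \<open>|c n| * |g x|\<close>, whose integrals are summable.
  It serves both the series of the kernel and that of the semigroup.\<close>

lemma integral_suminf_mult:
  fixes c :: "nat \<Rightarrow> real" and \<phi> :: "nat \<Rightarrow> 'a \<Rightarrow> real"
  assumes c: "summable (\<lambda>n. \<bar>c n\<bar>)" and g: "integrable N g"
    and \<phi>: "\<And>n. \<phi> n \<in> borel_measurable N" "\<And>n x. \<bar>\<phi> n x\<bar> \<le> 1"
  shows "summable (\<lambda>n. c n * (LINT x|N. \<phi> n x * g x))"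
    and "(LINT x|N. (\<Sum>n. c n * \<phi> n x) * g x) = (\<Sum>n. c n * (LINT x|N. \<phi> n x * g x))"
proof -
  have [measurable]: "g \<in> borel_measurable N" using g by simp
  note \<phi>(1)[measurable]
  have le: "\<bar>c n * \<phi> n x\<bar> \<le> \<bar>c n\<bar>" for n x
    using mult_left_mono[OF \<phi>(2)[of n x], of "\<bar>c n\<bar>"] by (simp add: abs_mult)
  have sm: "summable (\<lambda>n. c n * \<phi> n x)" for x
    by (rule summable_rabs_cancel, rule summable_comparison_test'[OF c]) (use le in auto)
  have le2: "\<bar>c n * \<phi> n x * g x\<bar> \<le> \<bar>c n\<bar> * \<bar>g x\<bar>" for n x
    using le[of n x] by (simp add: abs_mult mult_right_mono)
  have ig: "integrable N (\<lambda>x. \<bar>c n\<bar> * \<bar>g x\<bar>)" for n using g by simp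
  have ii: "integrable N (\<lambda>x. c n * \<phi> n x * g x)" for n
    by (rule Bochner_Integration.integrable_bound[OF ig[of n]]) (use le2 in auto)
  have s1: "AE x in N. summable (\<lambda>n. norm (c n * \<phi> n x * g x))"
    by (intro AE_I2 summable_comparison_test'[OF summable_mult2[OF c]]) (use le2 in auto)
  have s2: "summable (\<lambda>n. LINT x|N. norm (c n * \<phi> n x * g x))"
  proof (rule summable_comparison_test'[OF summable_mult2[OF c]])
    fix n
    have "(LINT x|N. norm (c n * \<phi> n x * g x)) \<le> (LINT x|N. \<bar>c n\<bar> * \<bar>g x\<bar>)"
      by (rule integral_mono) (use ii ig le2 in auto)
    then show "norm (LINT x|N. norm (c n * \<phi> n x * g x)) \<le> \<bar>c n\<bar> * (LINT x|N. \<bar>g x\<bar>)" by simp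
  qed
  have e: "(LINT x|N. c n * \<phi> n x * g x) = c n * (LINT x|N. \<phi> n x * g x)" for n
    by (simp add: mult.assoc)
  show "summable (\<lambda>n. c n * (LINT x|N. \<phi> n x * g x))"
    using summable_integral[OF ii s1 s2] unfolding e .
  have "(LINT x|N. (\<Sum>n. c n * \<phi> n x) * g x) = (LINT x|N. (\<Sum>n. c n * \<phi> n x * g x))"
    by (simp add: suminf_mult2[OF sm])
  also have "\<dots> = (\<Sum>n. c n * (LINT x|N. \<phi> n x * g x))"
    using integral_suminf[OF ii s1 s2] unfolding e .
  finally show "(LINT x|N. (\<Sum>n. c n * \<phi> n x) * g x) = (\<Sum>n. c n * (LINT x|N. \<phi> n x * g x))" .
qed

text \<open>The squared distance from \<open>f\<close> to its projection has nonnegative integral.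
  The common squared norm \<open>\<kappa>\<close> is \<open>L / 2\<close> for the sines and cosines;
  with a single constant function the lemma becomes a Cauchy-Schwarz inequality.\<close>

lemma bessel_inequality:
  fixes \<phi> :: "'i \<Rightarrow> 'a \<Rightarrow> real"
  assumes F: "finite F" and f: "integrable N (\<lambda>x. (f x)\<^sup>2)"
    and f\<phi>: "\<And>i. i \<in> F \<Longrightarrow> integrable N (\<lambda>x. f x * \<phi> i x)"
    and \<phi>\<phi>: "\<And>i j. i \<in> F \<Longrightarrow> j \<in> F \<Longrightarrow> integrable N (\<lambda>x. \<phi> i x * \<phi> j x)"
    and orth: "\<And>i j. i \<in> F \<Longrightarrow> j \<in> F \<Longrightarrow> (LINT x|N. \<phi> i x * \<phi> j x) = (if i = j then \<kappa> else 0)"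
    and \<kappa>: "\<kappa> > 0"
  shows "(\<Sum>i\<in>F. (LINT x|N. f x * \<phi> i x)\<^sup>2) \<le> \<kappa> * (LINT x|N. (f x)\<^sup>2)"
proof -
  define a where "a i = (LINT x|N. f x * \<phi> i x)" for i
  have eq: "(f x - (\<Sum>i\<in>F. a i / \<kappa> * \<phi> i x))\<^sup>2 = (f x)\<^sup>2 - 2 * (\<Sum>i\<in>F. a i / \<kappa> * (f x * \<phi> i x))
      + (\<Sum>i\<in>F. \<Sum>j\<in>F. a i / \<kappa> * (a j / \<kappa>) * (\<phi> i x * \<phi> j x))" for x
  proof -
    have "(\<Sum>i\<in>F. a i / \<kappa> * \<phi> i x)\<^sup>2 = (\<Sum>i\<in>F. \<Sum>j\<in>F. a i / \<kappa> * (a j / \<kappa>) * (\<phi> i x * \<phi> j x))"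
      unfolding power2_eq_square sum_product by (simp add: mult_ac)
    moreover have "f x * (\<Sum>i\<in>F. a i / \<kappa> * \<phi> i x) = (\<Sum>i\<in>F. a i / \<kappa> * (f x * \<phi> i x))"
      by (simp add: sum_distrib_left mult_ac)
    ultimately show ?thesis by (simp add: power2_diff)
  qed
  have "0 \<le> (LINT x|N. (f x - (\<Sum>i\<in>F. a i / \<kappa> * \<phi> i x))\<^sup>2)" by simp
  also have "\<dots> = (LINT x|N. (f x)\<^sup>2) - 2 * (\<Sum>i\<in>F. a i / \<kappa> * a i) + (\<Sum>i\<in>F. \<Sum>j\<in>F. a i / \<kappa> * (a j / \<kappa>) * (if i
      = j then \<kappa> else 0))"
    unfolding eq using f f\<phi> \<phi>\<phi> orth by (simp add: a_def Bochner_Integration.integral_sum)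
  also have "(\<Sum>i\<in>F. \<Sum>j\<in>F. a i / \<kappa> * (a j / \<kappa>) * (if i = j then \<kappa> else 0)) = (\<Sum>i\<in>F. a i / \<kappa> * a i)"
    using F \<kappa> by (simp add: if_distrib cong: if_cong)
  finally have "(\<Sum>i\<in>F. a i / \<kappa> * a i) \<le> (LINT x|N. (f x)\<^sup>2)" by simp
  then have "(\<Sum>i\<in>F. (a i)\<^sup>2) / \<kappa> \<le> (LINT x|N. (f x)\<^sup>2)"
    by (simp add: sum_divide_distrib power2_eq_square)
  then show ?thesis using \<kappa> by (simp add: a_def field_simps)
qed

section \<open>Sine series of the kernel\<close>

lemma summable_exp_rate:
  assumes "L > 0" "t > 0"
  shows "summable (\<lambda>n. exp (- rate L n * t))"
proof (rule summable_comparison_test')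
  let ?a = "(pi / L)\<^sup>2 / 2 * t"
  show "summable (\<lambda>n. exp (- ?a) ^ n)"
    using assms by (intro summable_geometric) auto
  fix n
  have "real n \<le> (real n)\<^sup>2"
    by (cases n) (auto simp: power2_eq_square)
  then have "real n * ?a \<le> (real n)\<^sup>2 * ?a" using assms by (intro mult_right_mono) auto
  also have "\<dots> = rate L n * t" by (simp add: rate_def power2_eq_square)
  finally have "exp (- rate L n * t) \<le> exp (- ?a) ^ n"
    by (simp add: exp_of_nat_mult[symmetric])
  then show "norm (exp (- rate L n * t)) \<le> exp (- ?a) ^ n" by simp
qed

lemma summable_exp_rate_mult:
  assumes "L > 0" "t > 0" "\<And>n. \<bar>a n\<bar> \<le> (B::real)"
  shows "summable (\<lambda>n. \<bar>2 / L * exp (- rate L n * t) * a n\<bar>)"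
proof (rule summable_comparison_test')
  show "summable (\<lambda>n. 2 / L * exp (- rate L n * t) * B)"
    using summable_exp_rate[OF assms(1,2)] by (intro summable_mult summable_mult2)
  show "norm \<bar>2 / L * exp (- rate L n * t) * a n\<bar> \<le> 2 / L * exp (- rate L n * t) * B" for n
    using assms mult_left_mono[OF assms(3)[of n], of "2 / L * exp (- rate L n * t)"]
    by (simp add: abs_mult)
qed

lemma continuous_on_dsin_series:
  fixes c :: "nat \<Rightarrow> real"
  assumes c: "summable (\<lambda>n. \<bar>c n\<bar>)"
  shows "continuous_on A (\<lambda>x. \<Sum>n. c n * dsin L n x)"
proof (rule uniform_limit_theorem)
  show "uniform_limit A (\<lambda>n x. \<Sum>i<n. c i * dsin L i x) (\<lambda>x. \<Sum>n. c n * dsin L n x) sequentially"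
  proof (rule Weierstrass_m_test[OF _ c])
    show "norm (c n * dsin L n x) \<le> \<bar>c n\<bar>" for n x
      using mult_left_mono[OF abs_dsin_le_1[of L n x], of "\<bar>c n\<bar>"] by (simp add: abs_mult)
  qed
qed (auto intro!: continuous_intros always_eventually)

text \<open>For fixed \<open>x\<close> both sides are continuous in \<open>y\<close> and have the
  same sine coefficients, so completeness identifies them. The factor \<open>2 / L\<close> undoes
  the squared norm \<open>L / 2\<close>.\<close>

lemma dirichlet_heat_kernel_expansion:
  assumes L: "L > 0" and p: "dirichlet_heat_kernel L p" and t: "t > 0"
    and x: "x \<in> {0..L}" and y: "y \<in> {0..L}"
  shows "p t x y = (\<Sum>n. 2 / L * exp (- rate L n * t) * dsin L n x * dsin L n y)"
proof -
  define c where "c n = 2 / L * exp (- rate L n * t) * dsin L n x" for n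
  define q where "q y = (\<Sum>n. c n * dsin L n y)" for y
  have c: "summable (\<lambda>n. \<bar>c n\<bar>)"
    unfolding c_def by (rule summable_exp_rate_mult[OF L t abs_dsin_le_1])
  have cq: "continuous_on {0..L} q" unfolding q_def by (rule continuous_on_dsin_series[OF c])
  note cp = dirichlet_heat_kernel_continuous_section[OF p t x]
  have "p t x y - q y = 0"
  proof (rule dsin_complete[OF L _ _ y])
    show "continuous_on {0..L} (\<lambda>y. p t x y - q y)" by (intro continuous_intros cp cq)
    fix n
    have "(LINT y|itv L. q y * dsin L n y) = (\<Sum>m. c m * (LINT y|itv L. dsin L m y * dsin L n y))"
      unfolding q_def
      by (rule integral_suminf_mult(2)[OF c])
         (auto intro!: integrable_itv_continuous borel_measurable_itv_continuous continuous_intros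
             abs_dsin_le_1)
    also have "\<dots> = (\<Sum>m. if m = n then c m * (if m > 0 then L / 2 else 0) else 0)"
      by (rule suminf_cong) (auto simp: dsin_orthogonal[OF L])
    also have "\<dots> = c n * (if n > 0 then L / 2 else 0)"
      using sums_single[of n "\<lambda>n. c n * (if n > 0 then L / 2 else 0)"] unfolding sums_iff by blast
    also have "\<dots> = exp (- rate L n * t) * dsin L n x" using L by (simp add: c_def)
    finally have "(LINT y|itv L. q y * dsin L n y) = exp (- rate L n * t) * dsin L n x" .
    moreover have "(LINT y|itv L. p t x y * dsin L n y) = exp (- rate L n * t) * dsin L n x"
      by (subst integral_itv_continuous) (intro continuous_intros cp dirichlet_heat_kernel_dsin[OF L p t x])+
    ultimately have "(LINT y|itv L. p t x y * dsin L n y) - (LINT y|itv L. q y * dsin L n y) = 0" by simp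
    also have "(LINT y|itv L. p t x y * dsin L n y) - (LINT y|itv L. q y * dsin L n y) =
        (LINT y|itv L. p t x y * dsin L n y - q y * dsin L n y)"
      by (intro Bochner_Integration.integral_diff[symmetric] integrable_itv_continuous continuous_intros cp cq)
    also have "\<dots> = integral {0..L} (\<lambda>y. (p t x y - q y) * dsin L n y)"
      by (subst integral_itv_continuous) (auto intro!: continuous_intros cp cq simp: algebra_simps)
    finally show "integral {0..L} (\<lambda>y. (p t x y - q y) * dsin L n y) = 0" .
  qed
  then show ?thesis by (simp add: q_def c_def)
qed

text \<open>The characterisation of \<open>p\<close> treats \<open>x\<close> and \<open>y\<close>
  differently; symmetry is visible only in the series. It moves integrals against sines from
  \<open>y\<close> to \<open>x\<close>.\<close>

lemma dirichlet_heat_kernel_symmetric: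
  assumes "L > 0" "dirichlet_heat_kernel L p" "t > 0" "x \<in> {0..L}" "y \<in> {0..L}"
  shows "p t x y = p t y x"
  using assms by (simp add: dirichlet_heat_kernel_expansion mult_ac)

lemma dirichlet_heat_kernel_continuous_section2:
  assumes "L > 0" "dirichlet_heat_kernel L p" "t > 0" "y \<in> {0..L}"
  shows "continuous_on {0..L} (\<lambda>x. p t x y)"
proof -
  have "continuous_on {0..L} (p t y)" by (rule dirichlet_heat_kernel_continuous_section[OF assms(2-)])
  then show ?thesis
    by (rule continuous_on_eq) (use dirichlet_heat_kernel_symmetric[OF assms(1-3)] assms in auto)
qed

lemma dirichlet_heat_kernel_dsin_adjoint:
  assumes "L > 0" "dirichlet_heat_kernel L p" "t > 0" "y \<in> {0..L}"
  shows "(LINT x|itv L. dsin L n x * p t x y) = exp (- rate L n * t) * dsin L n y"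
proof -
  have "(LINT x|itv L. dsin L n x * p t x y) = (LINT x|itv L. p t y x * dsin L n x)"
    by (rule integral_itv_cong) (use dirichlet_heat_kernel_symmetric[OF assms(1-3)] assms in auto)
  also have "\<dots> = integral {0..L} (\<lambda>x. p t y x * dsin L n x)"
    by (intro integral_itv_continuous continuous_intros dirichlet_heat_kernel_continuous_section[OF assms(2-)])
  finally show ?thesis using dirichlet_heat_kernel_dsin[OF assms] by simp
qed

section \<open>Short-time bounds for the squared kernel\<close>

lemma sum_exp_neg_square_le:
  fixes a :: real
  assumes a: "a > 0"
  shows "(\<Sum>n=1..N. exp (- ((real n)\<^sup>2 * a\<^sup>2))) \<le> arctan (a * real N) / a"
proof (induction N)
  case (Suc N)
  have "\<exists>z. real N < z \<and> z < real (Suc N) \<and> arctan (a * real (Suc N)) - arctan (a * real N) =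
      (real (Suc N) - real N) * (a / (1 + (a * z)\<^sup>2))"
  proof (rule MVT2)
    fix z :: real
    show "((\<lambda>z. arctan (a * z)) has_real_derivative a / (1 + (a * z)\<^sup>2)) (at z)"
      by (auto intro!: derivative_eq_intros simp: field_simps)
  qed simp
  then obtain z where z: "real N < z" "z < real (Suc N)"
    "arctan (a * real (Suc N)) - arctan (a * real N) = a / (1 + (a * z)\<^sup>2)" by auto
  have "z \<ge> 0" using z(1) of_nat_0_le_iff[of N, where 'a = real] by linarith
  then have zN: "(a * z)\<^sup>2 \<le> (a * real (Suc N))\<^sup>2"
    using z a by (intro power_mono mult_left_mono) auto
  have "1 + (a * z)\<^sup>2 \<le> exp ((a * real (Suc N))\<^sup>2)"
    using exp_ge_add_one_self[of "(a * real (Suc N))\<^sup>2"] zN by linarith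
  moreover have "1 + (a * z)\<^sup>2 > 0" by (simp add: add_pos_nonneg)
  ultimately have "exp (- ((a * real (Suc N))\<^sup>2)) \<le> 1 / (1 + (a * z)\<^sup>2)"
    by (simp add: exp_minus inverse_eq_divide frac_le)
  also have "\<dots> = (arctan (a * real (Suc N)) - arctan (a * real N)) / a" using z a by simp
  finally have "exp (- ((real (Suc N))\<^sup>2 * a\<^sup>2)) \<le> arctan (a * real (Suc N)) / a - arctan (a * real N) / a"
    by (simp add: power_mult_distrib mult.commute diff_divide_distrib)
  then show ?case using Suc.IH by simp
qed simp

text \<open>Only one factor of the square is expanded; integrating the other against each sine
  produces a second exponential, hence the time \<open>2 * t\<close>.\<close>

lemma dirichlet_heat_kernel_square_expansion:
  assumes L: "L > 0" and p: "dirichlet_heat_kernel L p" and t: "t > 0" and y: "y \<in> {0..L}"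
  shows "summable (\<lambda>n. 2 / L * exp (- rate L n * (2 * t)) * (dsin L n y)\<^sup>2)"
    and "(LINT x|itv L. (p t x y)\<^sup>2) = (\<Sum>n. 2 / L * exp (- rate L n * (2 * t)) * (dsin L n y)\<^sup>2)"
proof -
  define c where "c n = 2 / L * exp (- rate L n * t) * dsin L n y" for n
  have c: "summable (\<lambda>n. \<bar>c n\<bar>)"
    unfolding c_def by (rule summable_exp_rate_mult[OF L t abs_dsin_le_1])
  have ip: "integrable (itv L) (\<lambda>x. p t x y)"
    by (intro integrable_itv_continuous dirichlet_heat_kernel_continuous_section2[OF L p t y])
  have e: "c n * (LINT x|itv L. dsin L n x * p t x y) = 2 / L * exp (- rate L n * (2 * t)) * (dsin L n y)\<^sup>2"
      for n
  proof -
    have "exp (- rate L n * t) * exp (- rate L n * t) = exp (- rate L n * (2 * t))"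
      by (simp add: exp_add[symmetric])
    then show ?thesis
      unfolding dirichlet_heat_kernel_dsin_adjoint[OF L p t y] c_def by (simp add: power2_eq_square)
  qed
  have m: "dsin L n \<in> borel_measurable (itv L)" for n
    by (intro borel_measurable_itv_continuous continuous_intros)
  note s = integral_suminf_mult[where \<phi> = "dsin L", OF c ip m abs_dsin_le_1]
  show "summable (\<lambda>n. 2 / L * exp (- rate L n * (2 * t)) * (dsin L n y)\<^sup>2)"
    using s(1) unfolding e .
  have "(LINT x|itv L. (p t x y)\<^sup>2) = (LINT x|itv L. (\<Sum>n. c n * dsin L n x) * p t x y)"
    by (rule integral_itv_cong)
       (use y in \<open>simp add: power2_eq_square c_def dirichlet_heat_kernel_expansion[OF L p t] mult_ac\<close>)
  also have "\<dots> = (\<Sum>n. 2 / L * exp (- rate L n * (2 * t)) * (dsin L n y)\<^sup>2)"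
    using s(2) unfolding e .
  finally show "(LINT x|itv L. (p t x y)\<^sup>2) = (\<Sum>n. 2 / L * exp (- rate L n * (2 * t)) * (dsin L n y)\<^sup>2)" .
qed

lemma dirichlet_heat_kernel_square_le:
  assumes L: "L > 0" and p: "dirichlet_heat_kernel L p" and t: "t > 0" and y: "y \<in> {0..L}"
  shows "(LINT x|itv L. (p t x y)\<^sup>2) \<le> 1 / sqrt t"
  unfolding dirichlet_heat_kernel_square_expansion(2)[OF assms]
proof (rule suminf_le_const[OF dirichlet_heat_kernel_square_expansion(1)[OF assms]])
  fix N
  \<comment> \<open>Chosen so that \<open>rate L n * (2 * t)\<close> becomes n^2 a^2. The sum is
    compared with the integral of 1 / (1 + (a z)^2), at most pi / (2 a), and (2 / L) * pi / (2 a) is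
    exactly \<open>1 / sqrt t\<close>.\<close>
  define a where "a = pi / L * sqrt t"
  have a: "a > 0" using L t by (simp add: a_def)
  have le: "exp (- rate L n * (2 * t)) * (dsin L n y)\<^sup>2 \<le> exp (- ((real n)\<^sup>2 * a\<^sup>2))" for n
  proof -
    have "rate L n * (2 * t) = (real n)\<^sup>2 * a\<^sup>2"
      using t by (simp add: rate_def a_def power_mult_distrib power_divide)
    moreover have "(dsin L n y)\<^sup>2 \<le> 1" using abs_dsin_le_1 by (simp add: abs_square_le_1)
    ultimately show ?thesis by (simp add: mult_left_le)
  qed
  have "(\<Sum>n<N. 2 / L * exp (- rate L n * (2 * t)) * (dsin L n y)\<^sup>2)
      \<le> (\<Sum>n\<le>N. 2 / L * (exp (- rate L n * (2 * t)) * (dsin L n y)\<^sup>2))"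
    using L by (simp only: mult.assoc) (intro sum_mono2, auto)
  also have "\<dots> = (\<Sum>n=1..N. 2 / L * (exp (- rate L n * (2 * t)) * (dsin L n y)\<^sup>2))"
    by (rule sum.mono_neutral_right) (auto simp: not_le Suc_le_eq)
  also have "\<dots> \<le> (\<Sum>n=1..N. 2 / L * exp (- ((real n)\<^sup>2 * a\<^sup>2)))"
    using L by (intro sum_mono mult_left_mono le) auto
  also have "\<dots> \<le> 2 / L * (arctan (a * real N) / a)"
    unfolding sum_distrib_left[symmetric] using L by (intro mult_left_mono sum_exp_neg_square_le a) auto
  also have "\<dots> \<le> 2 / L * (pi / 2 / a)"
    using L a arctan_ubound[of "a * real N"] by (intro mult_left_mono divide_right_mono) auto
  also have "\<dots> = 1 / sqrt t" using L t by (simp add: a_def field_simps)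
  finally show "(\<Sum>n<N. 2 / L * exp (- rate L n * (2 * t)) * (dsin L n y)\<^sup>2) \<le> 1 / sqrt t" .
qed

lemma abs_sin_nat_mult_le: "\<bar>sin (real n * z)\<bar> \<le> real n * \<bar>sin z\<bar>"
proof (induction n)
  case (Suc n)
  have "\<bar>sin (real (Suc n) * z)\<bar> = \<bar>sin (real n * z) * cos z + cos (real n * z) * sin z\<bar>"
    by (simp add: algebra_simps sin_add)
  also have "\<dots> \<le> \<bar>sin (real n * z)\<bar> * \<bar>cos z\<bar> + \<bar>cos (real n * z)\<bar> * \<bar>sin z\<bar>"
    unfolding abs_mult[symmetric] by (rule abs_triangle_ineq)
  also have "\<dots> \<le> \<bar>sin (real n * z)\<bar> * 1 + 1 * \<bar>sin z\<bar>"
    by (intro add_mono mult_left_mono mult_right_mono) auto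
  also have "\<dots> \<le> real (Suc n) * \<bar>sin z\<bar>" using Suc.IH by (simp add: algebra_simps)
  finally show ?case .
qed simp

text \<open>If \<open>cos\<close> is small at \<open>m z\<close> then it is large at \<open>2 m z\<close>.\<close>

lemma sum_cos_square_ge: "real K / 8 \<le> (\<Sum>m=1..2 * K. (cos (real m * z))\<^sup>2)"
proof -
  have 1: "1 / 4 \<le> (cos (real m * z))\<^sup>2 + (cos (real (2 * m) * z))\<^sup>2" for m
  proof -
    have "cos (real (2 * m) * z) = 2 * (cos (real m * z))\<^sup>2 - 1"
      using cos_double_cos[of "real m * z"] by (simp add: mult.assoc)
    moreover have "c + (2 * c - 1)\<^sup>2 - 1 / 4 = (2 * c - 3 / 4)\<^sup>2 + 3 / 16" for c :: real
      by (simp add: power2_eq_square algebra_simps)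
    ultimately have "(cos (real m * z))\<^sup>2 + (cos (real (2 * m) * z))\<^sup>2 - 1 / 4
        = (2 * (cos (real m * z))\<^sup>2 - 3 / 4)\<^sup>2 + 3 / 16" by simp
    moreover have "(2 * (cos (real m * z))\<^sup>2 - 3 / 4)\<^sup>2 \<ge> 0" by simp
    ultimately show ?thesis by linarith
  qed
  have "real K / 4 = (\<Sum>m=1..K. 1 / 4)" by simp
  also have "\<dots> \<le> (\<Sum>m=1..K. (cos (real m * z))\<^sup>2 + (cos (real (2 * m) * z))\<^sup>2)"
    by (intro sum_mono 1)
  also have "\<dots> = (\<Sum>m=1..K. (cos (real m * z))\<^sup>2) + (\<Sum>m\<in>(*) 2 ` {1..K}. (cos (real m * z))\<^sup>2)"
    by (subst sum.reindex) (auto simp: sum.distrib inj_on_def)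
  \<comment> \<open>An index may occur in both sums, so each is bounded by the full sum; this halves
    \<open>K / 4\<close> to \<open>K / 8\<close>.\<close>
  also have "\<dots> \<le> (\<Sum>m=1..2 * K. (cos (real m * z))\<^sup>2) + (\<Sum>m=1..2 * K. (cos (real m * z))\<^sup>2)"
    by (intro add_mono sum_mono2) auto
  finally show ?thesis by simp
qed

lemma square_diff_ge: "P\<^sup>2 / 2 - Q\<^sup>2 \<le> (P - Q)\<^sup>2" for P Q :: real
proof -
  have "(P - Q)\<^sup>2 - (P\<^sup>2 / 2 - Q\<^sup>2) = (P - 2 * Q)\<^sup>2 / 2"
    by (simp add: power2_eq_square field_simps)
  moreover have "(P - 2 * Q)\<^sup>2 / 2 \<ge> 0" by simp
  ultimately show ?thesis by linarith
qed

text \<open>With equal Gaussian weights the difference of the two sines would be a multiple of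
  cos((n+1) z) sin z. The weights differ by at most \<open>4 * (n + 1) * \<rho>\<close>, and |sin(k
  z)| is at most k |sin z|, so the error also carries the factor sin z, as is needed near the
  boundary. The hypothesis on \<open>M\<close> makes the error at most |sin z| / 8, whence
  1/64.\<close>

lemma gaussian_sine_difference_ge:
  fixes \<rho> z :: real
  assumes \<rho>: "\<rho> \<ge> 0" and n: "Suc n \<le> M" and M: "8 * \<rho> * (real M)\<^sup>2 \<le> 1 / 8"
  shows "((cos (real (Suc n) * z))\<^sup>2 - 1 / 64) * (sin z)\<^sup>2 \<le>
    (exp (- ((real (Suc (Suc n)))\<^sup>2 * \<rho>)) * sin (real (Suc (Suc n)) * z) - exp (- ((real n)\<^sup>2 * \<rho>))
        * sin (real n * z))\<^sup>2"
proof -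
  let ?m = "real (Suc n)"
  define A where "A = exp (- ((real n)\<^sup>2 * \<rho>))"
  define B where "B = exp (- ((real (Suc (Suc n)))\<^sup>2 * \<rho>))"
  have A: "A > 0" "A \<le> 1" using \<rho> by (auto simp: A_def)
  have "(real n)\<^sup>2 * \<rho> \<le> (real M)\<^sup>2 * \<rho>" using n \<rho> by (intro mult_right_mono power_mono) auto
  then have "2 * ((real n)\<^sup>2 * \<rho>) \<le> 1 / 2" using M by (simp add: mult_ac)
  then have "1 / 2 \<le> exp (- (2 * ((real n)\<^sup>2 * \<rho>)))"
    using exp_ge_add_one_self[of "- (2 * ((real n)\<^sup>2 * \<rho>))"] by linarith
  also have "\<dots> = A\<^sup>2" by (simp add: A_def exp_double[symmetric])
  finally have A2: "A\<^sup>2 \<ge> 1 / 2" .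
  \<comment> \<open>The exponent is the difference of squares (n+2)^2 - n^2 = 4 (n+1).\<close>
  have BA: "B = A * exp (- (4 * ?m * \<rho>))"
    by (simp add: A_def B_def exp_add[symmetric] power2_eq_square algebra_simps)
  have "1 - exp (- (4 * ?m * \<rho>)) \<le> 4 * ?m * \<rho>"
    using exp_ge_add_one_self[of "- (4 * ?m * \<rho>)"] by linarith
  moreover have "0 \<le> 1 - exp (- (4 * ?m * \<rho>))" using \<rho> by simp
  ultimately have "A * (1 - exp (- (4 * ?m * \<rho>))) \<le> 1 * (4 * ?m * \<rho>)"
    using A by (intro mult_mono) auto
  moreover have "A - B = A * (1 - exp (- (4 * ?m * \<rho>)))" by (simp add: BA algebra_simps)
  moreover have "0 \<le> A * (1 - exp (- (4 * ?m * \<rho>)))" using A \<rho> by (intro mult_nonneg_nonneg) auto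
  ultimately have D: "0 \<le> A - B" "A - B \<le> 4 * ?m * \<rho>" by linarith+
  have m2: "real (Suc (Suc n)) \<le> 2 * real M" "?m \<le> real M" using n by auto
  have "\<bar>(A - B) * sin (real (Suc (Suc n)) * z)\<bar> \<le> (4 * ?m * \<rho>) * (real (Suc (Suc n)) * \<bar>sin z\<bar>)"
    unfolding abs_mult by (intro mult_mono abs_sin_nat_mult_le) (use D in auto)
  also have "\<dots> \<le> (4 * real M * \<rho>) * (2 * real M * \<bar>sin z\<bar>)"
    using m2 \<rho> by (intro mult_mono mult_nonneg_nonneg) auto
  also have "\<dots> = (8 * \<rho> * (real M)\<^sup>2) * \<bar>sin z\<bar>" by (simp add: power2_eq_square)
  also have "\<dots> \<le> 1 / 8 * \<bar>sin z\<bar>" by (intro mult_right_mono M) simp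
  finally have "((A - B) * sin (real (Suc (Suc n)) * z))\<^sup>2 \<le> (1 / 8 * \<bar>sin z\<bar>)\<^sup>2"
    by (rule power2_le_iff_abs_le[THEN iffD2, rotated]) simp
  then have Q: "((A - B) * sin (real (Suc (Suc n)) * z))\<^sup>2 \<le> 1 / 64 * (sin z)\<^sup>2"
    by (simp add: power_mult_distrib power2_eq_square)
  have "sin (real (Suc (Suc n)) * z) - sin (real n * z) = 2 * cos (?m * z) * sin z"
  proof -
    have "real (Suc (Suc n)) * z = ?m * z + z" "real n * z = ?m * z - z" by (simp_all add: algebra_simps)
    then show ?thesis by (simp only: sin_add sin_diff)
  qed
  then have s: "sin (real n * z) = sin (real (Suc (Suc n)) * z) - 2 * cos (?m * z) * sin z" by linarith
  have eq: "B * sin (real (Suc (Suc n)) * z) - A * sin (real n * z) =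
      A * (2 * cos (?m * z) * sin z) - (A - B) * sin (real (Suc (Suc n)) * z)"
    unfolding s by (simp add: algebra_simps)
  have "(cos (?m * z))\<^sup>2 * (sin z)\<^sup>2 \<le> 2 * A\<^sup>2 * ((cos (?m * z))\<^sup>2 * (sin z)\<^sup>2)"
    using A2 mult_right_mono[of 1 "2 * A\<^sup>2" "(cos (?m * z))\<^sup>2 * (sin z)\<^sup>2"] by simp
  also have "\<dots> = (A * (2 * cos (?m * z) * sin z))\<^sup>2 / 2"
    by (simp add: power_mult_distrib)
  finally have "((cos (?m * z))\<^sup>2 - 1 / 64) * (sin z)\<^sup>2 \<le>
      (A * (2 * cos (?m * z) * sin z))\<^sup>2 / 2 - ((A - B) * sin (real (Suc (Suc n)) * z))\<^sup>2"
    using Q unfolding left_diff_distrib by linarith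
  also have "\<dots> \<le> (B * sin (real (Suc (Suc n)) * z) - A * sin (real n * z))\<^sup>2"
    unfolding eq by (rule square_diff_ge)
  finally show ?thesis by (simp add: A_def B_def)
qed

lemma rate_eq: "rate L n = (real n)\<^sup>2 * rate L 1"
  by (simp add: rate_def power2_eq_square)

lemma rate_pos: "L > 0 \<Longrightarrow> rate L 1 > 0"
  by (simp add: rate_def)

text \<open>Bessel's inequality against the cosines, whose coefficients are differences of neighbouring
  Gaussian weighted sines; about \<open>r\<^sup>-\<^sup>1\<^sup>/\<^sup>2\<close> of them have size comparable to \<open>sin (\<pi> y / L)\<close>.\<close>

lemma dirichlet_heat_kernel_weighted_square_ge:
  assumes L: "L > 0" and p: "dirichlet_heat_kernel L p"
  obtains r0 c where "r0 > 0" "c > 0"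
    "\<And>r y. 0 < r \<Longrightarrow> r \<le> r0 \<Longrightarrow> y \<in> {0..L} \<Longrightarrow>
      c / sqrt r * (dsin L 1 y)\<^sup>2 \<le> (LINT x|itv L. (dsin L 1 x * p r x y)\<^sup>2)"
proof
  let ?\<mu> = "rate L 1"
  note \<mu> = rate_pos[OF L]
  \<comment> \<open>The bound on \<open>r\<close> gives \<open>sqrt \<rho> \<le> 1 / 32\<close>, so
    that rounding down in \<open>K\<close> below loses at most a factor 2.\<close>
  show "1 / (1024 * ?\<mu>) > 0" "3 / (64 * L) / (32 * sqrt ?\<mu>) > 0" using \<mu> L by auto
  fix r y :: real assume r: "0 < r" "r \<le> 1 / (1024 * ?\<mu>)" and y: "y \<in> {0..L}"
  define \<rho> where "\<rho> = ?\<mu> * r"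
  define z where "z = pi / L * y"
  have \<rho>: "\<rho> > 0" "\<rho> \<le> 1 / 1024" using r \<mu> by (auto simp: \<rho>_def field_simps)
  have s\<rho>: "sqrt \<rho> > 0" "sqrt \<rho> \<le> 1 / 32"
    using \<rho> real_sqrt_le_mono[OF \<rho>(2)] by (auto simp: real_sqrt_divide)
  \<comment> \<open>Up to rounding the largest \<open>K\<close> with
    \<open>8 * \<rho> * (2 * K)^2 \<le> 1 / 8\<close>, the smallness required for frequencies up to
    \<open>2 * K\<close>.\<close>
  define K where "K = nat \<lfloor>1 / (16 * sqrt \<rho>)\<rfloor>"
  have K1: "real K \<le> 1 / (16 * sqrt \<rho>)"
    using s\<rho> by (simp add: K_def)
  have "1 / (16 * sqrt \<rho>) - 1 \<le> real K" by (simp add: K_def) linarith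
  moreover have "1 \<le> 1 / (32 * sqrt \<rho>)" using s\<rho> by (simp add: field_simps)
  moreover have "1 / (16 * sqrt \<rho>) = 1 / (32 * sqrt \<rho>) + 1 / (32 * sqrt \<rho>)" by simp
  ultimately have K2: "1 / (32 * sqrt \<rho>) \<le> real K" by linarith
  have "(real K)\<^sup>2 \<le> (1 / (16 * sqrt \<rho>))\<^sup>2" using K1 by (intro power_mono) auto
  then have M: "8 * \<rho> * (real (2 * K))\<^sup>2 \<le> 1 / 8" using \<rho>
      by (simp add: power_divide power_mult_distrib field_simps)
  define f where "f x = dsin L 1 x * p r x y" for x
  note cp = dirichlet_heat_kernel_continuous_section2[OF L p r(1) y]
  \<comment> \<open>The first sine times a cosine is half a difference of two sines, on which the
    kernel acts by exponentials.\<close>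
  have coef: "(LINT x|itv L. f x * dcos L m x) =
      1 / 2 * (exp (- rate L (Suc m) * r) * dsin L (Suc m) y - exp (- rate L (m - 1) * r) * dsin L (m - 1) y)"
    if "m \<ge> 1" for m
  proof -
    have e: "f x * dcos L m x = 1 / 2 * (dsin L (Suc m) x * p r x y - dsin L (m - 1) x * p r x y)" for x
    proof -
      have *: "real 1 * pi / L * x + real m * pi / L * x = real (Suc m) * pi / L * x"
        "real m * pi / L * x - real 1 * pi / L * x = real (m - 1) * pi / L * x"
        using that by (simp_all add: of_nat_diff algebra_simps diff_divide_distrib add_divide_distrib)
      have "dsin L 1 x * dcos L m x = (dsin L (Suc m) x - dsin L (m - 1) x) / 2"
        unfolding dsin_def dcos_def mult.commute[of "sin _"] cos_times_sin
        using * by (simp add: add.commute)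
      then have "f x * dcos L m x = (dsin L (Suc m) x - dsin L (m - 1) x) / 2 * p r x y"
        unfolding f_def by (metis mult.assoc mult.commute)
      then show ?thesis by (simp add: algebra_simps)
    qed
    have i: "integrable (itv L) (\<lambda>x. dsin L k x * p r x y)" for k
      by (intro integrable_itv_continuous continuous_intros cp)
    show ?thesis
      unfolding e by (simp add: Bochner_Integration.integral_diff[OF i i]
          dirichlet_heat_kernel_dsin_adjoint[OF L p r(1) y])
  qed
  have "(\<Sum>m=1..2 * K. 1 / 4 * (((cos (real m * z))\<^sup>2 - 1 / 64) * (sin z)\<^sup>2))
      \<le> (\<Sum>m=1..2 * K. (LINT x|itv L. f x * dcos L m x)\<^sup>2)"
  proof (rule sum_mono)
    fix m assume m: "m \<in> {1..2 * K}"
    then obtain n where n: "m = Suc n" "Suc n \<le> 2 * K" by (cases m) auto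
    have rr: "- rate L k * r = - ((real k)\<^sup>2 * \<rho>)" for k
      by (subst rate_eq) (simp add: \<rho>_def)
    have dz: "dsin L k y = sin (real k * z)" for k by (simp add: dsin_def z_def mult.assoc)
    have "1 / 4 * (((cos (real (Suc n) * z))\<^sup>2 - 1 / 64) * (sin z)\<^sup>2) \<le> 1 / 4 *
     (exp (- ((real (Suc (Suc n)))\<^sup>2 * \<rho>)) * sin (real (Suc (Suc n)) * z) - exp (- ((real n)\<^sup>2 * \<rho>))
         * sin (real n * z))\<^sup>2"
      by (intro mult_left_mono gaussian_sine_difference_ge[OF _ n(2) M]) (use \<rho> in auto)
    also have "\<dots> = (LINT x|itv L. f x * dcos L m x)\<^sup>2"
      using m by (simp only: coef n power_mult_distrib rr dz atLeastAtMost_iff)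
        (simp add: power2_eq_square)
    finally show "1 / 4 * (((cos (real m * z))\<^sup>2 - 1 / 64) * (sin z)\<^sup>2) \<le> (LINT x|itv L. f x * dcos L m x)\<^sup>2"
      unfolding n .
  qed
  also have "\<dots> \<le> L / 2 * (LINT x|itv L. (f x)\<^sup>2)"
    by (rule bessel_inequality)
       (auto intro!: integrable_itv_continuous continuous_intros cp simp: f_def dcos_orthogonal[OF L] L)
  finally have main: "1 / 4 * (sin z)\<^sup>2 * (\<Sum>m=1..2 * K. (cos (real m * z))\<^sup>2 - 1 / 64)
      \<le> L / 2 * (LINT x|itv L. (f x)\<^sup>2)"
    by (simp add: sum_distrib_left mult_ac)
  \<comment> \<open>The squared cosines contribute \<open>K / 8\<close>, the error terms remove
    \<open>2 * K / 64\<close>, which leaves \<open>3 / 32 * K\<close>.\<close>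
  have "3 / 32 * (1 / (32 * sqrt \<rho>)) \<le> 3 / 32 * real K" using K2 by (intro mult_left_mono) auto
  also have "3 / 32 * real K \<le> (\<Sum>m=1..2 * K. (cos (real m * z))\<^sup>2 - 1 / 64)"
    using sum_cos_square_ge[of K z] by (simp add: sum_subtractf)
  finally have "1 / 4 * (sin z)\<^sup>2 * (3 / 32 * (1 / (32 * sqrt \<rho>)))
      \<le> 1 / 4 * (sin z)\<^sup>2 * (\<Sum>m=1..2 * K. (cos (real m * z))\<^sup>2 - 1 / 64)"
    by (intro mult_left_mono) auto
  also note main
  finally have "(2 / L) * (1 / 4 * (sin z)\<^sup>2 * (3 / 32 * (1 / (32 * sqrt \<rho>))))
      \<le> (2 / L) * (L / 2 * (LINT x|itv L. (f x)\<^sup>2))"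
    using L by (intro mult_left_mono) auto
  also have "\<dots> = (LINT x|itv L. (f x)\<^sup>2)" using L by simp
  finally have "(2 / L) * (1 / 4 * (sin z)\<^sup>2 * (3 / 32 * (1 / (32 * sqrt \<rho>)))) \<le> (LINT x|itv L. (f x)\<^sup>2)" .
  moreover have "(2 / L) * (1 / 4 * (sin z)\<^sup>2 * (3 / 32 * (1 / (32 * sqrt \<rho>)))) =
    3 / (64 * L) / (32 * sqrt ?\<mu>) / sqrt r * (dsin L 1 y)\<^sup>2"
    by (simp add: \<rho>_def real_sqrt_mult z_def dsin_def field_simps)
  ultimately show "3 / (64 * L) / (32 * sqrt ?\<mu>) / sqrt r * (dsin L 1 y)\<^sup>2
      \<le> (LINT x|itv L. (dsin L 1 x * p r x y)\<^sup>2)"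
    by (simp add: f_def)
qed

text \<open>The sine coefficients of \<open>P\<close> are those of \<open>g\<close> damped by
  exponentials, so its series converges uniformly and \<open>P\<close> is continuous although
  \<open>g\<close> is only bounded and measurable. The contraction bound comes from Bessel's
  inequality for \<open>g\<close>.\<close>

lemma
  fixes g :: "real \<Rightarrow> real"
  assumes L: "L > 0" and p: "dirichlet_heat_kernel L p" and t: "t > 0"
    and g: "g \<in> borel_measurable (itv L)" "\<And>x. x \<in> {0..L} \<Longrightarrow> \<bar>g x\<bar> \<le> B"
  defines "P \<equiv> \<lambda>x. LINT y|itv L. g y * p t x y"
  shows dirichlet_semigroup_continuous: "continuous_on {0..L} P"
    and dirichlet_semigroup_dsin: "(LINT x|itv L. dsin L n x * P x)
        = exp (- rate L n * t) * (LINT y|itv L. g y * dsin L n y)"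
    and dirichlet_semigroup_square_le: "(LINT x|itv L. (P x)\<^sup>2) \<le> (LINT x|itv L. (g x)\<^sup>2)"
proof -
  define b where "b n = (LINT y|itv L. g y * dsin L n y)" for n
  have m: "dsin L n \<in> borel_measurable (itv L)" for n
    by (intro borel_measurable_itv_continuous continuous_intros)
  note [measurable] = m g(1)
  have B: "B \<ge> 0" using g(2)[of 0] L by auto
  have ig: "integrable (itv L) g" by (rule integrable_itv_bounded[OF g])
  have igd: "integrable (itv L) (\<lambda>x. g x * dsin L n x)" for n
  proof (rule integrable_itv_bounded)
    show "\<bar>g x * dsin L n x\<bar> \<le> B * 1" if "x \<in> {0..L}" for x
      unfolding abs_mult by (intro mult_mono g(2) that abs_dsin_le_1 B) auto
  qed simp
  have bB: "\<bar>b n\<bar> \<le> B * L" for n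
  proof -
    have "\<bar>b n\<bar> \<le> (LINT y|itv L. \<bar>g y * dsin L n y\<bar>)" unfolding b_def by (rule integral_abs_bound)
    also have "\<dots> \<le> (LINT y|itv L. B)"
    proof (rule integral_mono)
      show "integrable (itv L) (\<lambda>y. \<bar>g y * dsin L n y\<bar>)" using igd by simp
      fix x assume "x \<in> space (itv L)"
      then have "x \<in> {0..L}" by (simp add: space_restrict_space)
      then have "\<bar>g x\<bar> * \<bar>dsin L n x\<bar> \<le> B * 1" by (intro mult_mono g(2) abs_dsin_le_1 B) auto
      then show "\<bar>g x * dsin L n x\<bar> \<le> B" by (simp add: abs_mult)
    qed (auto intro!: integrable_itv_continuous)
    also have "\<dots> = B * L" using L by (subst integral_itv_continuous) auto
    finally show ?thesis .
  qed
  define d where "d n = 2 / L * exp (- rate L n * t) * b n" for n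
  have d: "summable (\<lambda>n. \<bar>d n\<bar>)" unfolding d_def by (rule summable_exp_rate_mult[OF L t bB])
  have P: "P x = (\<Sum>n. d n * dsin L n x)" if x: "x \<in> {0..L}" for x
  proof -
    define c where "c n = 2 / L * exp (- rate L n * t) * dsin L n x" for n
    have c: "summable (\<lambda>n. \<bar>c n\<bar>)" unfolding c_def by (rule summable_exp_rate_mult[OF L t abs_dsin_le_1])
    have "P x = (LINT y|itv L. (\<Sum>n. c n * dsin L n y) * g y)"
      unfolding P_def
      by (rule integral_itv_cong) (use x in \<open>simp add: c_def dirichlet_heat_kernel_expansion[OF L p t]\<close>)
    also have "\<dots> = (\<Sum>n. c n * (LINT y|itv L. dsin L n y * g y))"
      by (rule integral_suminf_mult(2)[OF c ig m abs_dsin_le_1])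
    also have "\<dots> = (\<Sum>n. d n * dsin L n x)" by (simp add: c_def d_def b_def mult_ac)
    finally show ?thesis .
  qed
  show cP: "continuous_on {0..L} P"
    by (rule continuous_on_eq[OF continuous_on_dsin_series[OF d]]) (use P in auto)
  have dP: "(LINT x|itv L. dsin L n x * P x) = exp (- rate L n * t) * b n" for n
  proof -
    have "(LINT x|itv L. dsin L n x * P x) = (LINT x|itv L. (\<Sum>m. d m * dsin L m x) * dsin L n x)"
      by (rule integral_itv_cong) (simp add: P)
    also have "\<dots> = (\<Sum>m. d m * (LINT x|itv L. dsin L m x * dsin L n x))"
      by (rule integral_suminf_mult(2)[OF d _ m abs_dsin_le_1]) (intro integrable_itv_continuous
          continuous_intros)
    also have "\<dots> = (\<Sum>m. if m = n then d m * (if m > 0 then L / 2 else 0) else 0)"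
      by (rule suminf_cong) (auto simp: dsin_orthogonal[OF L])
    also have "\<dots> = d n * (if n > 0 then L / 2 else 0)"
      using sums_single[of n "\<lambda>n. d n * (if n > 0 then L / 2 else 0)"] unfolding sums_iff by blast
    also have "\<dots> = exp (- rate L n * t) * b n" using L by (auto simp: d_def b_def)
    finally show ?thesis .
  qed
  then show "(LINT x|itv L. dsin L n x * P x) = exp (- rate L n * t) * (LINT y|itv L. g y * dsin L n y)"
    unfolding b_def .
  have iP: "integrable (itv L) P" by (rule integrable_itv_continuous[OF cP])
  note s = integral_suminf_mult[where \<phi> = "dsin L", OF d iP m abs_dsin_le_1]
  have "(LINT x|itv L. (P x)\<^sup>2) = (LINT x|itv L. (\<Sum>n. d n * dsin L n x) * P x)"
    by (rule integral_itv_cong) (simp add: P power2_eq_square)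
  also have "\<dots> = (\<Sum>n. d n * (LINT x|itv L. dsin L n x * P x))" by (rule s(2))
  also have "\<dots> \<le> (LINT x|itv L. (g x)\<^sup>2)"
  proof (rule suminf_le_const[OF s(1)])
    fix N
    \<comment> \<open>Index 0 is dropped: its sine is zero and lacks the squared norm
      \<open>L / 2\<close> demanded by Bessel's inequality.\<close>
    have "(\<Sum>n<N. d n * (LINT x|itv L. dsin L n x * P x)) = (\<Sum>n\<in>{1..<N}. d n * (LINT x|itv L. dsin L n x * P x))"
      by (rule sum.mono_neutral_right) (auto simp: Suc_le_eq d_def b_def)
    also have "\<dots> \<le> (\<Sum>n\<in>{1..<N}. 2 / L * (b n)\<^sup>2)"
    proof (rule sum_mono)
      fix n
      have r: "exp (- rate L n * t) \<le> 1" using t by (simp add: rate_def)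
      have "d n * (LINT x|itv L. dsin L n x * P x) = 2 / L * (b n)\<^sup>2 * (exp (- rate L n * t)
          * exp (- rate L n * t))"
        unfolding dP by (simp add: d_def power2_eq_square)
      also have "\<dots> \<le> 2 / L * (b n)\<^sup>2 * (1 * 1)"
        using r L by (intro mult_left_mono mult_mono) auto
      finally show "d n * (LINT x|itv L. dsin L n x * P x) \<le> 2 / L * (b n)\<^sup>2" by simp
    qed
    also have "\<dots> = 2 / L * (\<Sum>n\<in>{1..<N}. (LINT x|itv L. g x * dsin L n x)\<^sup>2)"
      by (simp add: b_def sum_distrib_left)
    also have "\<dots> \<le> 2 / L * (L / 2 * (LINT x|itv L. (g x)\<^sup>2))"
    proof (intro mult_left_mono bessel_inequality)
      show "integrable (itv L) (\<lambda>x. (g x)\<^sup>2)"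
      proof (rule integrable_itv_bounded)
        show "\<bar>(g x)\<^sup>2\<bar> \<le> B\<^sup>2" if "x \<in> {0..L}" for x
          using power_mono[OF g(2)[OF that], of 2] by simp
      qed simp
    qed (use L in \<open>auto intro!: igd integrable_itv_continuous continuous_intros simp: dsin_orthogonal[OF L]\<close>)
    also have "\<dots> = (LINT x|itv L. (g x)\<^sup>2)" using L by simp
    finally show "(\<Sum>n<N. d n * (LINT x|itv L. dsin L n x * P x)) \<le> (LINT x|itv L. (g x)\<^sup>2)" .
  qed
  finally show "(LINT x|itv L. (P x)\<^sup>2) \<le> (LINT x|itv L. (g x)\<^sup>2)" .
qed

section \<open>Independence of the noise from the past\<close>


context prob_space
begin

text \<open>The characteristic function of a centred Gaussian, split into real and imaginary parts
  so that later arguments stay real. The degenerate law is a separate case because it has no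
  density.\<close>

lemma centered_gaussian_cos_sin:
  assumes "centered_gaussian M X"
  shows "integrable M (\<lambda>\<omega>. (X \<omega>)\<^sup>2)"
    and "expectation (\<lambda>\<omega>. cos (X \<omega>)) = exp (- expectation (\<lambda>\<omega>. (X \<omega>)\<^sup>2) / 2)"
    and "expectation (\<lambda>\<omega>. sin (X \<omega>)) = 0"
    and "expectation X = 0"
proof -
  have X [measurable]: "X \<in> borel_measurable M" using assms by (simp add: centered_gaussian_def)
  consider "AE \<omega> in M. X \<omega> = 0" | s where "s > 0" "distributed M lborel X (normal_density 0 s)"
    using assms by (auto simp: centered_gaussian_def)
  then have "integrable M (\<lambda>\<omega>. (X \<omega>)\<^sup>2) \<and>
    expectation (\<lambda>\<omega>. cos (X \<omega>)) = exp (- expectation (\<lambda>\<omega>. (X \<omega>)\<^sup>2) / 2) \<and>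
    expectation (\<lambda>\<omega>. sin (X \<omega>)) = 0 \<and> expectation X = 0"
  proof cases
    case 1
    have "integrable M (\<lambda>\<omega>. (X \<omega>)\<^sup>2) \<longleftrightarrow> integrable M (\<lambda>_. 0::real)"
      by (rule integrable_cong_AE) (use 1 in auto)
    moreover have "expectation (\<lambda>\<omega>. (X \<omega>)\<^sup>2) = expectation (\<lambda>_. 0)"
      by (rule integral_cong_AE) (use 1 in auto)
    moreover have "expectation (\<lambda>\<omega>. cos (X \<omega>)) = expectation (\<lambda>_. 1)"
      by (rule integral_cong_AE) (use 1 in auto)
    moreover have "expectation (\<lambda>\<omega>. sin (X \<omega>)) = expectation (\<lambda>_. 0)"
      by (rule integral_cong_AE) (use 1 in auto)
    moreover have "expectation X = expectation (\<lambda>_. 0)"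
      by (rule integral_cong_AE) (use 1 in auto)
    ultimately show ?thesis by (simp add: prob_space)
  next
    case 2
    note D = 2(2)
    have int: "integrable M (\<lambda>\<omega>. (X \<omega>)\<^sup>2)"
      using distributed_integrable[OF D, of "\<lambda>x. x\<^sup>2"] integrable_normal_moment[OF 2(1), of 0 2] by simp
    have mean: "expectation X = 0" by (rule normal_distributed_expectation[OF 2(1) D])
    have var: "expectation (\<lambda>\<omega>. (X \<omega>)\<^sup>2) = s\<^sup>2"
      using normal_distributed_variance[OF 2(1) D] mean by simp
    have "distributed M lborel (\<lambda>\<omega>. X \<omega> / s) std_normal_density"
      using normal_standard_normal_convert[OF 2(1), of X 0] D by simp
    then have "distr M lborel (\<lambda>\<omega>. X \<omega> / s) = std_normal_distribution" by (simp add: distributed_def)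
    then have "char (distr M lborel (\<lambda>\<omega>. X \<omega> / s)) s = complex_of_real (exp (- (s^2) / 2))"
      by (simp add: char_std_normal_distribution)
    moreover have "char (distr M lborel (\<lambda>\<omega>. X \<omega> / s)) s = (CLINT \<omega>|M. iexp (X \<omega>))"
      unfolding char_def using 2(1) by (subst integral_distr) auto
    ultimately have e: "(CLINT \<omega>|M. iexp (X \<omega>)) = complex_of_real (exp (- (s^2) / 2))" by simp
    have i: "integrable M (\<lambda>\<omega>. iexp (X \<omega>))" by (intro integrable_iexp) auto
    have "Re (CLINT \<omega>|M. iexp (X \<omega>)) = expectation (\<lambda>\<omega>. cos (X \<omega>))"
      by (subst integral_Re[OF i, symmetric]) (simp add: Re_exp)
    moreover have "Im (CLINT \<omega>|M. iexp (X \<omega>)) = expectation (\<lambda>\<omega>. sin (X \<omega>))"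
      by (subst integral_Im[OF i, symmetric]) (simp add: Im_exp)
    ultimately show ?thesis using int mean var e by simp
  qed
  then show "integrable M (\<lambda>\<omega>. (X \<omega>)\<^sup>2)"
    and "expectation (\<lambda>\<omega>. cos (X \<omega>)) = exp (- expectation (\<lambda>\<omega>. (X \<omega>)\<^sup>2) / 2)"
    and "expectation (\<lambda>\<omega>. sin (X \<omega>)) = 0" and "expectation X = 0" by blast+
qed

text \<open>Divided by their common mass, the weights are densities of two probability measures,
  under which \<open>Y\<close> has the same characteristic function by the trigonometric hypotheses.
  Mass zero is treated apart.\<close>

lemma weighted_law_unique:
  fixes w1 w2 Y :: "'a \<Rightarrow> real"
  assumes w: "integrable M w1" "integrable M w2" "\<And>\<omega>. w1 \<omega> \<ge> 0" "\<And>\<omega>. w2 \<omega> \<ge> 0"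
    and Y [measurable]: "Y \<in> borel_measurable M"
    and c: "\<And>t. expectation (\<lambda>\<omega>. w1 \<omega> * cos (t * Y \<omega>)) = expectation (\<lambda>\<omega>. w2 \<omega> * cos (t * Y \<omega>))"
    and s: "\<And>t. expectation (\<lambda>\<omega>. w1 \<omega> * sin (t * Y \<omega>)) = expectation (\<lambda>\<omega>. w2 \<omega> * sin (t * Y \<omega>))"
    and B: "B \<in> sets borel"
  shows "expectation (\<lambda>\<omega>. w1 \<omega> * indicator B (Y \<omega>)) = expectation (\<lambda>\<omega>. w2 \<omega> * indicator B (Y \<omega>))"
proof -
  have [measurable]: "w1 \<in> borel_measurable M" "w2 \<in> borel_measurable M" "B \<in> sets borel" using w B by auto
  define k where "k = expectation w1"
  have k2: "expectation w2 = k" using c[of 0] by (simp add: k_def)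
  have k0: "k \<ge> 0" unfolding k_def by (intro integral_nonneg_AE AE_I2 w)
  show ?thesis
  proof (cases "k = 0")
    case True
    have "AE \<omega> in M. w1 \<omega> = 0" "AE \<omega> in M. w2 \<omega> = 0"
      using True k2 k_def integral_nonneg_eq_0_iff_AE[OF w(1)] integral_nonneg_eq_0_iff_AE[OF w(2)] w(3,4)
          by auto
    then show ?thesis by (intro integral_cong_AE) auto
  next
    case False
    then have k: "k > 0" using k0 by simp
    define N where "N w = distr (density M (\<lambda>\<omega>. ennreal (w \<omega> / k))) borel Y" for w
    have rd: "real_distribution (N w)"
      and int: "\<And>f :: real \<Rightarrow> complex. f \<in> borel_measurable borel \<Longrightarrow>
        integral\<^sup>L (N w) f = integral\<^sup>L M (\<lambda>\<omega>. complex_of_real (w \<omega> / k) * f (Y \<omega>))"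
      and meas: "measure (N w) B = expectation (\<lambda>\<omega>. w \<omega> * indicator B (Y \<omega>)) / k"
      if w: "integrable M w" "\<And>\<omega>. w \<omega> \<ge> 0" "expectation w = k" for w
    proof -
      have [measurable]: "w \<in> borel_measurable M" using w by auto
      have "emeasure (density M (\<lambda>\<omega>. ennreal (w \<omega> / k))) (space M) = (\<integral>\<^sup>+\<omega>. ennreal (w \<omega> / k) \<partial>M)"
        by (subst emeasure_density) (auto intro!: nn_integral_cong)
      also have "\<dots> = ennreal (expectation (\<lambda>\<omega>. w \<omega> / k))"
        using w k by (intro nn_integral_eq_integral) auto
      also have "\<dots> = 1" using w k by simp
      finally have "prob_space (density M (\<lambda>\<omega>. ennreal (w \<omega> / k)))"
        by (intro prob_spaceI) simp
      then show "real_distribution (N w)" unfolding N_def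
        by (rule prob_space.real_distribution_distr) simp
      show "integral\<^sup>L (N w) f = integral\<^sup>L M (\<lambda>\<omega>. complex_of_real (w \<omega> / k) * f (Y \<omega>))"
          if [measurable]: "f \<in> borel_measurable borel" for f :: "real \<Rightarrow> complex"
        unfolding N_def using w(2) k by (subst integral_distr, simp, simp, subst integral_density) (auto
            simp: scaleR_conv_of_real)
      have "measure (N w) B = (LINT x|N w. indicator B x :: real)"
        by (simp add: N_def)
      also have "\<dots> = (LINT \<omega>|M. (w \<omega> / k) * indicator B (Y \<omega>))"
        unfolding N_def using w(2) k by (subst integral_distr, simp, simp, subst integral_density) auto
      finally show "measure (N w) B = expectation (\<lambda>\<omega>. w \<omega> * indicator B (Y \<omega>)) / k" by simp
    qed
    have ch: "char (N w) t = complex_of_real (expectation (\<lambda>\<omega>. w \<omega> * cos (t * Y \<omega>)) / k) + \<i>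
        * complex_of_real (expectation (\<lambda>\<omega>. w \<omega> * sin (t * Y \<omega>)) / k)"
      if w: "integrable M w" "\<And>\<omega>. w \<omega> \<ge> 0" "expectation w = k" for w t
    proof -
      have [measurable]: "w \<in> borel_measurable M" using w by auto
      have ie: "integrable M (\<lambda>\<omega>. complex_of_real (w \<omega> / k) * iexp (t * Y \<omega>))"
        by (rule Bochner_Integration.integrable_bound[OF integrable_divide[OF w(1), of k]])
           (auto simp: norm_mult norm_divide simp flip: of_real_mult)
      have "char (N w) t = (CLINT \<omega>|M. (w \<omega> / k) * iexp (t * Y \<omega>))"
        unfolding char_def by (subst int[OF w]) auto
      moreover have "Re (CLINT \<omega>|M. (w \<omega> / k) * iexp (t * Y \<omega>)) = expectation (\<lambda>\<omega>. w \<omega> * cos (t * Y \<omega>)) / k"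
        by (subst integral_Re[OF ie, symmetric]) (simp add: Re_exp flip: of_real_mult of_real_divide)
      moreover have "Im (CLINT \<omega>|M. (w \<omega> / k) * iexp (t * Y \<omega>)) = expectation (\<lambda>\<omega>. w \<omega> * sin (t * Y \<omega>)) / k"
        by (subst integral_Im[OF ie, symmetric]) (simp add: Im_exp flip: of_real_mult of_real_divide)
      ultimately show ?thesis by (simp add: complex_eq_iff)
    qed
    have "N w1 = N w2"
      by (rule Levy_uniqueness[OF rd rd]) (use w k2 k_def c s in \<open>auto simp: ch fun_eq_iff\<close>)
    then show ?thesis using meas[of w1] meas[of w2] w k k2 k_def by simp
  qed
qed

end

section \<open>Linear span of the noise, past and future\<close>

definition noise_span :: "((real \<times> real) set \<Rightarrow> 'w \<Rightarrow> real) \<Rightarrow> (real \<times> real) set set \<Rightarrow> ('w \<Rightarrow> real) set" where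
  "noise_span W S = {Y. \<exists>\<A> c. finite \<A> \<and> \<A> \<subseteq> S \<and> Y = (\<lambda>\<omega>. \<Sum>A\<in>\<A>. c A * W A \<omega>)}"

lemma noise_spanE:
  assumes "Y \<in> noise_span W S"
  obtains \<A> c where "finite \<A>" "\<A> \<subseteq> S" "Y = (\<lambda>\<omega>. \<Sum>A\<in>\<A>. c A * W A \<omega>)"
  using assms unfolding noise_span_def by blast

lemma noise_span_mono: "S \<subseteq> T \<Longrightarrow> noise_span W S \<subseteq> noise_span W T"
  unfolding noise_span_def by blast

lemma noise_span_base: "A \<in> S \<Longrightarrow> W A \<in> noise_span W S"
  unfolding noise_span_def by (intro CollectI exI[of _ "{A}"] exI[of _ "\<lambda>_. 1"]) auto

lemma noise_span_linear:
  assumes "X \<in> noise_span W S" "Y \<in> noise_span W S"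
  shows "(\<lambda>\<omega>. a * X \<omega> + b * Y \<omega>) \<in> noise_span W S"
proof -
  obtain \<A> c where 1: "finite \<A>" "\<A> \<subseteq> S" "X = (\<lambda>\<omega>. \<Sum>A\<in>\<A>. c A * W A \<omega>)" using assms(1) by (rule noise_spanE)
  obtain \<B> d where 2: "finite \<B>" "\<B> \<subseteq> S" "Y = (\<lambda>\<omega>. \<Sum>A\<in>\<B>. d A * W A \<omega>)" using assms(2) by (rule noise_spanE)
  define e where "e A = (if A \<in> \<A> then a * c A else 0) + (if A \<in> \<B> then b * d A else 0)" for A
  have "a * X \<omega> + b * Y \<omega> = (\<Sum>A\<in>\<A> \<union> \<B>. e A * W A \<omega>)" for \<omega>
  proof -
    have "(\<Sum>A\<in>\<A> \<union> \<B>. e A * W A \<omega>) = (\<Sum>A\<in>\<A> \<union> \<B>. if A \<in> \<A> then a * c A * W A \<omega> else 0) + (\<Sum>A\<in>\<A> \<union> \<B>.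
        if A \<in> \<B> then b * d A * W A \<omega> else 0)"
      unfolding e_def sum.distrib[symmetric] by (intro sum.cong) (auto simp: distrib_right)
    also have "\<dots> = (\<Sum>A\<in>\<A>. a * c A * W A \<omega>) + (\<Sum>A\<in>\<B>. b * d A * W A \<omega>)"
      using 1(1) 2(1) by (simp add: sum.inter_restrict[symmetric] Int_absorb1)
    finally show ?thesis by (simp add: 1(3) 2(3) sum_distrib_left mult.assoc)
  qed
  then show ?thesis unfolding noise_span_def using 1(1,2) 2(1,2)
    by (intro CollectI exI[of _ "\<A> \<union> \<B>"] exI[of _ e]) auto
qed

locale noise = prob_space M for M :: "'w measure" +
  fixes L :: real and W :: "(real \<times> real) set \<Rightarrow> 'w \<Rightarrow> real"
  assumes white_noise: "white_noise M L W"
begin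

lemma noise_span_gaussian: "Y \<in> noise_span W (noise_sets L) \<Longrightarrow> centered_gaussian M Y"
  using white_noise unfolding white_noise_def by (auto elim!: noise_spanE)

lemma noise_span_measurable: "Y \<in> noise_span W (noise_sets L) \<Longrightarrow> Y \<in> borel_measurable M"
  using noise_span_gaussian unfolding centered_gaussian_def by blast

lemma noise_gaussian: "A \<in> noise_sets L \<Longrightarrow> centered_gaussian M (W A)"
  by (rule noise_span_gaussian[OF noise_span_base])

lemma noise_measurable: "A \<in> noise_sets L \<Longrightarrow> W A \<in> borel_measurable M"
  by (rule noise_span_measurable[OF noise_span_base])

lemma noise_covariance:
  "A \<in> noise_sets L \<Longrightarrow> B \<in> noise_sets L \<Longrightarrow> expectation (\<lambda>\<omega>. W A \<omega> * W B \<omega>) = measure lborel (A \<inter> B)"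
  using white_noise unfolding white_noise_def by blast

lemma integrable_mult_square:
  fixes X Y :: "'w \<Rightarrow> real"
  assumes [measurable]: "X \<in> borel_measurable M" "Y \<in> borel_measurable M"
    and "integrable M (\<lambda>\<omega>. (X \<omega>)\<^sup>2)" "integrable M (\<lambda>\<omega>. (Y \<omega>)\<^sup>2)"
  shows "integrable M (\<lambda>\<omega>. X \<omega> * Y \<omega>)"
proof (rule Bochner_Integration.integrable_bound)
  show "integrable M (\<lambda>\<omega>. (X \<omega>)\<^sup>2 + (Y \<omega>)\<^sup>2)" using assms by simp
  show "AE \<omega> in M. norm (X \<omega> * Y \<omega>) \<le> norm ((X \<omega>)\<^sup>2 + (Y \<omega>)\<^sup>2)"
  proof (rule AE_I2)
    fix \<omega>
    have "2 * (\<bar>X \<omega>\<bar> * \<bar>Y \<omega>\<bar>) \<le> (X \<omega>)\<^sup>2 + (Y \<omega>)\<^sup>2"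
      using sum_squares_bound[of "\<bar>X \<omega>\<bar>" "\<bar>Y \<omega>\<bar>"] by (simp add: mult_ac)
    moreover have "0 \<le> \<bar>X \<omega>\<bar> * \<bar>Y \<omega>\<bar>" by simp
    ultimately have "\<bar>X \<omega>\<bar> * \<bar>Y \<omega>\<bar> \<le> (X \<omega>)\<^sup>2 + (Y \<omega>)\<^sup>2" by linarith
    then show "norm (X \<omega> * Y \<omega>) \<le> norm ((X \<omega>)\<^sup>2 + (Y \<omega>)\<^sup>2)" by (simp add: abs_mult)
  qed
qed simp

lemma noise_square_integrable: "A \<in> noise_sets L \<Longrightarrow> integrable M (\<lambda>\<omega>. (W A \<omega>)\<^sup>2)"
  by (rule centered_gaussian_cos_sin(1)[OF noise_gaussian])

lemma noise_mult_integrable: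
  "A \<in> noise_sets L \<Longrightarrow> B \<in> noise_sets L \<Longrightarrow> integrable M (\<lambda>\<omega>. W A \<omega> * W B \<omega>)"
  by (intro integrable_mult_square noise_measurable noise_square_integrable)

lemma noise_span_orthogonal:
  assumes Y: "Y \<in> noise_span W S" and U: "U \<in> noise_span W T"
    and ST: "S \<subseteq> noise_sets L" "T \<subseteq> noise_sets L" "\<And>A B. A \<in> S \<Longrightarrow> B \<in> T \<Longrightarrow> A \<inter> B = {}"
  shows "expectation (\<lambda>\<omega>. Y \<omega> * U \<omega>) = 0"
proof -
  obtain \<A> c where 1: "finite \<A>" "\<A> \<subseteq> S" "Y = (\<lambda>\<omega>. \<Sum>A\<in>\<A>. c A * W A \<omega>)" using Y by (rule noise_spanE)
  obtain \<B> d where 2: "finite \<B>" "\<B> \<subseteq> T" "U = (\<lambda>\<omega>. \<Sum>A\<in>\<B>. d A * W A \<omega>)" using U by (rule noise_spanE)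
  have i: "integrable M (\<lambda>\<omega>. W A \<omega> * W B \<omega>)" if "A \<in> \<A>" "B \<in> \<B>" for A B
    using that ST 1(2) 2(2) by (intro noise_mult_integrable) auto
  have e: "expectation (\<lambda>\<omega>. W A \<omega> * W B \<omega>) = 0" if "A \<in> \<A>" "B \<in> \<B>" for A B
  proof -
    have AB: "A \<in> S" "B \<in> T" using that 1(2) 2(2) by auto
    then have "A \<inter> B = {}" by (rule ST(3))
    moreover have "A \<in> noise_sets L" "B \<in> noise_sets L" using AB ST by auto
    ultimately show ?thesis by (simp add: noise_covariance)
  qed
  have "expectation (\<lambda>\<omega>. Y \<omega> * U \<omega>) = expectation (\<lambda>\<omega>. \<Sum>A\<in>\<A>. \<Sum>B\<in>\<B>. c A * d B * (W A \<omega> * W B \<omega>))"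
    unfolding 1(3) 2(3) sum_product by (simp add: mult_ac)
  also have "\<dots> = (\<Sum>A\<in>\<A>. \<Sum>B\<in>\<B>. c A * d B * expectation (\<lambda>\<omega>. W A \<omega> * W B \<omega>))"
    using i by (subst Bochner_Integration.integral_sum, force)+ simp
  also have "\<dots> = 0" using e by (intro sum.neutral ballI) simp
  finally show ?thesis .
qed

definition past_sets :: "real \<Rightarrow> (real \<times> real) set set" where
  "past_sets a = {A \<in> noise_sets L. A \<subseteq> {0<..a} \<times> UNIV}"

definition future_sets :: "real \<Rightarrow> (real \<times> real) set set" where
  "future_sets a = {A \<in> noise_sets L. A \<subseteq> {a<..} \<times> UNIV}"

abbreviation "\<F> \<equiv> noise_filtration M L W"

lemma past_sets_noise: "past_sets a \<subseteq> noise_sets L" and future_sets_noise: "future_sets a \<subseteq> noise_sets L"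
  by (auto simp: past_sets_def future_sets_def)

text \<open>Past and future are uncorrelated, so \<open>Y + U\<close> and \<open>Y - U\<close> are
  centred Gaussian with the sum of the variances, and the exponentials factor. Both signs are
  recorded for the product-to-sum formulas used later.\<close>

lemma past_future_trig:
  assumes Y: "Y \<in> noise_span W (past_sets a)" and U: "U \<in> noise_span W (future_sets a)"
  shows "expectation (\<lambda>\<omega>. cos (Y \<omega> + U \<omega>)) = expectation (\<lambda>\<omega>. cos (Y \<omega>)) * expectation (\<lambda>\<omega>. cos (U \<omega>))"
    and "expectation (\<lambda>\<omega>. cos (Y \<omega> - U \<omega>)) = expectation (\<lambda>\<omega>. cos (Y \<omega>)) * expectation (\<lambda>\<omega>. cos (U \<omega>))"
    and "expectation (\<lambda>\<omega>. sin (Y \<omega> + U \<omega>)) = 0" and "expectation (\<lambda>\<omega>. sin (Y \<omega> - U \<omega>)) = 0"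
proof -
  have Y': "Y \<in> noise_span W (noise_sets L)" and U': "U \<in> noise_span W (noise_sets L)"
    using Y U noise_span_mono[OF past_sets_noise] noise_span_mono[OF future_sets_noise] by blast+
  note [measurable] = noise_span_measurable[OF Y'] noise_span_measurable[OF U']
  note gY = centered_gaussian_cos_sin[OF noise_span_gaussian[OF Y']]
  note gU = centered_gaussian_cos_sin[OF noise_span_gaussian[OF U']]
  have YU: "expectation (\<lambda>\<omega>. Y \<omega> * U \<omega>) = 0"
    by (rule noise_span_orthogonal[OF Y U past_sets_noise future_sets_noise])
       (fastforce simp: past_sets_def future_sets_def)
  have iYU: "integrable M (\<lambda>\<omega>. Y \<omega> * U \<omega>)" by (intro integrable_mult_square gY(1) gU(1)) auto
  have p: "(\<lambda>\<omega>. 1 * Y \<omega> + k * U \<omega>) \<in> noise_span W (noise_sets L)" for k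
    by (rule noise_span_linear[OF Y' U'])
  have v: "expectation (\<lambda>\<omega>. (1 * Y \<omega> + k * U \<omega>)\<^sup>2) = expectation (\<lambda>\<omega>. (Y \<omega>)\<^sup>2) + k\<^sup>2
      * expectation (\<lambda>\<omega>. (U \<omega>)\<^sup>2)" for k
  proof -
    have "(1 * Y \<omega> + k * U \<omega>)\<^sup>2 = (Y \<omega>)\<^sup>2 + k\<^sup>2 * (U \<omega>)\<^sup>2 + 2 * k * (Y \<omega> * U \<omega>)" for \<omega>
      by (simp add: power2_eq_square algebra_simps)
    then show ?thesis using gY(1) gU(1) iYU YU by simp
  qed
  note g = centered_gaussian_cos_sin(2,3)[OF noise_span_gaussian[OF p], unfolded v]
  show "expectation (\<lambda>\<omega>. cos (Y \<omega> + U \<omega>)) = expectation (\<lambda>\<omega>. cos (Y \<omega>)) * expectation (\<lambda>\<omega>. cos (U \<omega>))"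
    using g(1)[of 1] gY(2) gU(2) by (simp add: exp_add[symmetric] field_simps)
  show "expectation (\<lambda>\<omega>. cos (Y \<omega> - U \<omega>)) = expectation (\<lambda>\<omega>. cos (Y \<omega>)) * expectation (\<lambda>\<omega>. cos (U \<omega>))"
    using g(1)[of "-1"] gY(2) gU(2) by (simp add: exp_add[symmetric] field_simps)
  show "expectation (\<lambda>\<omega>. sin (Y \<omega> + U \<omega>)) = 0" "expectation (\<lambda>\<omega>. sin (Y \<omega> - U \<omega>)) = 0"
    using g(2)[of 1] g(2)[of "-1"] by simp_all
qed

text \<open>Multidimensional uniqueness of characteristic functions is avoided by treating one coordinate at a
  time: uniqueness on the line, applied to the positive weights \<open>h (1 + cos Y)\<close> and \<open>h (1 + sin Y)\<close>, shows
  that annihilation survives the restriction of \<open>h\<close> to an event determined by a single \<open>W A\<close>.\<close>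

definition annihilates :: "('w \<Rightarrow> real) \<Rightarrow> ('w \<Rightarrow> real) set \<Rightarrow> bool" where
  "annihilates h V \<longleftrightarrow> (\<forall>Y\<in>V. expectation (\<lambda>\<omega>. h \<omega> * cos (Y \<omega>)) = 0 \<and> expectation (\<lambda>\<omega>. h \<omega> * sin (Y \<omega>)) = 0)"

text \<open>The annihilating function is given as a difference because uniqueness on the line
  compares two nonnegative weights. The product-to-sum formulas lead to the combinations
  \<open>Y + t * W A\<close> and \<open>-Y + t * W A\<close>, which stay in the span, so the
  hypothesis applies to all of them.\<close>

lemma annihilates_restrict:
  assumes h: "integrable M h1" "integrable M h2" "\<And>\<omega>. h1 \<omega> \<ge> 0" "\<And>\<omega>. h2 \<omega> \<ge> 0"
    and ann: "annihilates (\<lambda>\<omega>. h1 \<omega> - h2 \<omega>) (noise_span W (past_sets a))"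
    and A: "A \<in> past_sets a" and B [measurable]: "B \<in> sets borel"
  shows "annihilates (\<lambda>\<omega>. h1 \<omega> * indicator B (W A \<omega>) - h2 \<omega> * indicator B (W A \<omega>)) (noise_span W (past_sets a))"
  unfolding annihilates_def
proof
  fix Y assume Y: "Y \<in> noise_span W (past_sets a)"
  let ?V = "noise_span W (past_sets a)" and ?X = "W A"
  have X: "?X \<in> ?V" by (rule noise_span_base[OF A])
  have m: "Z \<in> borel_measurable M" if "Z \<in> ?V" for Z
    using that noise_span_mono[OF past_sets_noise] noise_span_measurable by blast
  note [measurable] = m[OF X] m[OF Y]
  have [measurable]: "h1 \<in> borel_measurable M" "h2 \<in> borel_measurable M" using h by auto
  have lin: "(\<lambda>\<omega>. p * Y \<omega> + t * ?X \<omega>) \<in> ?V" for p t by (rule noise_span_linear[OF Y X])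
  have b: "integrable M (\<lambda>\<omega>. h \<omega> * f \<omega>)" if "integrable M h" "f \<in> borel_measurable M" "\<And>\<omega>. \<bar>f \<omega>\<bar> \<le> 2"
      for h f :: "'w \<Rightarrow> real"
  proof (rule Bochner_Integration.integrable_bound[of _ "\<lambda>\<omega>. 2 * \<bar>h \<omega>\<bar>"])
    show "AE \<omega> in M. norm (h \<omega> * f \<omega>) \<le> norm (2 * \<bar>h \<omega>\<bar>)"
      using mult_left_mono[OF that(3), of "\<bar>h _\<bar>"] by (intro AE_I2) (simp add: abs_mult mult.commute)
  qed (use that in auto)
  have d: "expectation (\<lambda>\<omega>. h1 \<omega> * f \<omega>) = expectation (\<lambda>\<omega>. h2 \<omega> * f \<omega>)
      \<longleftrightarrow> expectation (\<lambda>\<omega>. (h1 \<omega> - h2 \<omega>) * f \<omega>) = 0"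
    if "f \<in> borel_measurable M" "\<And>\<omega>. \<bar>f \<omega>\<bar> \<le> 2" for f
    using b[OF h(1) that] b[OF h(2) that] by (simp add: left_diff_distrib)
  have tr: "expectation (\<lambda>\<omega>. (h1 \<omega> - h2 \<omega>) * cos (p * Y \<omega> + t * ?X \<omega>)) = 0"
     "expectation (\<lambda>\<omega>. (h1 \<omega> - h2 \<omega>) * sin (p * Y \<omega> + t * ?X \<omega>)) = 0" for p t
    using bspec[OF ann[unfolded annihilates_def] lin[of p t]] by simp_all
  have ti: "integrable M (\<lambda>\<omega>. (h1 \<omega> - h2 \<omega>) * cos (p * Y \<omega> + t * ?X \<omega>))"
    "integrable M (\<lambda>\<omega>. (h1 \<omega> - h2 \<omega>) * sin (p * Y \<omega> + t * ?X \<omega>))" for p t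
    using h by (intro b; auto intro: order_trans[OF abs_cos_le_one] order_trans[OF abs_sin_le_one])+
  let ?D = "\<lambda>\<omega>. h1 \<omega> - h2 \<omega>"
  have key: "expectation (\<lambda>\<omega>. h1 \<omega> * g \<omega> * indicator B (?X \<omega>))
      = expectation (\<lambda>\<omega>. h2 \<omega> * g \<omega> * indicator B (?X \<omega>))"
    if g [measurable]: "g \<in> borel_measurable M" "\<And>\<omega>. 0 \<le> g \<omega>" "\<And>\<omega>. g \<omega> \<le> 2"
      and gc: "\<And>t. expectation (\<lambda>\<omega>. ?D \<omega> * (g \<omega> * cos (t * ?X \<omega>))) = 0"
      and gs: "\<And>t. expectation (\<lambda>\<omega>. ?D \<omega> * (g \<omega> * sin (t * ?X \<omega>))) = 0" for g
  proof (rule weighted_law_unique)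
    have le: "\<bar>g \<omega> * x\<bar> \<le> 2" if "\<bar>x\<bar> \<le> 1" for \<omega> x
      using mult_mono[OF g(3)[of \<omega>] that] g(2)[of \<omega>] by (simp add: abs_mult)
    show "integrable M (\<lambda>\<omega>. h1 \<omega> * g \<omega>)" "integrable M (\<lambda>\<omega>. h2 \<omega> * g \<omega>)"
      using b h g by auto
    show "expectation (\<lambda>\<omega>. h1 \<omega> * g \<omega> * cos (t * ?X \<omega>)) = expectation (\<lambda>\<omega>. h2 \<omega> * g \<omega> * cos (t * ?X \<omega>))" for t
      unfolding mult.assoc by (subst d) (use le gc in auto)
    show "expectation (\<lambda>\<omega>. h1 \<omega> * g \<omega> * sin (t * ?X \<omega>)) = expectation (\<lambda>\<omega>. h2 \<omega> * g \<omega> * sin (t * ?X \<omega>))" for t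
      unfolding mult.assoc by (subst d) (use le gs in auto)
  qed (use h g in auto)
  have k1: "expectation (\<lambda>\<omega>. h1 \<omega> * 1 * indicator B (?X \<omega>)) = expectation (\<lambda>\<omega>. h2 \<omega> * 1 * indicator B (?X \<omega>))"
    by (rule key) (use tr[of 0] in auto)
  have kc: "expectation (\<lambda>\<omega>. h1 \<omega> * (1 + cos (Y \<omega>)) * indicator B (?X \<omega>))
      = expectation (\<lambda>\<omega>. h2 \<omega> * (1 + cos (Y \<omega>)) * indicator B (?X \<omega>))"
  proof (rule key)
    fix t
    have 1: "?D \<omega> * ((1 + cos (Y \<omega>)) * cos (t * ?X \<omega>)) = ?D \<omega> * cos (0 * Y \<omega> + t * ?X \<omega>)
      + 1/2 * (?D \<omega> * cos (1 * Y \<omega> + t * ?X \<omega>)) + 1/2 * (?D \<omega> * cos ((-1) * Y \<omega> + t * ?X \<omega>))" for \<omega>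
      by (simp add: cos_add cos_diff algebra_simps)
    have 2: "?D \<omega> * ((1 + cos (Y \<omega>)) * sin (t * ?X \<omega>)) = ?D \<omega> * sin (0 * Y \<omega> + t * ?X \<omega>)
      + 1/2 * (?D \<omega> * sin (1 * Y \<omega> + t * ?X \<omega>)) + 1/2 * (?D \<omega> * sin ((-1) * Y \<omega> + t * ?X \<omega>))" for \<omega>
      by (simp add: sin_add sin_diff algebra_simps)
    show "expectation (\<lambda>\<omega>. ?D \<omega> * ((1 + cos (Y \<omega>)) * cos (t * ?X \<omega>))) = 0"
      unfolding 1 using ti(1)[of 0 t] ti(1)[of 1 t] ti(1)[of "-1" t] tr(1)[of 0 t] tr(1)[of 1 t] tr(1)[of
          "-1" t] by simp
    show "expectation (\<lambda>\<omega>. ?D \<omega> * ((1 + cos (Y \<omega>)) * sin (t * ?X \<omega>))) = 0"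
      unfolding 2 using ti(2)[of 0 t] ti(2)[of 1 t] ti(2)[of "-1" t] tr(2)[of 0 t] tr(2)[of 1 t] tr(2)[of
          "-1" t] by simp
    show "0 \<le> 1 + cos (Y \<omega>)" "1 + cos (Y \<omega>) \<le> 2" for \<omega>
      using cos_ge_minus_one[of "Y \<omega>"] cos_le_one[of "Y \<omega>"] by linarith+
  qed simp
  have ks: "expectation (\<lambda>\<omega>. h1 \<omega> * (1 + sin (Y \<omega>)) * indicator B (?X \<omega>))
      = expectation (\<lambda>\<omega>. h2 \<omega> * (1 + sin (Y \<omega>)) * indicator B (?X \<omega>))"
  proof (rule key)
    fix t
    have 1: "?D \<omega> * ((1 + sin (Y \<omega>)) * cos (t * ?X \<omega>)) = ?D \<omega> * cos (0 * Y \<omega> + t * ?X \<omega>)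
      + 1/2 * (?D \<omega> * sin (1 * Y \<omega> + t * ?X \<omega>)) + (-1/2) * (?D \<omega> * sin ((-1) * Y \<omega> + t * ?X \<omega>))" for \<omega>
      by (simp add: sin_add sin_diff algebra_simps)
    have 2: "?D \<omega> * ((1 + sin (Y \<omega>)) * sin (t * ?X \<omega>)) = ?D \<omega> * sin (0 * Y \<omega> + t * ?X \<omega>)
      + (-1/2) * (?D \<omega> * cos (1 * Y \<omega> + t * ?X \<omega>)) + 1/2 * (?D \<omega> * cos ((-1) * Y \<omega> + t * ?X \<omega>))" for \<omega>
      by (simp add: cos_add cos_diff algebra_simps)
    show "expectation (\<lambda>\<omega>. ?D \<omega> * ((1 + sin (Y \<omega>)) * cos (t * ?X \<omega>))) = 0"
      unfolding 1 using ti(1)[of 0 t] ti(2)[of 1 t] ti(2)[of "-1" t] tr(1)[of 0 t] tr(2)[of 1 t] tr(2)[of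
          "-1" t] by simp
    show "expectation (\<lambda>\<omega>. ?D \<omega> * ((1 + sin (Y \<omega>)) * sin (t * ?X \<omega>))) = 0"
      unfolding 2 using ti(2)[of 0 t] ti(1)[of 1 t] ti(1)[of "-1" t] tr(2)[of 0 t] tr(1)[of 1 t] tr(1)[of
          "-1" t] by simp
    show "0 \<le> 1 + sin (Y \<omega>)" "1 + sin (Y \<omega>) \<le> 2" for \<omega>
      using sin_ge_minus_one[of "Y \<omega>"] sin_le_one[of "Y \<omega>"] by linarith+
  qed simp
  have ii: "integrable M (\<lambda>\<omega>. h \<omega> * indicator B (?X \<omega>))" "integrable M (\<lambda>\<omega>. h \<omega> * indicator B (?X \<omega>)
      * cos (Y \<omega>))"
    "integrable M (\<lambda>\<omega>. h \<omega> * indicator B (?X \<omega>) * sin (Y \<omega>))" if "integrable M h" for h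
    unfolding mult.assoc using that
    by (intro b; auto simp: indicator_def intro: order_trans[OF abs_cos_le_one] order_trans[OF abs_sin_le_one])+
  \<comment> \<open>Subtracting the case of weight 1 recovers the cosine and the sine of
    \<open>Y\<close> alone.\<close>
  have e: "expectation (\<lambda>\<omega>. h \<omega> * (1 + cos (Y \<omega>)) * indicator B (?X \<omega>))
      = expectation (\<lambda>\<omega>. h \<omega> * 1 * indicator B (?X \<omega>)) + expectation (\<lambda>\<omega>. h \<omega> * indicator B (?X \<omega>) * cos (Y \<omega>))"
    "expectation (\<lambda>\<omega>. h \<omega> * (1 + sin (Y \<omega>)) * indicator B (?X \<omega>))
        = expectation (\<lambda>\<omega>. h \<omega> * 1 * indicator B (?X \<omega>)) + expectation (\<lambda>\<omega>. h \<omega> * indicator B (?X \<omega>)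
        * sin (Y \<omega>))"
    if "integrable M h" for h
    by (subst Bochner_Integration.integral_add[symmetric], use ii[OF that] in \<open>simp_all add: algebra_simps\<close>)+
  show "expectation (\<lambda>\<omega>. (h1 \<omega> * indicator B (W A \<omega>) - h2 \<omega> * indicator B (W A \<omega>)) * cos (Y \<omega>)) = 0 \<and>
    expectation (\<lambda>\<omega>. (h1 \<omega> * indicator B (W A \<omega>) - h2 \<omega> * indicator B (W A \<omega>)) * sin (Y \<omega>)) = 0"
    using k1 kc ks ii[OF h(1)] ii[OF h(2)] by (simp add: e[OF h(1)] e[OF h(2)] left_diff_distrib)
qed

end

section \<open>From cylinder events to the filtration\<close>

context noise
begin

lemma space_noise_filtration [simp]: "space (\<F> a) = space M"
  by (simp add: noise_filtration_def space_measure_of_conv)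

lemma noise_filtration_generator:
  "{W A -` B \<inter> space M | A B. A \<in> noise_sets L \<and> A \<subseteq> {0<..a} \<times> UNIV \<and> B \<in> sets borel} \<union> null_sets M \<subseteq> sets M"
  using noise_measurable by (auto intro: measurable_sets)

lemma sets_noise_filtration: "sets (\<F> a) = sigma_sets (space M)
     ({W A -` B \<inter> space M | A B. A \<in> noise_sets L \<and> A \<subseteq> {0<..a} \<times> UNIV \<and> B \<in> sets borel} \<union> null_sets M)"
  unfolding noise_filtration_def
  by (rule sets_measure_of) (use noise_filtration_generator sets.space_closed in blast)

lemma sets_noise_filtration_le: "sets (\<F> a) \<subseteq> sets M"
  unfolding sets_noise_filtration by (rule sets.sigma_sets_subset[OF noise_filtration_generator])

lemma measurable_noise_filtration: "X \<in> borel_measurable (\<F> a) \<Longrightarrow> X \<in> borel_measurable M"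
  using sets_noise_filtration_le by (auto simp: measurable_def)

lemma noise_filtration_mono:
  assumes "a \<le> b"
  shows "sets (\<F> a) \<subseteq> sets (\<F> b)"
  unfolding sets_noise_filtration
proof (rule sigma_sets_subseteq, rule Un_mono)
  have "{0<..a} \<times> UNIV \<subseteq> ({0<..b} \<times> UNIV :: (real \<times> real) set)" using assms by auto
  then show "{W A -` B \<inter> space M |A B. A \<in> noise_sets L \<and> A \<subseteq> {0<..a} \<times> UNIV \<and> B \<in> sets borel}
    \<subseteq> {W A -` B \<inter> space M |A B. A \<in> noise_sets L \<and> A \<subseteq> {0<..b} \<times> UNIV \<and> B \<in> sets borel}"
    by blast
qed simp

lemma measurable_noise_filtration_mono:
  "X \<in> borel_measurable (\<F> a) \<Longrightarrow> a \<le> b \<Longrightarrow> X \<in> borel_measurable (\<F> b)"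
  using noise_filtration_mono[of a b] by (auto simp: measurable_def)

lemma noise_past_measurable: "A \<in> past_sets a \<Longrightarrow> W A \<in> borel_measurable (\<F> a)"
proof (rule measurableI)
  fix B :: "real set" assume "A \<in> past_sets a" "B \<in> sets borel"
  then have "W A -` B \<inter> space M \<in> {W A -` B \<inter> space M | A B. A \<in> noise_sets L \<and> A \<subseteq> {0<..a} \<times> UNIV
      \<and> B \<in> sets borel}"
    unfolding past_sets_def by blast
  then show "W A -` B \<inter> space (\<F> a) \<in> sets (\<F> a)"
    unfolding sets_noise_filtration space_noise_filtration by (intro sigma_sets.Basic UnI1)
qed simp

text \<open>Built one factor at a time to match the one-coordinate restriction lemma. Together with
  the null sets these events form a pi-system that generates the filtration.\<close>

inductive_set cylinders :: "real \<Rightarrow> 'w set set" for a where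
  cyl_space: "space M \<in> cylinders a"
| cyl_Int: "A \<in> past_sets a \<Longrightarrow> B \<in> sets borel \<Longrightarrow> G \<in> cylinders a \<Longrightarrow> (W A -` B \<inter> space M) \<inter> G \<in> cylinders a"

lemma cylinders_events: "G \<in> cylinders a \<Longrightarrow> G \<in> events"
  by (induction rule: cylinders.induct)
     (use past_sets_noise in \<open>auto intro!: sets.Int measurable_sets[OF noise_measurable]\<close>)

lemma cylinders_Int: "G \<in> cylinders a \<Longrightarrow> H \<in> cylinders a \<Longrightarrow> G \<inter> H \<in> cylinders a"
proof (induction rule: cylinders.induct)
  case cyl_space
  then show ?case using sets.sets_into_space[OF cylinders_events] by (simp add: Int_absorb1)
next
  case (cyl_Int A B G)
  then show ?case using cylinders.cyl_Int[of A a B "G \<inter> H"] by (simp add: Int_assoc)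
qed

lemma annihilates_cylinder:
  assumes h: "integrable M h1" "integrable M h2" "\<And>\<omega>. h1 \<omega> \<ge> 0" "\<And>\<omega>. h2 \<omega> \<ge> 0"
    and ann: "annihilates (\<lambda>\<omega>. h1 \<omega> - h2 \<omega>) (noise_span W (past_sets a))"
    and G: "G \<in> cylinders a"
  shows "annihilates (\<lambda>\<omega>. h1 \<omega> * indicator G \<omega> - h2 \<omega> * indicator G \<omega>) (noise_span W (past_sets a))"
  using G
proof induction
  case cyl_space
  have "expectation (\<lambda>\<omega>. (h1 \<omega> * indicator (space M) \<omega> - h2 \<omega> * indicator (space M) \<omega>) * f \<omega>)
      = expectation (\<lambda>\<omega>. (h1 \<omega> - h2 \<omega>) * f \<omega>)" for f :: "'w \<Rightarrow> real"
    by (rule Bochner_Integration.integral_cong) auto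
  then show ?case using ann unfolding annihilates_def by simp
next
  case (cyl_Int A B G)
  have [measurable]: "G \<in> events" by (rule cylinders_events) fact
  have i: "integrable M (\<lambda>\<omega>. h \<omega> * indicator G \<omega>)" if "integrable M h" for h :: "'w \<Rightarrow> real"
    using that by (intro integrable_real_mult_indicator) auto
  have "annihilates (\<lambda>\<omega>. h1 \<omega> * indicator G \<omega> * indicator B (W A \<omega>) - h2 \<omega> * indicator G \<omega>
      * indicator B (W A \<omega>)) (noise_span W (past_sets a))"
    by (rule annihilates_restrict) (use cyl_Int h i in auto)
  moreover have "expectation (\<lambda>\<omega>. (h1 \<omega> * indicator G \<omega> * indicator B (W A \<omega>) - h2 \<omega> * indicator G \<omega>
      * indicator B (W A \<omega>)) * f \<omega>) =
     expectation (\<lambda>\<omega>. (h1 \<omega> * indicator (W A -` B \<inter> space M \<inter> G) \<omega> - h2 \<omega>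
         * indicator (W A -` B \<inter> space M \<inter> G) \<omega>) * f \<omega>)" for f :: "'w \<Rightarrow> real"
    by (rule Bochner_Integration.integral_cong) (auto simp: indicator_def)
  ultimately show ?case unfolding annihilates_def by simp
qed

text \<open>Dynkin's theorem over cylinders and null sets. The zero function lies in the span and
  its cosine is 1, so annihilation after restriction to a cylinder contains the equality of the two
  integrals there.\<close>

lemma annihilates_filtration:
  assumes h: "integrable M h1" "integrable M h2" "\<And>\<omega>. h1 \<omega> \<ge> 0" "\<And>\<omega>. h2 \<omega> \<ge> 0"
    and ann: "annihilates (\<lambda>\<omega>. h1 \<omega> - h2 \<omega>) (noise_span W (past_sets a))"
    and G: "G \<in> sets (\<F> a)"
  shows "expectation (\<lambda>\<omega>. h1 \<omega> * indicator G \<omega>) = expectation (\<lambda>\<omega>. h2 \<omega> * indicator G \<omega>)"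
proof -
  have i: "integrable M (\<lambda>\<omega>. h \<omega> * indicator G \<omega>)" if "integrable M h" "G \<in> events" for h :: "'w \<Rightarrow> real" and G
    using that by (intro integrable_real_mult_indicator) auto
  have zero: "(\<lambda>_. 0) \<in> noise_span W (past_sets a)"
    unfolding noise_span_def by (intro CollectI exI[of _ "{}"]) simp
  have cyl: "expectation (\<lambda>\<omega>. h1 \<omega> * indicator G \<omega>) = expectation (\<lambda>\<omega>. h2 \<omega> * indicator G \<omega>)"
      if "G \<in> cylinders a" for G
  proof -
    have "expectation (\<lambda>\<omega>. h1 \<omega> * indicator G \<omega> - h2 \<omega> * indicator G \<omega>) = 0"
      using bspec[OF annihilates_cylinder[OF h ann that, unfolded annihilates_def] zero] by simp
    then show ?thesis using i[OF h(1)] i[OF h(2)] cylinders_events[OF that] by simp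
  qed
  have sp: "expectation h1 = expectation h2"
  proof -
    have "expectation (\<lambda>\<omega>. h \<omega> * indicator (space M) \<omega>) = expectation h" for h :: "'w \<Rightarrow> real"
      by (rule Bochner_Integration.integral_cong) auto
    then show ?thesis using cyl[OF cyl_space] by simp
  qed
  let ?G = "cylinders a \<union> null_sets M"
  have GG: "G \<in> sigma_sets (space M) ?G"
  proof -
    have "{W A -` B \<inter> space M | A B. A \<in> noise_sets L \<and> A \<subseteq> {0<..a} \<times> UNIV \<and> B \<in> sets borel} \<subseteq> cylinders a"
    proof safe
      fix A and B :: "real set" assume "A \<in> noise_sets L" "A \<subseteq> {0<..a} \<times> UNIV" "B \<in> sets borel"
      then have "(W A -` B \<inter> space M) \<inter> space M \<in> cylinders a"
        by (intro cylinders.intros) (auto simp: past_sets_def)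
      then show "W A -` B \<inter> space M \<in> cylinders a" by (simp add: Int_assoc)
    qed
    then show ?thesis
      using G sigma_sets_subseteq[OF Un_mono[OF _ order_refl], of _ "cylinders a" "space M" "null_sets M"]
      unfolding sets_noise_filtration by blast
  qed
  have stable: "Int_stable ?G"
  proof (rule Int_stableI)
    fix G H assume "G \<in> ?G" "H \<in> ?G"
    then show "G \<inter> H \<in> ?G"
      using cylinders_Int[of G a H] cylinders_events[of _ a] null_set_Int1[of G M H] null_set_Int1[of H M G]
      by (auto simp: Int_commute intro: null_set_Int2)
  qed
  have GE: "?G \<subseteq> events" using cylinders_events by auto
  then have "?G \<subseteq> Pow (space M)" using sets.sets_into_space by blast
  from stable this GG show ?thesis
  proof (induction rule: sigma_sets_induct_disjoint)
    case (basic A)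
    then show ?case
    proof
      assume A: "A \<in> null_sets M"
      have "expectation (\<lambda>\<omega>. h \<omega> * indicator A \<omega>) = 0" if "integrable M h" for h :: "'w \<Rightarrow> real"
      proof -
        have "expectation (\<lambda>\<omega>. h \<omega> * indicator A \<omega>) = expectation (\<lambda>_. 0)"
          by (rule integral_cong_AE) (use that A AE_not_in[OF A] in \<open>auto simp: null_sets_def\<close>)
        then show ?thesis by simp
      qed
      then show ?case using h by simp
    qed (rule cyl)
  next
    case empty
    then show ?case by simp
  next
    case (compl A)
    have A: "A \<in> events"
      using compl(1) sets.sigma_sets_subset[OF GE] by blast
    have "expectation (\<lambda>\<omega>. h \<omega> * indicator (space M - A) \<omega>)
        = expectation h - expectation (\<lambda>\<omega>. h \<omega> * indicator A \<omega>)"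
      if "integrable M h" for h :: "'w \<Rightarrow> real"
    proof -
      have "expectation (\<lambda>\<omega>. h \<omega> * indicator (space M - A) \<omega>) = expectation (\<lambda>\<omega>. h \<omega> - h \<omega> * indicator A \<omega>)"
        by (rule Bochner_Integration.integral_cong) (auto simp: indicator_def)
      then show ?thesis using that i[OF that A] by simp
    qed
    then show ?case using h compl.IH sp by simp
  next
    case (union A)
    have A: "A i \<in> events" for i
      using union(2) sets.sigma_sets_subset[OF GE] by blast
    have "expectation (\<lambda>\<omega>. h \<omega> * indicator (\<Union>i. A i) \<omega>) = (\<Sum>i. expectation (\<lambda>\<omega>. h \<omega> * indicator (A i) \<omega>))"
      if h: "integrable M h" for h :: "'w \<Rightarrow> real"
    proof -
      have "set_integrable M (\<Union>i. A i) h"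
        using i[OF h, of "\<Union>i. A i"] A by (auto simp: set_integrable_def mult.commute)
      moreover have "A i \<inter> A j = {}" if "i \<noteq> j" for i j
        using union(1) that by (auto simp: disjoint_family_on_def)
      ultimately show ?thesis
        using lebesgue_integral_countable_add[of A M h, OF A]
            by (simp add: set_lebesgue_integral_def mult.commute)
    qed
    then show ?case using h union.IH by simp
  qed
qed

text \<open>Both \<open>cos (t * U)\<close> minus its mean and \<open>sin (t * U)\<close> annihilate
  the span of the past, hence their integrals over a past event \<open>G\<close> factor; uniqueness
  on the line then gives the product formula for \<open>G\<close> and any event of \<open>U\<close>.
  The function \<open>f\<close> will be the identity and the square.\<close>

lemma noise_future_indep:
  fixes Z :: "'w \<Rightarrow> real" and f :: "real \<Rightarrow> real"
  assumes U: "U \<in> noise_span W (future_sets a)" and Z: "Z \<in> borel_measurable (\<F> a)"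
    and f [measurable]: "f \<in> borel_measurable borel"
  shows "indep_var borel Z borel (\<lambda>\<omega>. f (U \<omega>))"
proof -
  have U': "U \<in> noise_span W (noise_sets L)" using U noise_span_mono[OF future_sets_noise] by blast
  note [measurable] = noise_span_measurable[OF U'] measurable_noise_filtration[OF Z]
  have b: "integrable M f" if "f \<in> borel_measurable M" "\<And>\<omega>. \<bar>f \<omega>\<bar> \<le> 2" for f :: "'w \<Rightarrow> real"
    using that by (intro integrable_const_bound[of _ 2]) auto
  have c1: "\<bar>1 + cos x\<bar> \<le> 2" "\<bar>1 + sin x\<bar> \<le> 2" "0 \<le> 1 + cos x" "0 \<le> 1 + sin x" for x :: real
    using cos_ge_minus_one[of x] cos_le_one[of x] sin_ge_minus_one[of x] sin_le_one[of x]
    unfolding abs_le_iff by linarith+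
  have c2: "\<bar>cos x\<bar> \<le> 2" "\<bar>sin x\<bar> \<le> 2" for x :: real
    using abs_cos_le_one[of x] abs_sin_le_one[of x] by linarith+
  have c3: "\<bar>x * y\<bar> \<le> 2" if "\<bar>x\<bar> \<le> 1" "\<bar>y\<bar> \<le> 1" for x y :: real
    using mult_mono[OF that] by (simp add: abs_mult)
  have E1: "\<bar>expectation (\<lambda>\<omega>. cos (V \<omega>))\<bar> \<le> 1" if "V \<in> borel_measurable M" for V :: "'w \<Rightarrow> real"
  proof -
    have "\<bar>expectation (\<lambda>\<omega>. cos (V \<omega>))\<bar> \<le> expectation (\<lambda>\<omega>. \<bar>cos (V \<omega>)\<bar>)" by (rule integral_abs_bound)
    also have "\<dots> \<le> expectation (\<lambda>_. 1)" using that by (intro integral_mono b) (auto intro: c2)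
    finally show ?thesis by (simp add: prob_space)
  qed
  have prob_eq: "prob (G \<inter> (U -` B \<inter> space M)) = prob G * prob (U -` B \<inter> space M)"
    if G: "G \<in> sets (\<F> a)" and B [measurable]: "B \<in> sets borel" for G B
  proof -
    have GM [measurable]: "G \<in> events" using G sets_noise_filtration_le by auto
    have key: "expectation (\<lambda>\<omega>. indicator G \<omega> * cos (t * U \<omega>)) = prob G * expectation (\<lambda>\<omega>. cos (t * U \<omega>))"
      "expectation (\<lambda>\<omega>. indicator G \<omega> * sin (t * U \<omega>)) = prob G * expectation (\<lambda>\<omega>. sin (t * U \<omega>))" for t
    proof -
      define e where "e = expectation (\<lambda>\<omega>. cos (t * U \<omega>))"
      have tU: "(\<lambda>\<omega>. t * U \<omega>) \<in> noise_span W (future_sets a)"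
        using noise_span_linear[OF U U, of t 0] by simp
      have ig: "integrable M (\<lambda>\<omega>. cos (t * U \<omega>) * cos (Y \<omega>))" "integrable M (\<lambda>\<omega>. cos (t * U \<omega>) * sin (Y \<omega>))"
        if [measurable]: "Y \<in> borel_measurable M" for Y
        by (rule b; auto intro!: c3)+
      have e1: "0 \<le> 1 + e" using E1[of "\<lambda>\<omega>. t * U \<omega>"] by (simp add: e_def)
      have i1: "integrable M (\<lambda>\<omega>. 1 + cos (t * U \<omega>))" "integrable M (\<lambda>\<omega>. 1 + sin (t * U \<omega>))"
        by (rule b; simp add: c1)+
      have ann: "expectation (\<lambda>\<omega>. cos (t * U \<omega>) * cos (Y \<omega>)) = e * expectation (\<lambda>\<omega>. cos (Y \<omega>)) \<and>
          expectation (\<lambda>\<omega>. cos (t * U \<omega>) * sin (Y \<omega>)) = 0 \<and>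
          expectation (\<lambda>\<omega>. sin (t * U \<omega>) * cos (Y \<omega>)) = 0 \<and>
          expectation (\<lambda>\<omega>. sin (t * U \<omega>) * sin (Y \<omega>)) = 0 \<and> expectation (\<lambda>\<omega>. sin (Y \<omega>)) = 0
              \<and> Y \<in> borel_measurable M"
        if Y: "Y \<in> noise_span W (past_sets a)" for Y
      proof -
        have Y': "Y \<in> noise_span W (noise_sets L)" using Y noise_span_mono[OF past_sets_noise] by blast
        note [measurable] = noise_span_measurable[OF Y']
        have i: "integrable M (\<lambda>\<omega>. cos (Y \<omega> + t * U \<omega>))" "integrable M (\<lambda>\<omega>. cos (Y \<omega> - t * U \<omega>))"
          "integrable M (\<lambda>\<omega>. sin (Y \<omega> + t * U \<omega>))" "integrable M (\<lambda>\<omega>. sin (Y \<omega> - t * U \<omega>))"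
          by (rule b; simp add: c2)+
        have *: "cos (t * U \<omega>) * cos (Y \<omega>) = 1/2 * cos (Y \<omega> + t * U \<omega>) + 1/2 * cos (Y \<omega> - t * U \<omega>)"
          "cos (t * U \<omega>) * sin (Y \<omega>) = 1/2 * sin (Y \<omega> + t * U \<omega>) + 1/2 * sin (Y \<omega> - t * U \<omega>)"
          "sin (t * U \<omega>) * cos (Y \<omega>) = 1/2 * sin (Y \<omega> + t * U \<omega>) - 1/2 * sin (Y \<omega> - t * U \<omega>)"
          "sin (t * U \<omega>) * sin (Y \<omega>) = 1/2 * cos (Y \<omega> - t * U \<omega>) - 1/2 * cos (Y \<omega> + t * U \<omega>)" for \<omega>
          by (simp_all add: cos_add cos_diff sin_add sin_diff field_simps)
        note pf = past_future_trig[OF Y tU]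
        have "expectation (\<lambda>\<omega>. cos (t * U \<omega>) * cos (Y \<omega>)) = e * expectation (\<lambda>\<omega>. cos (Y \<omega>))"
          unfolding *(1) by (simp only: Bochner_Integration.integral_add integrable_mult_right i
              integral_mult_right_zero pf e_def)
            simp
        moreover have "expectation (\<lambda>\<omega>. cos (t * U \<omega>) * sin (Y \<omega>)) = 0"
          unfolding *(2) by (simp only: Bochner_Integration.integral_add integrable_mult_right i
              integral_mult_right_zero pf)
        moreover have "expectation (\<lambda>\<omega>. sin (t * U \<omega>) * cos (Y \<omega>)) = 0"
          unfolding *(3) by (simp only: Bochner_Integration.integral_diff integrable_mult_right i
              integral_mult_right_zero pf)
        moreover have "expectation (\<lambda>\<omega>. sin (t * U \<omega>) * sin (Y \<omega>)) = 0"
          unfolding *(4) by (simp only: Bochner_Integration.integral_diff integrable_mult_right i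
              integral_mult_right_zero pf)
        ultimately show ?thesis
          using centered_gaussian_cos_sin(3)[OF noise_span_gaussian[OF Y']] noise_span_measurable[OF Y']
              by blast
      qed
      \<comment> \<open>The number 1 is added on both sides so that the two weights compared are
        nonnegative.\<close>
      have "expectation (\<lambda>\<omega>. (1 + cos (t * U \<omega>)) * indicator G \<omega>) = expectation (\<lambda>\<omega>. (1 + e) * indicator G \<omega>)"
      proof (rule annihilates_filtration[OF _ _ _ _ _ G])
        show "annihilates (\<lambda>\<omega>. 1 + cos (t * U \<omega>) - (1 + e)) (noise_span W (past_sets a))"
          unfolding annihilates_def
        proof (intro ballI conjI)
          fix Y assume Y: "Y \<in> noise_span W (past_sets a)"
          note a = ann[OF Y]
          have m [measurable]: "Y \<in> borel_measurable M" using a by blast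
          have "integrable M (\<lambda>\<omega>. cos (Y \<omega>))" "integrable M (\<lambda>\<omega>. sin (Y \<omega>))"
            by (rule b; simp add: c2)+
          then show "expectation (\<lambda>\<omega>. (1 + cos (t * U \<omega>) - (1 + e)) * cos (Y \<omega>)) = 0"
             "expectation (\<lambda>\<omega>. (1 + cos (t * U \<omega>) - (1 + e)) * sin (Y \<omega>)) = 0"
            using a ig[OF m] by (simp_all add: left_diff_distrib)
        qed
      qed (use e1 c1 i1 in auto)
      moreover have iG: "integrable M (\<lambda>\<omega>. indicator G \<omega> * cos (t * U \<omega>))" "integrable M (\<lambda>\<omega>. indicator G \<omega>
          * sin (t * U \<omega>))"
        by (rule b; auto simp: indicator_def intro: c2)+
      moreover have "(1 + x) * indicator G \<omega> = indicator G \<omega> + indicator G \<omega> * x" for x :: real and \<omega>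
        by (simp add: algebra_simps)
      moreover have iI: "integrable M (indicator G :: 'w \<Rightarrow> real)"
          by (simp add: integrable_indicator_iff emeasure_eq_measure)
      ultimately show "expectation (\<lambda>\<omega>. indicator G \<omega> * cos (t * U \<omega>))
          = prob G * expectation (\<lambda>\<omega>. cos (t * U \<omega>))"
        by (simp add: e_def)
      have "expectation (\<lambda>\<omega>. (1 + sin (t * U \<omega>)) * indicator G \<omega>) = expectation (\<lambda>\<omega>. 1 * indicator G \<omega>)"
      proof (rule annihilates_filtration[OF _ _ _ _ _ G])
        show "annihilates (\<lambda>\<omega>. 1 + sin (t * U \<omega>) - 1) (noise_span W (past_sets a))"
          unfolding annihilates_def using ann by simp
      qed (use c1 i1 in auto)
      moreover have "(1 + x) * indicator G \<omega> = indicator G \<omega> + indicator G \<omega> * x" for x :: real and \<omega>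
        by (simp add: algebra_simps)
      moreover have "expectation (\<lambda>\<omega>. sin (t * U \<omega>)) = 0"
        by (rule centered_gaussian_cos_sin(3)[OF noise_span_gaussian])
           (use tU noise_span_mono[OF future_sets_noise] in blast)
      ultimately show "expectation (\<lambda>\<omega>. indicator G \<omega> * sin (t * U \<omega>))
          = prob G * expectation (\<lambda>\<omega>. sin (t * U \<omega>))"
        using iG iI by simp
    qed
    \<comment> \<open>The two weights compared are the indicator of \<open>G\<close> and the
      constant \<open>prob G\<close>.\<close>
    have "expectation (\<lambda>\<omega>. indicator G \<omega> * indicator B (U \<omega>)) = expectation (\<lambda>\<omega>. prob G * indicator B (U \<omega>))"
      by (rule weighted_law_unique) (use key in \<open>auto simp: integrable_indicator_iff emeasure_eq_measure\<close>)
    moreover have "expectation (\<lambda>\<omega>. indicator G \<omega> * indicator B (U \<omega>) :: real)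
        = expectation (indicator (G \<inter> (U -` B \<inter> space M)))"
      by (rule Bochner_Integration.integral_cong) (auto simp: indicator_def)
    moreover have "expectation (\<lambda>\<omega>. indicator B (U \<omega>) :: real) = expectation (indicator (U -` B \<inter> space M))"
      by (rule Bochner_Integration.integral_cong) (auto simp: indicator_def)
    moreover have "U -` B \<inter> space M \<in> events" by measurable
    ultimately show ?thesis by (simp add: sets.Int del: Int_assoc)
  qed
  show ?thesis
    unfolding indep_var_eq
  proof (intro conjI indep_setI)
    fix a' b' assume a': "a' \<in> sigma_sets (space M) {Z -` A \<inter> space M |A. A \<in> sets borel}"
      and b': "b' \<in> sigma_sets (space M) {(\<lambda>\<omega>. f (U \<omega>)) -` A \<inter> space M |A. A \<in> sets borel}"
    have "sigma_sets (space (\<F> a)) {Z -` A \<inter> space M |A. A \<in> sets borel} \<subseteq> sets (\<F> a)"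
      using measurable_sets[OF Z] by (intro sets.sigma_sets_subset) auto
    then have 1: "a' \<in> sets (\<F> a)" using a' by auto
    have "sigma_sets (space M) {(\<lambda>\<omega>. f (U \<omega>)) -` A \<inter> space M |A. A \<in> sets borel} \<subseteq> {U -` B \<inter> space M | B. B
        \<in> sets borel}"
    proof -
      have "sigma_algebra (space M) {U -` B \<inter> space M | B. B \<in> sets borel}"
        using sets.sigma_algebra_axioms[of "vimage_algebra (space M) U borel"]
        by (simp add: sets_vimage_algebra2)
      then show ?thesis
      proof (rule sigma_algebra.sigma_sets_subset)
        show "{(\<lambda>\<omega>. f (U \<omega>)) -` A \<inter> space M |A. A \<in> sets borel} \<subseteq> {U -` B \<inter> space M | B. B \<in> sets borel}"
        proof safe
          fix A :: "real set" assume A: "A \<in> sets borel"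
          have "f -` A \<in> sets borel" using measurable_sets[OF f A] by simp
          then show "\<exists>B. (\<lambda>\<omega>. f (U \<omega>)) -` A \<inter> space M = U -` B \<inter> space M \<and> B \<in> sets borel"
            by (intro exI[of _ "f -` A"]) auto
        qed
      qed
    qed
    then obtain B where "b' = U -` B \<inter> space M" "B \<in> sets borel" using b' by blast
    then show "prob (a' \<inter> b') = prob a' * prob b'" using prob_eq[OF 1] by simp
  next
    show "sigma_sets (space M) {Z -` A \<inter> space M |A. A \<in> sets borel} \<subseteq> events"
      by (intro sets.sigma_sets_subset) (auto intro!: measurable_sets)
    show "sigma_sets (space M) {(\<lambda>\<omega>. f (U \<omega>)) -` A \<inter> space M |A. A \<in> sets borel} \<subseteq> events"
      by (intro sets.sigma_sets_subset) (auto intro!: measurable_sets)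
  qed measurable
qed

end

section \<open>The Walsh isometry\<close>

lemma noise_rectangle:
  assumes "0 \<le> a" "A \<in> sets borel" "A \<subseteq> {0<..<L}"
  shows "{a<..b} \<times> A \<in> noise_sets L"
proof -
  have m: "{a<..b} \<times> A \<in> sets (borel \<Otimes>\<^sub>M borel)" using assms(2) by (intro pair_measureI) auto
  then have m': "{a<..b} \<times> A \<in> sets borel" unfolding borel_prod .
  have "emeasure lborel ({a<..b} \<times> A) = emeasure (lborel \<Otimes>\<^sub>M lborel) ({a<..b} \<times> A)" by (simp add: lborel_prod)
  also have "\<dots> = emeasure lborel {a<..b} * emeasure lborel A"
    using assms(2) by (intro lborel.emeasure_pair_measure_Times) auto
  also have "\<dots> \<le> emeasure lborel {a<..b} * emeasure lborel {0<..<L}"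
    using assms by (intro mult_left_mono emeasure_mono) auto
  also have "\<dots> < \<infinity>"
    by (cases "a \<le> b"; cases "0 \<le> L") (simp_all add: ennreal_mult_less_top)
  finally show ?thesis using assms m' by (auto simp: noise_sets_def)
qed

section \<open>Products of noise increments and elementary integrals\<close>

context noise
begin

lemma noise_future_span:
  assumes U: "U \<in> noise_span W (future_sets a)" and Z: "Z \<in> borel_measurable (\<F> a)" and i: "integrable M Z"
  shows "integrable M (\<lambda>\<omega>. Z \<omega> * U \<omega>)" "expectation (\<lambda>\<omega>. Z \<omega> * U \<omega>) = 0"
    and "integrable M (\<lambda>\<omega>. Z \<omega> * (U \<omega>)\<^sup>2)"
    and "expectation (\<lambda>\<omega>. Z \<omega> * (U \<omega>)\<^sup>2) = expectation Z * expectation (\<lambda>\<omega>. (U \<omega>)\<^sup>2)"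
proof -
  have U': "U \<in> noise_span W (noise_sets L)" using U noise_span_mono[OF future_sets_noise] by blast
  note g = centered_gaussian_cos_sin[OF noise_span_gaussian[OF U']]
  have iU: "integrable M U" by (rule square_integrable_imp_integrable[OF noise_span_measurable[OF U'] g(1)])
  have 1: "indep_var borel Z borel U" using noise_future_indep[OF U Z, of "\<lambda>x. x"] by simp
  show "integrable M (\<lambda>\<omega>. Z \<omega> * U \<omega>)" by (rule indep_var_integrable[OF 1 i iU])
  show "expectation (\<lambda>\<omega>. Z \<omega> * U \<omega>) = 0" using indep_var_lebesgue_integral[OF 1 i iU] g(4) by simp
  have 2: "indep_var borel Z borel (\<lambda>\<omega>. (U \<omega>)\<^sup>2)" using noise_future_indep[OF U Z, of "\<lambda>x. x\<^sup>2"] by simp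
  show "integrable M (\<lambda>\<omega>. Z \<omega> * (U \<omega>)\<^sup>2)" by (rule indep_var_integrable[OF 2 i g(1)])
  show "expectation (\<lambda>\<omega>. Z \<omega> * (U \<omega>)\<^sup>2) = expectation Z * expectation (\<lambda>\<omega>. (U \<omega>)\<^sup>2)"
    by (rule indep_var_lebesgue_integral[OF 2 i g(1)])
qed

text \<open>Independence is available for functions of a single element of the span, so the product
  of two increments is polarised into the squares of their sum and difference.\<close>

lemma noise_future_product:
  assumes C: "C \<in> future_sets a" and D: "D \<in> future_sets a" and Z: "Z \<in> borel_measurable (\<F> a)"
      and i: "integrable M Z"
  shows "integrable M (\<lambda>\<omega>. Z \<omega> * (W C \<omega> * W D \<omega>))"
    and "expectation (\<lambda>\<omega>. Z \<omega> * (W C \<omega> * W D \<omega>)) = expectation Z * measure lborel (C \<inter> D)"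
proof -
  have CD: "C \<in> noise_sets L" "D \<in> noise_sets L" using C D future_sets_noise by auto
  have sp: "(\<lambda>\<omega>. 1 * W C \<omega> + k * W D \<omega>) \<in> noise_span W (future_sets a)" for k
    by (intro noise_span_linear noise_span_base C D)
  note p = noise_future_span(3,4)[OF sp[of 1] Z i] and m = noise_future_span(3,4)[OF sp[of "-1"] Z i]
  have eq: "Z \<omega> * (W C \<omega> * W D \<omega>) = 1/4 * (Z \<omega> * (1 * W C \<omega> + 1 * W D \<omega>)\<^sup>2) - 1/4 * (Z \<omega> * (1 * W C \<omega> + (-1)
      * W D \<omega>)\<^sup>2)" for \<omega>
    by (simp add: power2_eq_square algebra_simps)
  show "integrable M (\<lambda>\<omega>. Z \<omega> * (W C \<omega> * W D \<omega>))"
    unfolding eq by (intro Bochner_Integration.integrable_diff integrable_mult_right p m)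
  have "expectation (\<lambda>\<omega>. Z \<omega> * (W C \<omega> * W D \<omega>)) =
      1/4 * (expectation Z * expectation (\<lambda>\<omega>. (1 * W C \<omega> + 1 * W D \<omega>)\<^sup>2)) - 1/4 * (expectation Z
          * expectation (\<lambda>\<omega>. (1 * W C \<omega> + (-1) * W D \<omega>)\<^sup>2))"
    unfolding eq by (simp only: Bochner_Integration.integral_diff integrable_mult_right p m
        integral_mult_right_zero)
  also have "\<dots> = expectation Z * (1/4 * (expectation (\<lambda>\<omega>. (1 * W C \<omega> + 1 * W D \<omega>)\<^sup>2) - expectation (\<lambda>\<omega>. (1
      * W C \<omega> + (-1) * W D \<omega>)\<^sup>2)))"
    by (simp add: algebra_simps)
  also have "expectation (\<lambda>\<omega>. (1 * W C \<omega> + 1 * W D \<omega>)\<^sup>2) - expectation (\<lambda>\<omega>. (1 * W C \<omega> + (-1) * W D \<omega>)\<^sup>2)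
      = expectation (\<lambda>\<omega>. (1 * W C \<omega> + 1 * W D \<omega>)\<^sup>2 - (1 * W C \<omega> + (-1) * W D \<omega>)\<^sup>2)"
    by (intro Bochner_Integration.integral_diff[symmetric] centered_gaussian_cos_sin(1) noise_span_gaussian)
       (use noise_span_linear noise_span_base CD in blast)+
  also have "\<dots> = expectation (\<lambda>\<omega>. 4 * (W C \<omega> * W D \<omega>))"
    by (simp add: power2_eq_square algebra_simps)
  also have "\<dots> = 4 * measure lborel (C \<inter> D)" using noise_covariance[OF CD] by simp
  finally show "expectation (\<lambda>\<omega>. Z \<omega> * (W C \<omega> * W D \<omega>)) = expectation Z * measure lborel (C \<inter> D)" by simp
qed

text \<open>Additivity is not among the axioms of \<open>white_noise\<close>; it follows from the
  covariances, which make the second moment of the defect zero.\<close>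

lemma noise_additive:
  assumes A: "A \<in> noise_sets L" and B: "B \<in> noise_sets L" and AB: "A \<union> B \<in> noise_sets L" "A \<inter> B = {}"
  shows "AE \<omega> in M. W (A \<union> B) \<omega> = W A \<omega> + W B \<omega>"
proof -
  define D where "D \<omega> = W (A \<union> B) \<omega> - (W A \<omega> + W B \<omega>)" for \<omega>
  have mAB: "measure lborel (A \<union> B) = measure lborel A + measure lborel B"
    using A B AB(2) by (intro measure_Union) (auto simp: noise_sets_def)
  note i = noise_mult_integrable[OF AB(1) AB(1)] noise_mult_integrable[OF AB(1) A] noise_mult_integrable[OF
      AB(1) B]
    noise_mult_integrable[OF A A] noise_mult_integrable[OF B B] noise_mult_integrable[OF A B]
  note c = noise_covariance[OF AB(1) AB(1)] noise_covariance[OF AB(1) A] noise_covariance[OF AB(1) B]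
    noise_covariance[OF A A] noise_covariance[OF B B] noise_covariance[OF A B]
  have eq: "(D \<omega>)\<^sup>2 = W (A \<union> B) \<omega> * W (A \<union> B) \<omega> - 2 * (W (A \<union> B) \<omega> * W A \<omega>) - 2 * (W (A \<union> B) \<omega> * W B \<omega>)
      + W A \<omega> * W A \<omega> + W B \<omega> * W B \<omega> + 2 * (W A \<omega> * W B \<omega>)" for \<omega>
    by (simp add: D_def power2_eq_square algebra_simps)
  have iD: "integrable M (\<lambda>\<omega>. (D \<omega>)\<^sup>2)" unfolding eq using i by simp
  have "(A \<union> B) \<inter> A = A" "(A \<union> B) \<inter> B = B" by auto
  then have "expectation (\<lambda>\<omega>. (D \<omega>)\<^sup>2) = 0" unfolding eq using i c mAB AB(2) by simp
  then have "AE \<omega> in M. (D \<omega>)\<^sup>2 = 0"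
    using integral_nonneg_eq_0_iff_AE[OF iD] by simp
  then show ?thesis by (simp add: D_def)
qed

lemma elementary_processD:
  assumes "elementary_process M L W (a, b, A, X)"
  shows "0 \<le> a" "a \<le> b" "A \<in> sets borel" "A \<subseteq> {0<..<L}" "X \<in> borel_measurable (\<F> a)"
    "X \<in> borel_measurable M" "{a<..b} \<times> A \<in> future_sets a" "{a<..b} \<times> A \<in> noise_sets L"
    "\<exists>B. \<forall>\<omega>\<in>space M. \<bar>X \<omega>\<bar> \<le> B"
proof -
  show *: "0 \<le> a" "a \<le> b" "A \<in> sets borel" "A \<subseteq> {0<..<L}" "X \<in> borel_measurable (\<F> a)"
    using assms by auto
  show "X \<in> borel_measurable M" by (rule measurable_noise_filtration[OF *(5)])
  show "{a<..b} \<times> A \<in> noise_sets L" by (rule noise_rectangle[OF *(1,3,4)])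
  then show "{a<..b} \<times> A \<in> future_sets a" by (auto simp: future_sets_def)
  show "\<exists>B. \<forall>\<omega>\<in>space M. \<bar>X \<omega>\<bar> \<le> B" using assms by (auto simp: bounded_iff)
qed

text \<open>The earlier rectangle is cut at the starting time of the later one: its first part is
  measurable at that time, and only the second part is correlated with the later increment.\<close>

lemma elementary_product_ordered:
  assumes e: "elementary_process M L W (a, b, A, X)" and e': "elementary_process M L W (a', b', A', X')"
    and le: "a \<le> a'"
  shows "integrable M (\<lambda>\<omega>. (X \<omega> * W ({a<..b} \<times> A) \<omega>) * (X' \<omega> * W ({a'<..b'} \<times> A') \<omega>))"
    and "expectation (\<lambda>\<omega>. (X \<omega> * W ({a<..b} \<times> A) \<omega>) * (X' \<omega> * W ({a'<..b'} \<times> A') \<omega>)) =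
      expectation (\<lambda>\<omega>. X \<omega> * X' \<omega>) * measure lborel (({a<..b} \<times> A) \<inter> ({a'<..b'} \<times> A'))"
proof -
  note E = elementary_processD[OF e] and E' = elementary_processD[OF e']
  \<comment> \<open>The minimum covers a first rectangle that ends before \<open>a'\<close>; then
    \<open>?R2\<close> is empty.\<close>
  let ?R = "{a<..b} \<times> A" and ?R1 = "{a<..min b a'} \<times> A" and ?R2 = "{a'<..b} \<times> A" and ?R' = "{a'<..b'} \<times> A'"
  have R1: "?R1 \<in> noise_sets L" and R2: "?R2 \<in> noise_sets L"
    using noise_rectangle E E' by auto
  have R1p: "?R1 \<in> past_sets a'" using R1 E(1) by (auto simp: past_sets_def)
  have R2f: "?R2 \<in> future_sets a'" using R2 by (auto simp: future_sets_def)
  have split: "?R = ?R1 \<union> ?R2" "?R1 \<inter> ?R2 = {}" using le by auto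
  have add: "AE \<omega> in M. W ?R \<omega> = W ?R1 \<omega> + W ?R2 \<omega>"
    unfolding split(1) by (rule noise_additive[OF R1 R2]) (use split E(8) in auto)
  obtain B where B: "\<And>\<omega>. \<omega> \<in> space M \<Longrightarrow> \<bar>X \<omega>\<bar> \<le> B" using E(9) by auto
  obtain B' where B': "\<And>\<omega>. \<omega> \<in> space M \<Longrightarrow> \<bar>X' \<omega>\<bar> \<le> B'" using E'(9) by auto
  have XX: "\<bar>X \<omega> * X' \<omega>\<bar> \<le> \<bar>B\<bar> * \<bar>B'\<bar>" if "\<omega> \<in> space M" for \<omega>
    unfolding abs_mult using B[OF that] B'[OF that] by (intro mult_mono) auto
  have mX: "X \<in> borel_measurable (\<F> a')" by (rule measurable_noise_filtration_mono[OF E(5) le])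
  note [measurable] = E(6) E'(6) noise_measurable[OF R1] noise_measurable[OF R2] noise_measurable[OF E(8)]
      noise_measurable[OF E'(8)]
  have iXX: "integrable M (\<lambda>\<omega>. X \<omega> * X' \<omega>)"
    by (rule integrable_const_bound[of _ "\<bar>B\<bar> * \<bar>B'\<bar>"]) (use XX in auto)
  have mXX: "(\<lambda>\<omega>. X \<omega> * X' \<omega>) \<in> borel_measurable (\<F> a')" using mX E'(5) by simp
  \<comment> \<open>The first part of the increment is measurable at time \<open>a'\<close> but
    unbounded, so integrability of \<open>Z\<close> rests on the second moment of the noise.\<close>
  define Z where "Z \<omega> = X \<omega> * X' \<omega> * W ?R1 \<omega>" for \<omega>
  have mZ: "Z \<in> borel_measurable (\<F> a')" unfolding Z_def[abs_def] using mXX noise_past_measurable[OF R1p]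
      by simp
  have iZ: "integrable M Z"
  proof (rule Bochner_Integration.integrable_bound)
    show "integrable M (\<lambda>\<omega>. \<bar>B\<bar> * \<bar>B'\<bar> * \<bar>W ?R1 \<omega>\<bar>)"
      using square_integrable_imp_integrable[OF noise_measurable[OF R1] noise_square_integrable[OF R1]] by simp
    show "AE \<omega> in M. norm (Z \<omega>) \<le> norm (\<bar>B\<bar> * \<bar>B'\<bar> * \<bar>W ?R1 \<omega>\<bar>)"
      unfolding Z_def using XX by (intro AE_I2) (simp add: abs_mult[of _ "W _ _"] mult_right_mono)
  qed (rule measurable_noise_filtration[OF mZ])
  note s1 = noise_future_span(1,2)[OF noise_span_base[OF E'(7)] mZ iZ]
  note s2 = noise_future_product[OF R2f E'(7) mXX iXX]
  have eq: "AE \<omega> in M. (X \<omega> * W ?R \<omega>) * (X' \<omega> * W ?R' \<omega>) = Z \<omega> * W ?R' \<omega> + X \<omega> * X' \<omega> * (W ?R2 \<omega> * W ?R' \<omega>)"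
    using add by eventually_elim (simp add: Z_def algebra_simps)
  have i: "integrable M (\<lambda>\<omega>. Z \<omega> * W ?R' \<omega> + X \<omega> * X' \<omega> * (W ?R2 \<omega> * W ?R' \<omega>))" using s1 s2 by simp
  have [measurable]: "Z \<in> borel_measurable M" using iZ by simp
  show "integrable M (\<lambda>\<omega>. (X \<omega> * W ?R \<omega>) * (X' \<omega> * W ?R' \<omega>))"
    by (rule integrable_cong_AE[THEN iffD1, OF _ _ _ i]) (use eq in auto)
  have "expectation (\<lambda>\<omega>. (X \<omega> * W ?R \<omega>) * (X' \<omega> * W ?R' \<omega>))
      = expectation (\<lambda>\<omega>. Z \<omega> * W ?R' \<omega> + X \<omega> * X' \<omega> * (W ?R2 \<omega> * W ?R' \<omega>))"
    by (rule integral_cong_AE) (use eq in auto)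
  also have "\<dots> = expectation (\<lambda>\<omega>. X \<omega> * X' \<omega>) * measure lborel (?R2 \<inter> ?R')" using s1 s2 by simp
  also have "?R2 \<inter> ?R' = ?R \<inter> ?R'" using le by auto
  finally show "expectation (\<lambda>\<omega>. (X \<omega> * W ?R \<omega>) * (X' \<omega> * W ?R' \<omega>))
      = expectation (\<lambda>\<omega>. X \<omega> * X' \<omega>) * measure lborel (?R \<inter> ?R')" .
qed

lemma elementary_value_integral:
  assumes e: "elementary_process M L W (a, b, A, X)" and e': "elementary_process M L W (a', b', A', X')"
  shows "integrable (lborel \<Otimes>\<^sub>M M) (\<lambda>z. elementary_value (a, b, A, X) z * elementary_value (a', b', A', X') z)"
    and "(LINT z|(lborel \<Otimes>\<^sub>M M). elementary_value (a, b, A, X) z * elementary_value (a', b', A', X') z) =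
      expectation (\<lambda>\<omega>. X \<omega> * X' \<omega>) * measure lborel (({a<..b} \<times> A) \<inter> ({a'<..b'} \<times> A'))"
proof -
  note E = elementary_processD[OF e] and E' = elementary_processD[OF e']
  let ?Q = "({a<..b} \<times> A) \<inter> ({a'<..b'} \<times> A')"
  interpret P: pair_sigma_finite "lborel :: (real \<times> real) measure" M
    by (intro pair_sigma_finite.intro sigma_finite_measure_axioms) (rule sigma_finite_lborel)
  note [measurable] = E(6) E'(6)
  have Q [measurable]: "?Q \<in> sets borel" using E(8) E'(8) by (auto simp: noise_sets_def)
  have Qf: "emeasure lborel ?Q < \<infinity>"
    using E(8) emeasure_mono[of ?Q "{a<..b} \<times> A" lborel] by (auto simp: noise_sets_def intro: le_less_trans)
  have eq: "elementary_value (a, b, A, X) z * elementary_value (a', b', A', X') z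
      = indicator ?Q (fst z) * (X (snd z) * X' (snd z))" for z
    by (cases z) (auto simp: indicator_def split: prod.splits)
  obtain B where B: "\<And>\<omega>. \<omega> \<in> space M \<Longrightarrow> \<bar>X \<omega>\<bar> \<le> B" using E(9) by auto
  obtain B' where B': "\<And>\<omega>. \<omega> \<in> space M \<Longrightarrow> \<bar>X' \<omega>\<bar> \<le> B'" using E'(9) by auto
  have XX: "\<bar>X \<omega> * X' \<omega>\<bar> \<le> \<bar>B\<bar> * \<bar>B'\<bar>" if "\<omega> \<in> space M" for \<omega>
    unfolding abs_mult using B[OF that] B'[OF that] by (intro mult_mono) auto
  have iXX: "integrable M (\<lambda>\<omega>. X \<omega> * X' \<omega>)"
    by (rule integrable_const_bound[of _ "\<bar>B\<bar> * \<bar>B'\<bar>"]) (use XX in auto)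
  have i: "integrable (lborel \<Otimes>\<^sub>M M) (\<lambda>z. indicator ?Q (fst z) * (X (snd z) * X' (snd z)) :: real)"
  proof (rule P.Fubini_integrable)
    show "integrable lborel (\<lambda>x. LINT y|M. norm (indicator ?Q (fst (x, y)) * (X (snd (x, y))
        * X' (snd (x, y))) :: real))"
      using Qf by (simp add: abs_mult integrable_indicator_iff)
  qed (use iXX in auto)
  then show "integrable (lborel \<Otimes>\<^sub>M M) (\<lambda>z. elementary_value (a, b, A, X) z
      * elementary_value (a', b', A', X') z)"
    unfolding eq .
  have "(LINT z|(lborel \<Otimes>\<^sub>M M). indicator ?Q (fst z) * (X (snd z) * X' (snd z)))
      = (LINT x|lborel. LINT \<omega>|M. indicator ?Q x * (X \<omega> * X' \<omega>))"
    using P.integral_fst'[OF i] by simp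
  also have "\<dots> = expectation (\<lambda>\<omega>. X \<omega> * X' \<omega>) * measure lborel ?Q" using Q by simp
  finally show "(LINT z|(lborel \<Otimes>\<^sub>M M). elementary_value (a, b, A, X) z * elementary_value (a', b', A', X') z) =
      expectation (\<lambda>\<omega>. X \<omega> * X' \<omega>) * measure lborel ?Q"
    unfolding eq .
qed

lemma elementary_isometry:
  assumes e: "elementary_process M L W e" and e': "elementary_process M L W e'"
  shows "integrable M (\<lambda>\<omega>. elementary_integral W e \<omega> * elementary_integral W e' \<omega>)"
    and "expectation (\<lambda>\<omega>. elementary_integral W e \<omega> * elementary_integral W e' \<omega>) =
      (LINT z|(lborel \<Otimes>\<^sub>M M). elementary_value e z * elementary_value e' z)"
    and "integrable (lborel \<Otimes>\<^sub>M M) (\<lambda>z. elementary_value e z * elementary_value e' z)"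
proof -
  obtain a b A X where [simp]: "e = (a, b, A, X)" by (cases e)
  obtain a' b' A' X' where [simp]: "e' = (a', b', A', X')" by (cases e')
  have "integrable M (\<lambda>\<omega>. elementary_integral W e \<omega> * elementary_integral W e' \<omega>) \<and>
    expectation (\<lambda>\<omega>. elementary_integral W e \<omega> * elementary_integral W e' \<omega>) =
      (LINT z|(lborel \<Otimes>\<^sub>M M). elementary_value e z * elementary_value e' z)"
  proof (cases "a \<le> a'")
    case True
    have "elementary_process M L W (a, b, A, X)" "elementary_process M L W (a', b', A', X')" using e e'
        by simp_all
    from elementary_product_ordered[OF this True] elementary_value_integral(2)[OF this] show ?thesis by simp
  next
    case False
    then have le: "a' \<le> a" by simp
    have "elementary_process M L W (a', b', A', X')" "elementary_process M L W (a, b, A, X)" using e e'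
        by simp_all
    from elementary_product_ordered[OF this le] elementary_value_integral(2)[OF this(2,1)] show ?thesis
      by (simp add: mult.commute Int_commute)
  qed
  then show "integrable M (\<lambda>\<omega>. elementary_integral W e \<omega> * elementary_integral W e' \<omega>)"
    "expectation (\<lambda>\<omega>. elementary_integral W e \<omega> * elementary_integral W e' \<omega>) =
      (LINT z|(lborel \<Otimes>\<^sub>M M). elementary_value e z * elementary_value e' z)" by blast+
  show "integrable (lborel \<Otimes>\<^sub>M M) (\<lambda>z. elementary_value e z * elementary_value e' z)"
    using elementary_value_integral(1)[of a b A X a' b' A' X'] e e' by simp
qed

end

section \<open>Passing an isometry to limits in mean square\<close>

lemma square_le_weighted:
  fixes x y :: real
  assumes "\<epsilon> > 0"
  shows "x\<^sup>2 \<le> (1 + \<epsilon>) * y\<^sup>2 + (1 + 1 / \<epsilon>) * (y - x)\<^sup>2"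
proof -
  have "(1 + \<epsilon>) * y\<^sup>2 + (1 + 1 / \<epsilon>) * (y - x)\<^sup>2 - x\<^sup>2 = (\<epsilon> * y + (y - x))\<^sup>2 / \<epsilon>"
    using assms by (simp add: power2_eq_square field_simps)
  moreover have "(\<epsilon> * y + (y - x))\<^sup>2 / \<epsilon> \<ge> 0" using assms by simp
  ultimately show ?thesis by linarith
qed

lemma nn_integral_square_le_weighted:
  fixes f g :: "'a \<Rightarrow> real"
  assumes \<epsilon>: "\<epsilon> > 0" and [measurable]: "f \<in> borel_measurable N" "g \<in> borel_measurable N"
  shows "(\<integral>\<^sup>+x. ennreal ((f x)\<^sup>2) \<partial>N) \<le> ennreal (1 + \<epsilon>) * (\<integral>\<^sup>+x. ennreal ((g x)\<^sup>2) \<partial>N)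
    + ennreal (1 + 1 / \<epsilon>) * (\<integral>\<^sup>+x. ennreal ((g x - f x)\<^sup>2) \<partial>N)"
proof -
  have "(\<integral>\<^sup>+x. ennreal ((f x)\<^sup>2) \<partial>N) \<le> (\<integral>\<^sup>+x. ennreal (1 + \<epsilon>) * ennreal ((g x)\<^sup>2) + ennreal (1 + 1 / \<epsilon>)
      * ennreal ((g x - f x)\<^sup>2) \<partial>N)"
    using \<epsilon> square_le_weighted[OF \<epsilon>]
    by (intro nn_integral_mono) (simp add: ennreal_mult[symmetric] ennreal_plus[symmetric] del: ennreal_plus)
  also have "\<dots> = ennreal (1 + \<epsilon>) * (\<integral>\<^sup>+x. ennreal ((g x)\<^sup>2) \<partial>N) + ennreal (1 + 1 / \<epsilon>) * (\<integral>\<^sup>+x. ennreal ((g x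
      - f x)\<^sup>2) \<partial>N)"
    by (simp add: nn_integral_add nn_integral_cmult)
  finally show ?thesis .
qed

text \<open>The weighted inequality replaces the triangle inequality for norms, so the argument runs
  in \<open>ennreal\<close> before integrability is known; \<open>\<epsilon>\<close> tends to 0
  last. Exchanging the two sides gives the reverse inequality, hence an isometry in the
  limit.\<close>

lemma nn_integral_square_limit_le:
  fixes f :: "'a \<Rightarrow> real" and g :: "'b \<Rightarrow> real"
  assumes [measurable]: "\<And>n. fn n \<in> borel_measurable N1" "f \<in> borel_measurable N1"
      "\<And>n. gn n \<in> borel_measurable N2" "g \<in> borel_measurable N2"
    and eq: "\<And>n. (\<integral>\<^sup>+x. ennreal ((fn n x)\<^sup>2) \<partial>N1) = (\<integral>\<^sup>+x. ennreal ((gn n x)\<^sup>2) \<partial>N2)"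
    and f: "(\<lambda>n::nat. \<integral>\<^sup>+x. ennreal ((fn n x - f x)\<^sup>2) \<partial>N1) \<longlonglongrightarrow> 0"
    and g: "(\<lambda>n. \<integral>\<^sup>+x. ennreal ((gn n x - g x)\<^sup>2) \<partial>N2) \<longlonglongrightarrow> 0"
  shows "(\<integral>\<^sup>+x. ennreal ((f x)\<^sup>2) \<partial>N1) \<le> (\<integral>\<^sup>+x. ennreal ((g x)\<^sup>2) \<partial>N2)"
proof -
  let ?F = "\<integral>\<^sup>+x. ennreal ((f x)\<^sup>2) \<partial>N1" and ?G = "\<integral>\<^sup>+x. ennreal ((g x)\<^sup>2) \<partial>N2"
  have le: "?F \<le> ennreal ((1 + \<epsilon>)\<^sup>2) * ?G" if \<epsilon>: "\<epsilon> > 0" for \<epsilon>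
  proof -
    let ?a = "ennreal (1 + \<epsilon>)" and ?c = "ennreal (1 + 1 / \<epsilon>)"
    have "(\<lambda>n. ?a * (?a * ?G + ?c * (\<integral>\<^sup>+x. ennreal ((g x - gn n x)\<^sup>2) \<partial>N2)) + ?c * (\<integral>\<^sup>+x. ennreal ((fn n x
        - f x)\<^sup>2) \<partial>N1))
        \<longlonglongrightarrow> ?a * (?a * ?G + ?c * 0) + ?c * 0"
      using g by (intro tendsto_add ennreal_tendsto_cmult tendsto_const f) (simp_all add: power2_commute)
    then have "?F \<le> ?a * (?a * ?G + ?c * 0) + ?c * 0"
    proof (rule LIMSEQ_le_const, intro exI allI impI)
      fix n
      have "?F \<le> ?a * (\<integral>\<^sup>+x. ennreal ((fn n x)\<^sup>2) \<partial>N1) + ?c * (\<integral>\<^sup>+x. ennreal ((fn n x - f x)\<^sup>2) \<partial>N1)"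
        by (rule nn_integral_square_le_weighted[OF \<epsilon>]) auto
      also have "\<dots> \<le> ?a * (?a * ?G + ?c * (\<integral>\<^sup>+x. ennreal ((g x - gn n x)\<^sup>2) \<partial>N2)) + ?c
          * (\<integral>\<^sup>+x. ennreal ((fn n x - f x)\<^sup>2) \<partial>N1)"
        unfolding eq by (intro add_right_mono mult_left_mono nn_integral_square_le_weighted[OF \<epsilon>]) auto
      finally show "?F \<le> ?a * (?a * ?G + ?c * (\<integral>\<^sup>+x. ennreal ((g x - gn n x)\<^sup>2) \<partial>N2)) + ?c
          * (\<integral>\<^sup>+x. ennreal ((fn n x - f x)\<^sup>2) \<partial>N1)" .
    qed
    then show ?thesis using \<epsilon> by (simp add: power2_eq_square ennreal_mult mult.assoc)
  qed
  show ?thesis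
  proof (cases "?G = \<infinity>")
    case False
    then obtain G where G: "?G = ennreal G" "G \<ge> 0" by (cases ?G) auto
    have "(\<lambda>n. ennreal ((1 + 1 / real (Suc n))\<^sup>2 * G)) \<longlonglongrightarrow> ennreal ((1 + 0)\<^sup>2 * G)"
      by (intro tendsto_ennrealI tendsto_intros lim_1_over_n[THEN LIMSEQ_Suc])
    then have "?F \<le> ennreal ((1 + 0)\<^sup>2 * G)"
      by (rule LIMSEQ_le_const) (use le G in \<open>auto simp: ennreal_mult[symmetric]\<close>)
    then show ?thesis using G by simp
  qed simp
qed

section \<open>The isometry for predictable integrands\<close>

context noise
begin

text \<open>The generators of the predictable sigma-algebra are measurable rectangles, but that
  sigma-algebra lives only on positive times and positions in \<open>S\<close>; hence the cut-off by
  an indicator.\<close>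

lemma predictable_measurable:
  fixes \<Phi> :: "(real \<times> real) \<times> 'w \<Rightarrow> real"
  assumes \<Phi>: "\<Phi> \<in> borel_measurable (predictable_sigma M \<F> S)" and S: "S \<in> sets borel"
  shows "(\<lambda>z. indicator (({0<..} \<times> S) \<times> space M) z * \<Phi> z) \<in> borel_measurable (lborel \<Otimes>\<^sub>M M)"
proof -
  let ?\<Omega> = "({0<..} \<times> S) \<times> space M" and ?P = "(lborel \<Otimes>\<^sub>M M) :: ((real \<times> real) \<times> 'w) measure"
  let ?E = "{({a<..b} \<times> A) \<times> G | a b A G. 0 \<le> a \<and> a \<le> b \<and> A \<in> sets borel \<and> A \<subseteq> S \<and> G \<in> sets (\<F> a)}"
  have rect: "I \<times> A \<in> sets (borel :: (real \<times> real) measure)" if "I \<in> sets borel" "A \<in> sets borel"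
      for I A :: "real set"
  proof -
    have "I \<times> A \<in> sets (borel \<Otimes>\<^sub>M borel)" using that by (intro pair_measureI)
    then show ?thesis unfolding borel_prod .
  qed
  have \<Omega>: "?\<Omega> \<in> sets ?P" using rect[of "{0<..}" S] S by (intro pair_measureI) auto
  have E: "?E \<subseteq> sets (restrict_space ?P ?\<Omega>)"
  proof safe
    fix a b :: real and A :: "real set" and G
    assume *: "0 \<le> a" "a \<le> b" "A \<in> sets borel" "A \<subseteq> S" "G \<in> sets (\<F> a)"
    have "G \<in> events" using * sets_noise_filtration_le by auto
    then have "({a<..b} \<times> A) \<times> G \<in> sets ?P" using rect[of "{a<..b}" A] * by (intro pair_measureI) auto
    moreover have "({a<..b} \<times> A) \<times> G \<subseteq> ?\<Omega>" using * sets.sets_into_space[OF \<open>G \<in> events\<close>] by auto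
    ultimately show "({a<..b} \<times> A) \<times> G \<in> sets (restrict_space ?P ?\<Omega>)"
      using \<Omega> by (subst sets_restrict_space_iff) auto
  qed
  have sp: "space (restrict_space ?P ?\<Omega>) = ?\<Omega>" by (auto simp: space_restrict_space space_pair_measure)
  have EP: "?E \<subseteq> Pow ?\<Omega>" using E sets.sets_into_space[of _ "restrict_space ?P ?\<Omega>"] unfolding sp by blast
  have sets: "sets (predictable_sigma M \<F> S) \<subseteq> sets (restrict_space ?P ?\<Omega>)"
    unfolding predictable_sigma_def sets_measure_of[OF EP]
    using sets.sigma_sets_subset[OF E] unfolding sp .
  have space: "space (predictable_sigma M \<F> S) = ?\<Omega>"
    unfolding predictable_sigma_def by (rule space_measure_of[OF EP])
  have "\<Phi> \<in> borel_measurable (restrict_space ?P ?\<Omega>)"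
    using \<Phi> sets unfolding measurable_def space sp by auto
  then show ?thesis using \<Omega> by (subst (asm) borel_measurable_restrict_space_iff) auto
qed

lemma elementary_value_measurable:
  assumes "elementary_process M L W e"
  shows "elementary_value e \<in> borel_measurable (lborel \<Otimes>\<^sub>M M)"
proof -
  obtain a b A X where e: "e = (a, b, A, X)" by (cases e)
  note E = elementary_processD[OF assms[unfolded e]]
  have [measurable]: "{a<..b} \<times> A \<in> sets borel" using E(8) by (auto simp: noise_sets_def)
  note [measurable] = E(6)
  have "elementary_value e = (\<lambda>z. X (snd z) * indicator ({a<..b} \<times> A) (fst z))"
    by (auto simp: e fun_eq_iff indicator_def)
  then show ?thesis by simp
qed

lemma elementary_integral_mean:
  assumes "elementary_process M L W e"
  shows "integrable M (elementary_integral W e)" "expectation (elementary_integral W e) = 0"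
proof -
  obtain a b A X where e: "e = (a, b, A, X)" by (cases e)
  note E = elementary_processD[OF assms[unfolded e]]
  have eq: "elementary_integral W e = (\<lambda>\<omega>. X \<omega> * W ({a<..b} \<times> A) \<omega>)" by (simp add: e fun_eq_iff)
  obtain B where B: "\<And>\<omega>. \<omega> \<in> space M \<Longrightarrow> \<bar>X \<omega>\<bar> \<le> B" using E(9) by auto
  have "integrable M X" by (rule integrable_const_bound[of _ B]) (use B E(6) in auto)
  note s = noise_future_span(1,2)[OF noise_span_base[OF E(7)] E(5) this]
  show "integrable M (elementary_integral W e)" "expectation (elementary_integral W e) = 0"
    unfolding eq using s by auto
qed

lemma simple_value_eq: "simple_value es z = (\<Sum>i<length es. elementary_value (es ! i) z)"
  by (simp add: simple_value_def sum_list_sum_nth atLeast0LessThan)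

lemma simple_integral_eq: "simple_integral W es \<omega> = (\<Sum>i<length es. elementary_integral W (es ! i) \<omega>)"
  by (simp add: simple_integral_def sum_list_sum_nth atLeast0LessThan)

lemma simple_integral_isometry:
  assumes es: "\<forall>e\<in>set es. elementary_process M L W e"
  shows "simple_value es \<in> borel_measurable (lborel \<Otimes>\<^sub>M M)"
    and "integrable M (simple_integral W es)" and "expectation (simple_integral W es) = 0"
    and "(\<integral>\<^sup>+\<omega>. ennreal ((simple_integral W es \<omega>)\<^sup>2) \<partial>M)
        = (\<integral>\<^sup>+z. ennreal ((simple_value es z)\<^sup>2) \<partial>(lborel \<Otimes>\<^sub>M M))"
proof -
  have e: "elementary_process M L W (es ! i)" if "i < length es" for i using es that by simp
  show "simple_value es \<in> borel_measurable (lborel \<Otimes>\<^sub>M M)"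
    unfolding simple_value_eq[abs_def] using elementary_value_measurable[OF e]
        by (intro borel_measurable_sum) auto
  show "integrable M (simple_integral W es)"
    unfolding simple_integral_eq[abs_def] using elementary_integral_mean[OF e]
        by (intro Bochner_Integration.integrable_sum) auto
  show "expectation (simple_integral W es) = 0"
    unfolding simple_integral_eq[abs_def] using elementary_integral_mean[OF e]
        by (subst Bochner_Integration.integral_sum) auto
  have sq: "(simple_integral W es \<omega>)\<^sup>2 = (\<Sum>i<length es. \<Sum>j<length es. elementary_integral W (es ! i) \<omega>
      * elementary_integral W (es ! j) \<omega>)"
    "(simple_value es z)\<^sup>2 = (\<Sum>i<length es. \<Sum>j<length es. elementary_value (es ! i) z
        * elementary_value (es ! j) z)" for \<omega> z
    unfolding simple_integral_eq simple_value_eq power2_eq_square sum_product by simp_all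
  note iso = elementary_isometry[OF e e]
  have i1: "integrable M (\<lambda>\<omega>. (simple_integral W es \<omega>)\<^sup>2)" unfolding sq
    by (intro Bochner_Integration.integrable_sum iso) auto
  have i2: "integrable (lborel \<Otimes>\<^sub>M M) (\<lambda>z. (simple_value es z)\<^sup>2)" unfolding sq
    by (intro Bochner_Integration.integrable_sum iso) auto
  have "expectation (\<lambda>\<omega>. (simple_integral W es \<omega>)\<^sup>2) =
      (\<Sum>i<length es. \<Sum>j<length es. expectation (\<lambda>\<omega>. elementary_integral W (es ! i) \<omega>
          * elementary_integral W (es ! j) \<omega>))"
    unfolding sq by (subst Bochner_Integration.integral_sum; (intro Bochner_Integration.integrable_sum iso
        sum.cong refl Bochner_Integration.integral_sum)?) auto
  also have "\<dots> = (\<Sum>i<length es. \<Sum>j<length es. (LINT z|(lborel \<Otimes>\<^sub>M M). elementary_value (es ! i) z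
      * elementary_value (es ! j) z))"
    by (intro sum.cong refl iso) auto
  also have "\<dots> = (LINT z|(lborel \<Otimes>\<^sub>M M). (simple_value es z)\<^sup>2)"
    unfolding sq by (subst Bochner_Integration.integral_sum; (intro Bochner_Integration.integrable_sum iso
        sum.cong refl Bochner_Integration.integral_sum[symmetric])?) auto
  finally show "(\<integral>\<^sup>+\<omega>. ennreal ((simple_integral W es \<omega>)\<^sup>2) \<partial>M)
      = (\<integral>\<^sup>+z. ennreal ((simple_value es z)\<^sup>2) \<partial>(lborel \<Otimes>\<^sub>M M))"
    using nn_integral_eq_integral[OF i1] nn_integral_eq_integral[OF i2] by simp
qed

text \<open>\<open>integrand_norm2\<close> integrates over the strip only, the isometry for simple
  processes over the whole plane; this reconciles the two.\<close>

lemma simple_value_support: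
  assumes es: "\<forall>e\<in>set es. elementary_process M L W e" and z: "z \<in> space (lborel \<Otimes>\<^sub>M M)"
  shows "simple_value es z = indicator (({0<..} \<times> {0<..<L}) \<times> space M) z * simple_value es z"
proof (cases "z \<in> ({0<..} \<times> {0<..<L}) \<times> space M")
  case False
  obtain s y \<omega> where zz: "z = ((s, y), \<omega>)" by (cases z) auto
  have "\<omega> \<in> space M" using z by (simp add: zz space_pair_measure)
  then have out: "\<not> (s > 0 \<and> y \<in> {0<..<L})" using False by (auto simp: zz)
  have "elementary_value e z = 0" if "e \<in> set es" for e
  proof -
    obtain a b A X where e: "e = (a, b, A, X)" by (cases e)
    have "elementary_process M L W (a, b, A, X)" using es that e by blast
    from elementary_processD(1,4)[OF this] show ?thesis using out by (auto simp: e zz indicator_def)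
  qed
  then have "map (\<lambda>e. elementary_value e z) es = map (\<lambda>e. 0) es" by simp
  then have "simple_value es z = 0" unfolding simple_value_def by (simp del: map_eq_conv)
  then show ?thesis by simp
qed simp

text \<open>The limit inequality in both directions gives equality. The mean is zero because each
  approximating integral has mean zero and the square of a mean is at most the second moment of the
  difference.\<close>

lemma walsh_isometry:
  assumes "has_walsh_integral M L W \<Phi> I"
  shows "(\<integral>\<^sup>+\<omega>. ennreal ((I \<omega>)\<^sup>2) \<partial>M) = integrand_norm2 M L \<Phi>"
    and "integrable M (\<lambda>\<omega>. (I \<omega>)\<^sup>2)" and "integrable M I" and "expectation I = 0"
proof -
  obtain S where \<Phi>: "\<Phi> \<in> borel_measurable (predictable_sigma M \<F> {0<..<L})"
    and fin: "integrand_norm2 M L \<Phi> < \<infinity>" and I [measurable]: "I \<in> borel_measurable M"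
    and S: "\<And>n::nat. \<forall>e\<in>set (S n). elementary_process M L W e"
    and lim1: "(\<lambda>n. integrand_norm2 M L (\<lambda>z. simple_value (S n) z - \<Phi> z)) \<longlonglongrightarrow> 0"
    and lim2: "(\<lambda>n. \<integral>\<^sup>+\<omega>. ennreal ((simple_integral W (S n) \<omega> - I \<omega>)\<^sup>2) \<partial>M) \<longlonglongrightarrow> 0"
    using assms unfolding has_walsh_integral_def by blast
  let ?R = "({0<..} \<times> {0<..<L}) \<times> space M" and ?P = "(lborel \<Otimes>\<^sub>M M) :: ((real \<times> real) \<times> 'w) measure"
  define \<Psi> where "\<Psi> z = indicator ?R z * \<Phi> z" for z
  have [measurable]: "\<Psi> \<in> borel_measurable ?P"
    unfolding \<Psi>_def[abs_def] by (rule predictable_measurable[OF \<Phi>]) simp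
  note iso = simple_integral_isometry[OF S]
  have n\<Phi>: "integrand_norm2 M L \<Phi> = (\<integral>\<^sup>+z. ennreal ((\<Psi> z)\<^sup>2) \<partial>?P)"
    unfolding integrand_norm2_def by (intro nn_integral_cong) (simp add: \<Psi>_def indicator_def)
  have lim1': "(\<lambda>n. \<integral>\<^sup>+z. ennreal ((simple_value (S n) z - \<Psi> z)\<^sup>2) \<partial>?P) \<longlonglongrightarrow> 0"
  proof -
    have "integrand_norm2 M L (\<lambda>z. simple_value (S n) z - \<Phi> z)
        = (\<integral>\<^sup>+z. ennreal ((simple_value (S n) z - \<Psi> z)\<^sup>2) \<partial>?P)" for n
      unfolding integrand_norm2_def
    proof (rule nn_integral_cong)
      fix z assume "z \<in> space ?P"
      from simple_value_support[OF S this, of n]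
      show "ennreal ((simple_value (S n) z - \<Phi> z)\<^sup>2) * indicator ?R z
          = ennreal ((simple_value (S n) z - \<Psi> z)\<^sup>2)"
        by (cases "z \<in> ?R") (simp_all add: \<Psi>_def)
    qed
    then show ?thesis using lim1 by simp
  qed
  have [measurable]: "simple_integral W (S n) \<in> borel_measurable M" "simple_value (S n) \<in> borel_measurable
      ?P" for n
    using iso(1,2)[of n] by auto
  show eq: "(\<integral>\<^sup>+\<omega>. ennreal ((I \<omega>)\<^sup>2) \<partial>M) = integrand_norm2 M L \<Phi>"
    unfolding n\<Phi>
  proof (rule antisym)
    show "(\<integral>\<^sup>+\<omega>. ennreal ((I \<omega>)\<^sup>2) \<partial>M) \<le> (\<integral>\<^sup>+z. ennreal ((\<Psi> z)\<^sup>2) \<partial>?P)"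
      by (rule nn_integral_square_limit_le[OF _ _ _ _ iso(4) lim2 lim1']) auto
    show "(\<integral>\<^sup>+z. ennreal ((\<Psi> z)\<^sup>2) \<partial>?P) \<le> (\<integral>\<^sup>+\<omega>. ennreal ((I \<omega>)\<^sup>2) \<partial>M)"
      by (rule nn_integral_square_limit_le[OF _ _ _ _ iso(4)[symmetric] lim1' lim2]) auto
  qed
  show i2: "integrable M (\<lambda>\<omega>. (I \<omega>)\<^sup>2)"
    using eq fin by (intro integrableI_nonneg) auto
  show i: "integrable M I" by (rule square_integrable_imp_integrable[OF I i2])
  have "ennreal ((expectation I)\<^sup>2) \<le> (\<integral>\<^sup>+\<omega>. ennreal ((simple_integral W (S n) \<omega> - I \<omega>)\<^sup>2) \<partial>M)" for n
  proof (cases "(\<integral>\<^sup>+\<omega>. ennreal ((simple_integral W (S n) \<omega> - I \<omega>)\<^sup>2) \<partial>M) = \<infinity>")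
    case False
    define D where "D \<omega> = simple_integral W (S n) \<omega> - I \<omega>" for \<omega>
    have iD: "integrable M D" using i iso(2)[of n] by (simp add: D_def[abs_def])
    have [measurable]: "D \<in> borel_measurable M" using iD by simp
    have iD2: "integrable M (\<lambda>\<omega>. (D \<omega>)\<^sup>2)" using False by (intro integrableI_nonneg) (auto simp: D_def less_top)
    have "expectation D = - expectation I" using i iso(2,3)[of n] by (simp add: D_def[abs_def])
    then have "(expectation I)\<^sup>2 = (expectation D)\<^sup>2" by simp
    also have "\<dots> \<le> expectation (\<lambda>\<omega>. (D \<omega>)\<^sup>2)"
      using variance_eq[OF iD iD2] variance_positive[of D] by simp
    finally have "ennreal ((expectation I)\<^sup>2) \<le> ennreal (expectation (\<lambda>\<omega>. (D \<omega>)\<^sup>2))" by (rule ennreal_leI)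
    also have "\<dots> = (\<integral>\<^sup>+\<omega>. ennreal ((D \<omega>)\<^sup>2) \<partial>M)" using nn_integral_eq_integral[OF iD2] by simp
    finally show ?thesis by (simp add: D_def)
  qed simp
  then have "ennreal ((expectation I)\<^sup>2) \<le> 0"
    by (intro LIMSEQ_le_const[OF lim2]) auto
  then show "expectation I = 0" by (simp add: ennreal_eq_0_iff)
qed

end

section \<open>Second moments and energy\<close>

text \<open>One noise level is fixed. The function \<open>g\<close> is a bounded Borel version of
  the Lebesgue measurable \<open>u0\<close>, and \<open>g_u0\<close> says that the kernel does not
  see the difference. The later instantiation takes \<open>g\<close>, \<open>B\<close>,
  \<open>l\<close> and \<open>K\<close> independent of \<open>lam\<close>.\<close>

locale mild = noise M L W for M :: "'w measure" and L W +
  fixes p :: "real \<Rightarrow> real \<Rightarrow> real \<Rightarrow> real" and \<sigma> u0 g :: "real \<Rightarrow> real" and lam l K B :: real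
    and u :: "real \<Rightarrow> real \<Rightarrow> 'w \<Rightarrow> real"
  assumes L: "L > 0" and p: "dirichlet_heat_kernel L p" and mild: "mild_solution M L W p \<sigma> u0 lam u"
    and lam: "lam > 0" and l: "l > 0" and \<sigma>_lower: "\<And>x. l * \<bar>x\<bar> \<le> \<bar>\<sigma> x\<bar>" and \<sigma>_upper: "\<And>x. \<bar>\<sigma> x\<bar> \<le> K * \<bar>x\<bar>"
    and \<sigma>_measurable [measurable]: "\<sigma> \<in> borel_measurable borel"
    and g [measurable]: "g \<in> borel_measurable borel" and g_bound: "\<And>x. \<bar>g x\<bar> \<le> B"
    and g_u0: "\<And>t x. t > 0 \<Longrightarrow> x \<in> {0..L} \<Longrightarrow> (LINT y:{0..L}|lebesgue. u0 y * p t x y)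
        = (LINT y|itv L. g y * p t x y)"
begin

definition "P t x = (LINT y|itv L. g y * p t x y)"

text \<open>Extended by zero, so that continuity on the stated set becomes joint Borel measurability
  on the whole space, as Tonelli requires.\<close>

definition "kern r x y = indicator ({0<..} \<times> {0..L} \<times> {0..L}) (r, x, y) * p r x y"

text \<open>The field is cut off where predictability gives no measurability.\<close>

definition "field s y \<omega> = indicator (({0<..} \<times> {0..L}) \<times> space M) ((s, y), \<omega>) * u s y \<omega>"

definition "moment s y = (\<integral>\<^sup>+\<omega>. ennreal ((field s y \<omega>)\<^sup>2) \<partial>M)"

definition "moment\<sigma> s y = (\<integral>\<^sup>+\<omega>. ennreal ((\<sigma> (field s y \<omega>))\<^sup>2) \<partial>M)"

lemma K_pos: "K > 0"
proof -
  have "l * \<bar>1\<bar> \<le> K * \<bar>1::real\<bar>" using \<sigma>_lower[of 1] \<sigma>_upper[of 1] by linarith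
  then show ?thesis using l by simp
qed

lemma \<sigma>_0 [simp]: "\<sigma> 0 = 0"
  using \<sigma>_upper[of 0] by simp

lemma field_measurable [measurable]: "(\<lambda>z. field (fst (fst z)) (snd (fst z)) (snd z)) \<in> borel_measurable
    ((lborel \<Otimes>\<^sub>M lborel) \<Otimes>\<^sub>M M)"
proof -
  have "(\<lambda>((t, x), \<omega>). u t x \<omega>) \<in> borel_measurable (predictable_sigma M \<F> {0..L})"
    using mild unfolding mild_solution_def by blast
  from predictable_measurable[OF this] show ?thesis
    by (simp add: field_def[abs_def] lborel_prod case_prod_unfold)
qed

lemma field_measurable2 [measurable (raw)]:
  assumes [measurable]: "f \<in> borel_measurable N" "h \<in> borel_measurable N" "k \<in> measurable N M"
  shows "(\<lambda>z. field (f z) (h z) (k z)) \<in> borel_measurable N"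
proof -
  have "(\<lambda>z. ((f z, h z), k z)) \<in> measurable N ((lborel \<Otimes>\<^sub>M lborel) \<Otimes>\<^sub>M M)" by measurable
  from measurable_compose[OF this field_measurable] show ?thesis by simp
qed

lemma kern_measurable [measurable (raw)]:
  assumes [measurable]: "f \<in> borel_measurable N" "h \<in> borel_measurable N" "k \<in> borel_measurable N"
  shows "(\<lambda>z. kern (f z) (h z) (k z)) \<in> borel_measurable N"
proof -
  have "{0<..} \<times> {0..L} \<times> {0..L} \<in> sets (borel \<Otimes>\<^sub>M (borel \<Otimes>\<^sub>M borel) :: (real \<times> real \<times> real) measure)"
    by (intro pair_measureI) auto
  then have m: "{0<..} \<times> {0..L} \<times> {0..L} \<in> sets (borel :: (real \<times> real \<times> real) measure)" unfolding borel_prod .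
  have "(\<lambda>q. indicator ({0<..} \<times> {0..L} \<times> {0..L}) q *\<^sub>R (case q of (r, x, y) \<Rightarrow> p r x y)) \<in> borel_measurable
      borel"
    by (rule borel_measurable_continuous_on_indicator[OF m dirichlet_heat_kernel_continuous[OF p]])
  then have "(\<lambda>q. kern (fst q) (fst (snd q)) (snd (snd q))) \<in> borel_measurable borel"
    by (simp add: kern_def case_prod_unfold)
  moreover have "(\<lambda>z. (f z, h z, k z)) \<in> borel_measurable N" by measurable
  ultimately have "(\<lambda>z. (\<lambda>q. kern (fst q) (fst (snd q)) (snd (snd q))) (f z, h z, k z)) \<in> borel_measurable N"
    by (rule measurable_compose[rotated])
  then show ?thesis by simp
qed

lemma moment_measurable [measurable (raw)]:
  assumes [measurable]: "f \<in> borel_measurable N" "h \<in> borel_measurable N"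
  shows "(\<lambda>z. moment (f z) (h z)) \<in> borel_measurable N" "(\<lambda>z. moment\<sigma> (f z) (h z)) \<in> borel_measurable N"
  unfolding moment_def moment\<sigma>_def by measurable

lemma moment\<sigma>_bounds:
  "ennreal (l\<^sup>2) * moment s y \<le> moment\<sigma> s y" "moment\<sigma> s y \<le> ennreal (K\<^sup>2) * moment s y"
proof -
  have 1: "l\<^sup>2 * x\<^sup>2 \<le> (\<sigma> x)\<^sup>2" for x
    using power_mono[OF \<sigma>_lower[of x], of 2] l by (simp add: power_mult_distrib)
  have 2: "(\<sigma> x)\<^sup>2 \<le> K\<^sup>2 * x\<^sup>2" for x
    using power_mono[OF \<sigma>_upper[of x], of 2] by (simp add: power_mult_distrib)
  show "ennreal (l\<^sup>2) * moment s y \<le> moment\<sigma> s y"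
    unfolding moment_def moment\<sigma>_def using 1
    by (subst nn_integral_cmult[symmetric]) (auto intro!: nn_integral_mono ennreal_leI simp:
        ennreal_mult[symmetric])
  show "moment\<sigma> s y \<le> ennreal (K\<^sup>2) * moment s y"
    unfolding moment_def moment\<sigma>_def using 2
    by (subst nn_integral_cmult[symmetric]) (auto intro!: nn_integral_mono ennreal_leI simp:
        ennreal_mult[symmetric])
qed

text \<open>Squaring the mild formulation: the cross term vanishes because the Walsh integral has
  mean zero, the isometry gives its second moment, and Tonelli brings the expectation
  inside.\<close>

lemma moment_eq:
  assumes t: "t > 0" and x: "x \<in> {0..L}"
  shows "moment t x = ennreal ((P t x)\<^sup>2) + ennreal (lam\<^sup>2) *
    (\<integral>\<^sup>+s. \<integral>\<^sup>+y. ennreal (indicator {0<..<t} s * indicator {0<..<L} y * (kern (t - s) x y)\<^sup>2)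
        * moment\<sigma> s y \<partial>lborel \<partial>lborel)"
proof -
  define \<Phi> where "\<Phi> = (\<lambda>((s, y), \<omega>). indicator {0<..<t} s * p (t - s) x y * \<sigma> (u s y \<omega>))"
  obtain I where I: "has_walsh_integral M L W \<Phi> I"
    and ae: "AE \<omega> in M. u t x \<omega> = P t x + lam * I \<omega>"
    using mild t x unfolding mild_solution_def \<Phi>_def P_def g_u0[OF t x, symmetric] by blast
  note iso = walsh_isometry[OF I]
  have [measurable]: "I \<in> borel_measurable M" using iso by simp
  have fu: "field t x \<omega> = u t x \<omega>" if "\<omega> \<in> space M" for \<omega> using t x that by (simp add: field_def)
  have eq: "(P t x + lam * I \<omega>)\<^sup>2 = (P t x)\<^sup>2 + 2 * P t x * lam * I \<omega> + lam\<^sup>2 * (I \<omega>)\<^sup>2" for \<omega>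
    by (simp add: power2_eq_square algebra_simps)
  have i: "integrable M (\<lambda>\<omega>. (P t x + lam * I \<omega>)\<^sup>2)" unfolding eq using iso by simp
  have "moment t x = (\<integral>\<^sup>+\<omega>. ennreal ((P t x + lam * I \<omega>)\<^sup>2) \<partial>M)"
    unfolding moment_def by (rule nn_integral_cong_AE) (use ae AE_space in \<open>eventually_elim, simp add: fu\<close>)
  also have "\<dots> = ennreal (expectation (\<lambda>\<omega>. (P t x + lam * I \<omega>)\<^sup>2))"
    by (rule nn_integral_eq_integral[OF i]) simp
  also have "expectation (\<lambda>\<omega>. (P t x + lam * I \<omega>)\<^sup>2) = (P t x)\<^sup>2 + lam\<^sup>2 * expectation (\<lambda>\<omega>. (I \<omega>)\<^sup>2)"
    unfolding eq using iso by (simp add: prob_space)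
  also have "ennreal \<dots> = ennreal ((P t x)\<^sup>2) + ennreal (lam\<^sup>2) * ennreal (expectation (\<lambda>\<omega>. (I \<omega>)\<^sup>2))"
    by (simp add: ennreal_plus ennreal_mult)
  also have "ennreal (expectation (\<lambda>\<omega>. (I \<omega>)\<^sup>2)) = integrand_norm2 M L \<Phi>"
    using iso(1) nn_integral_eq_integral[OF iso(2)] by simp
  also have "integrand_norm2 M L \<Phi> = (\<integral>\<^sup>+z. ennreal (indicator {0<..<t} (fst (fst z))
      * indicator {0<..<L} (snd (fst z))
      * (kern (t - fst (fst z)) x (snd (fst z)))\<^sup>2)
          * ennreal ((\<sigma> (field (fst (fst z)) (snd (fst z)) (snd z)))\<^sup>2) \<partial>((lborel \<Otimes>\<^sub>M lborel) \<Otimes>\<^sub>M M))"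
    unfolding integrand_norm2_def lborel_prod
  proof (rule nn_integral_cong)
    fix z :: "(real \<times> real) \<times> 'w" assume "z \<in> space (lborel \<Otimes>\<^sub>M M)"
    then obtain s y \<omega> where z: "z = ((s, y), \<omega>)" "\<omega> \<in> space M" by (cases z) (auto simp: space_pair_measure)
    show "ennreal ((\<Phi> z)\<^sup>2) * indicator (({0<..} \<times> {0<..<L}) \<times> space M) z =
       ennreal (indicator {0<..<t} (fst (fst z)) * indicator {0<..<L} (snd (fst z))
      * (kern (t - fst (fst z)) x (snd (fst z)))\<^sup>2)
          * ennreal ((\<sigma> (field (fst (fst z)) (snd (fst z)) (snd z)))\<^sup>2)"
      using z x by (cases "0 < s \<and> s < t \<and> 0 < y \<and> y < L")
        (auto simp: \<Phi>_def kern_def field_def power_mult_distrib ennreal_mult indicator_def)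
  qed
  also have "\<dots> = (\<integral>\<^sup>+q. (\<integral>\<^sup>+\<omega>. ennreal (indicator {0<..<t} (fst q) * indicator {0<..<L} (snd q)
      * (kern (t - fst q) x (snd q))\<^sup>2) * ennreal ((\<sigma> (field (fst q) (snd q) \<omega>))\<^sup>2) \<partial>M) \<partial>(lborel \<Otimes>\<^sub>M lborel))"
    by (subst nn_integral_fst[symmetric]) auto
  also have "\<dots> = (\<integral>\<^sup>+q. ennreal (indicator {0<..<t} (fst q) * indicator {0<..<L} (snd q)
      * (kern (t - fst q) x (snd q))\<^sup>2) * moment\<sigma> (fst q) (snd q) \<partial>(lborel \<Otimes>\<^sub>M lborel))"
    unfolding moment\<sigma>_def by (intro nn_integral_cong nn_integral_cmult) measurable
  also have "\<dots> = (\<integral>\<^sup>+s. \<integral>\<^sup>+y. ennreal (indicator {0<..<t} s * indicator {0<..<L} y * (kern (t - s) x y)\<^sup>2)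
      * moment\<sigma> s y \<partial>lborel \<partial>lborel)"
    by (subst lborel.nn_integral_fst[symmetric]) auto
  finally show ?thesis .
qed

definition "wmoment \<phi> t = (\<integral>\<^sup>+x. ennreal (indicator {0..L} x * \<phi> x) * moment t x \<partial>lborel)"

text \<open>What remains of the squared kernel when the moment equation is integrated over
  \<open>x\<close> with weight \<open>\<phi>\<close>. It is bounded above for weight 1 and below for
  the squared first sine.\<close>

definition "mass \<phi> r y = (\<integral>\<^sup>+x. ennreal (indicator {0..L} x * (\<phi> x * (kern r x y)\<^sup>2)) \<partial>lborel)"

text \<open>Tonelli moves the integral over \<open>x\<close> innermost, where it meets only the
  squared kernel.\<close>

lemma wmoment_eq:
  assumes t: "t > 0" and [measurable]: "\<phi> \<in> borel_measurable borel" and \<phi>: "\<And>x. \<phi> x \<ge> 0"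
  shows "wmoment \<phi> t = (\<integral>\<^sup>+x. ennreal (indicator {0..L} x * (\<phi> x * (P t x)\<^sup>2)) \<partial>lborel) + ennreal (lam\<^sup>2) *
    (\<integral>\<^sup>+s. \<integral>\<^sup>+y. ennreal (indicator {0<..<t} s * indicator {0<..<L} y) * moment\<sigma> s y * mass \<phi> (t
        - s) y \<partial>lborel \<partial>lborel)"
proof -
  have cP: "continuous_on {0..L} (P t)"
    unfolding P_def[abs_def]
    by (rule dirichlet_semigroup_continuous[OF L p t]) (auto intro!: g_bound borel_measurable_itvI)
  have [measurable]: "(\<lambda>x. indicator {0..L} x * P t x) \<in> borel_measurable borel"
    using borel_measurable_continuous_on_indicator[OF _ cP] by simp
  have m1: "(\<lambda>x. ennreal (indicator {0..L} x * (\<phi> x * (P t x)\<^sup>2))) \<in> borel_measurable borel"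
  proof -
    have "(\<lambda>x. ennreal (indicator {0..L} x * (\<phi> x * (P t x)\<^sup>2)))
        = (\<lambda>x. ennreal (\<phi> x * (indicator {0..L} x * P t x)\<^sup>2))"
      by (auto simp: indicator_def)
    then show ?thesis by simp
  qed
  let ?f = "\<lambda>x s y. ennreal (indicator {0..L} x * \<phi> x) * (ennreal (indicator {0<..<t} s
      * indicator {0<..<L} y * (kern (t - s) x y)\<^sup>2) * moment\<sigma> s y)"
  have "wmoment \<phi> t = (\<integral>\<^sup>+x. ennreal (indicator {0..L} x * (\<phi> x * (P t x)\<^sup>2)) + ennreal (lam\<^sup>2)
      * (\<integral>\<^sup>+s. \<integral>\<^sup>+y. ?f x s y \<partial>lborel \<partial>lborel) \<partial>lborel)"
    unfolding wmoment_def
  proof (rule nn_integral_cong)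
    fix x :: real
    show "ennreal (indicator {0..L} x * \<phi> x) * moment t x
        = ennreal (indicator {0..L} x * (\<phi> x * (P t x)\<^sup>2)) + ennreal (lam\<^sup>2)
        * (\<integral>\<^sup>+s. \<integral>\<^sup>+y. ?f x s y \<partial>lborel \<partial>lborel)"
    proof (cases "x \<in> {0..L}")
      case True
      have "(\<integral>\<^sup>+s. \<integral>\<^sup>+y. ?f x s y \<partial>lborel \<partial>lborel) = ennreal (indicator {0..L} x * \<phi> x) *
        (\<integral>\<^sup>+s. \<integral>\<^sup>+y. ennreal (indicator {0<..<t} s * indicator {0<..<L} y * (kern (t - s) x y)\<^sup>2)
            * moment\<sigma> s y \<partial>lborel \<partial>lborel)"
        by (simp add: nn_integral_cmult)
      then show ?thesis using True \<phi> unfolding moment_eq[OF t True]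
        by (simp add: distrib_left ennreal_mult mult_ac)
    qed simp
  qed
  also have "\<dots> = (\<integral>\<^sup>+x. ennreal (indicator {0..L} x * (\<phi> x * (P t x)\<^sup>2))
      \<partial>lborel) + ennreal (lam\<^sup>2) * (\<integral>\<^sup>+x. \<integral>\<^sup>+s. \<integral>\<^sup>+y. ?f x s y \<partial>lborel \<partial>lborel \<partial>lborel)"
    using m1 by (subst nn_integral_add) (auto simp: nn_integral_cmult)
  also have "(\<integral>\<^sup>+x. \<integral>\<^sup>+s. \<integral>\<^sup>+y. ?f x s y \<partial>lborel \<partial>lborel \<partial>lborel)
      = (\<integral>\<^sup>+s. \<integral>\<^sup>+x. \<integral>\<^sup>+y. ?f x s y \<partial>lborel \<partial>lborel \<partial>lborel)"
    by (rule lborel_pair.Fubini') measurable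
  also have "\<dots> = (\<integral>\<^sup>+s. \<integral>\<^sup>+y. \<integral>\<^sup>+x. ?f x s y \<partial>lborel \<partial>lborel \<partial>lborel)"
    by (intro nn_integral_cong lborel_pair.Fubini') measurable
  also have "\<dots> = (\<integral>\<^sup>+s. \<integral>\<^sup>+y. ennreal (indicator {0<..<t} s * indicator {0<..<L} y) * moment\<sigma> s y
      * mass \<phi> (t - s) y \<partial>lborel \<partial>lborel)"
    unfolding mass_def by (intro nn_integral_cong, subst nn_integral_cmult[symmetric])
       (auto intro!: nn_integral_cong simp: \<phi> ennreal_mult mult_ac)
  finally show ?thesis .
qed

end

section \<open>Integrals of the inverse square root\<close>

lemma nn_integral_itv_continuous:
  fixes f :: "real \<Rightarrow> real"
  assumes "continuous_on {0..L} f" "\<And>x. x \<in> {0..L} \<Longrightarrow> f x \<ge> 0"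
  shows "(\<integral>\<^sup>+x. ennreal (indicator {0..L} x * f x) \<partial>lborel) = ennreal (LINT x|itv L. f x)"
proof -
  have "(\<integral>\<^sup>+x. ennreal (indicator {0..L} x * f x) \<partial>lborel) = (\<integral>\<^sup>+x. ennreal (f x) \<partial>itv L)"
    by (subst nn_integral_restrict_space) (auto intro!: nn_integral_cong simp: indicator_def)
  also have "\<dots> = ennreal (LINT x|itv L. f x)"
    by (rule nn_integral_eq_integral[OF integrable_itv_continuous[OF assms(1)]])
       (use assms(2) in \<open>auto simp: space_restrict_space intro!: AE_I2\<close>)
  finally show ?thesis .
qed

lemma integral_itv_const: "L > 0 \<Longrightarrow> (LINT x|itv L. c) = L * (c::real)"
  by (subst integral_itv_continuous) auto

lemma nn_integral_inverse_sqrt: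
  fixes t :: real
  assumes "\<delta> \<ge> 0"
  shows "(\<integral>\<^sup>+s. ennreal (indicator {t - \<delta>..t} s * (1 / sqrt (t - s))) \<partial>lborel) = ennreal (2 * sqrt \<delta>)"
proof -
  define f where "f s = (if s \<in> {t - \<delta>..t} then 1 / sqrt (t - s) else 0)" for s
  have [measurable]: "f \<in> borel_measurable borel" unfolding f_def by measurable
  \<comment> \<open>The integrand is singular at \<open>s = t\<close>; the antiderivative is
    continuous there, which is enough.\<close>
  have "((\<lambda>s. 1 / sqrt (t - s)) has_integral - 2 * sqrt (t - t) - - 2 * sqrt (t - (t - \<delta>))) {t - \<delta>..t}"
  proof (rule fundamental_theorem_of_calculus_interior)
    fix s assume s: "s \<in> {t - \<delta><..<t}"
    have "((\<lambda>s. - 2 * sqrt (t - s)) has_real_derivative 1 / sqrt (t - s)) (at s)"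
      using s by (auto intro!: derivative_eq_intros simp: field_simps)
    then show "((\<lambda>s. - 2 * sqrt (t - s)) has_vector_derivative 1 / sqrt (t - s)) (at s)"
      by (simp add: has_real_derivative_iff_has_vector_derivative)
  qed (use assms in \<open>auto intro!: continuous_intros\<close>)
  then have f: "(f has_integral 2 * sqrt \<delta>) UNIV"
    unfolding f_def has_integral_restrict_UNIV by simp
  have "(\<integral>\<^sup>+s. ennreal (f s) \<partial>lborel) = ennreal (2 * sqrt \<delta>)"
    by (rule nn_integral_has_integral_lborel[OF _ _ f]) (simp_all add: f_def)
  moreover have "(\<integral>\<^sup>+s. ennreal (indicator {t - \<delta>..t} s * (1 / sqrt (t - s))) \<partial>lborel)
      = (\<integral>\<^sup>+s. ennreal (f s) \<partial>lborel)"
    by (rule nn_integral_cong) (simp add: f_def indicator_def)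
  ultimately show ?thesis by simp
qed

text \<open>Split at distance \<open>1 / \<beta>\<close> from \<open>t\<close>. Nearby the
  exponential is at most 1 and the singularity contributes \<open>2 / sqrt \<beta>\<close>; farther
  away \<open>1 / sqrt (t - s)\<close> is at most \<open>sqrt \<beta>\<close> and integrating the
  exponential leaves \<open>1 / sqrt \<beta>\<close>.\<close>

lemma nn_integral_inverse_sqrt_exp_le:
  fixes t :: real
  assumes \<beta>: "\<beta> > 0"
  shows "(\<integral>\<^sup>+s. ennreal (indicator {0<..<t} s * (1 / sqrt (t - s) * exp (- \<beta> * (t - s)))) \<partial>lborel)
      \<le> ennreal (3 / sqrt \<beta>)"
proof -
  let ?a = "\<lambda>s. ennreal (indicator {t - 1 / \<beta>..t} s * (1 / sqrt (t - s)))"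
  let ?b = "\<lambda>s. ennreal (indicator {..t} s * (sqrt \<beta> * exp (- \<beta> * (t - s))))"
  have "(\<integral>\<^sup>+s. ennreal (indicator {0<..<t} s * (1 / sqrt (t - s) * exp (- \<beta> * (t - s)))) \<partial>lborel)
      \<le> (\<integral>\<^sup>+s. ?a s + ?b s \<partial>lborel)"
  proof (rule nn_integral_mono)
    fix s :: real
    show "ennreal (indicator {0<..<t} s * (1 / sqrt (t - s) * exp (- \<beta> * (t - s)))) \<le> ?a s + ?b s"
    proof (cases "0 < s \<and> s < t")
      case True
      show ?thesis
      proof (cases "s \<ge> t - 1 / \<beta>")
        case near: True
        have "1 / sqrt (t - s) * exp (- \<beta> * (t - s)) \<le> 1 / sqrt (t - s) * 1"
          using True \<beta> by (intro mult_left_mono) auto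
        then have "ennreal (indicator {0<..<t} s * (1 / sqrt (t - s) * exp (- \<beta> * (t - s)))) \<le> ?a s"
          using near True by (auto intro!: ennreal_leI)
        then show ?thesis by (rule order_trans) simp
      next
        case far: False
        then have "1 / \<beta> \<le> t - s" by simp
        then have "1 / sqrt (t - s) \<le> 1 / sqrt (1 / \<beta>)"
          using \<beta> True by (intro divide_left_mono mult_pos_pos) auto
        then have "1 / sqrt (t - s) * exp (- \<beta> * (t - s)) \<le> sqrt \<beta> * exp (- \<beta> * (t - s))"
          using \<beta> by (intro mult_right_mono) (auto simp: real_sqrt_divide)
        then have "ennreal (indicator {0<..<t} s * (1 / sqrt (t - s) * exp (- \<beta> * (t - s)))) \<le> ?b s"
          using True by (auto intro!: ennreal_leI)
        then show ?thesis by (rule order_trans) simp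
      qed
    qed (auto simp: indicator_def)
  qed
  also have "\<dots> = (\<integral>\<^sup>+s. ?a s \<partial>lborel) + (\<integral>\<^sup>+s. ?b s \<partial>lborel)" by (intro nn_integral_add) auto
  also have "(\<integral>\<^sup>+s. ?b s \<partial>lborel) = (\<integral>\<^sup>+s. ?b (t + (-1) * s) \<partial>lborel)"
    by (subst nn_integral_real_affine[of _ "-1" t]) auto
  also have "\<dots> = (\<integral>\<^sup>+s. ennreal (sqrt \<beta> * exp (- \<beta> * s)) * indicator {0..} s \<partial>lborel)"
    by (intro nn_integral_cong) (auto simp: indicator_def)
  also have "\<dots> = ennreal (0 - (- (1 / sqrt \<beta> * exp (- \<beta> * 0))))"
  proof (rule nn_integral_FTC_atLeast)
    show "((\<lambda>s. - (1 / sqrt \<beta> * exp (- \<beta> * s))) has_real_derivative sqrt \<beta> * exp (- \<beta> * s)) (at s)" for s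
      using \<beta> by (auto intro!: derivative_eq_intros simp: field_simps)
    have "((\<lambda>s. - (1 / sqrt \<beta> * exp (- \<beta> * s))) \<longlongrightarrow> - (1 / sqrt \<beta> * 0)) at_top"
      using \<beta> by (intro tendsto_intros filterlim_compose[OF exp_at_bot] filterlim_tendsto_neg_mult_at_bot[OF
          tendsto_const] filterlim_ident) auto
    then show "((\<lambda>s. - (1 / sqrt \<beta> * exp (- \<beta> * s))) \<longlongrightarrow> 0) at_top" by simp
  qed (use \<beta> in auto)
  also have "(\<integral>\<^sup>+s. ?a s \<partial>lborel) = ennreal (2 * sqrt (1 / \<beta>))"
    using \<beta> by (intro nn_integral_inverse_sqrt) simp
  also have "ennreal (2 * sqrt (1 / \<beta>)) + ennreal (0 - (- (1 / sqrt \<beta> * exp (- \<beta> * 0)))) = ennreal (3 / sqrt \<beta>)"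
    using \<beta> by (subst ennreal_plus[symmetric]) (auto simp: real_sqrt_divide)
  finally show ?thesis .
qed

section \<open>Renewal inequalities\<close>

context mild
begin

lemma P_continuous: "t > 0 \<Longrightarrow> continuous_on {0..L} (P t)"
  unfolding P_def[abs_def]
  by (rule dirichlet_semigroup_continuous[OF L p]) (auto intro!: g_bound borel_measurable_itvI)

lemma mass_eq:
  assumes "s < t" "y \<in> {0..L}" and \<phi>: "continuous_on {0..L} \<phi>" "\<And>x. \<phi> x \<ge> 0"
  shows "mass \<phi> (t - s) y = ennreal (LINT x|itv L. \<phi> x * (p (t - s) x y)\<^sup>2)"
proof -
  have "mass \<phi> (t - s) y = (\<integral>\<^sup>+x. ennreal (indicator {0..L} x * (\<phi> x * (p (t - s) x y)\<^sup>2)) \<partial>lborel)"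
    unfolding mass_def by (rule nn_integral_cong) (use assms in \<open>auto simp: kern_def indicator_def\<close>)
  also have "\<dots> = ennreal (LINT x|itv L. \<phi> x * (p (t - s) x y)\<^sup>2)"
    by (rule nn_integral_itv_continuous)
       (use assms in \<open>auto intro!: continuous_intros dirichlet_heat_kernel_continuous_section2[OF L p]\<close>)
  finally show ?thesis .
qed

abbreviation "energy2 \<equiv> wmoment (\<lambda>_. 1)"

abbreviation "inner_energy2 \<equiv> wmoment (\<lambda>x. (dsin L 1 x)\<^sup>2)"

lemma wmoment_measurable [measurable (raw)]:
  assumes [measurable]: "f \<in> borel_measurable N" and [measurable]: "\<phi> \<in> borel_measurable borel"
  shows "(\<lambda>z. wmoment \<phi> (f z)) \<in> borel_measurable N"
  unfolding wmoment_def by measurable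

text \<open>Contraction of the semigroup bounds the deterministic part; the bound on the squared
  kernel is uniform in \<open>y\<close>, so the inequality closes in the energy alone.\<close>

lemma energy2_le:
  assumes t: "t > 0"
  shows "energy2 t \<le> ennreal (L * B\<^sup>2) + ennreal (lam\<^sup>2 * K\<^sup>2) *
    (\<integral>\<^sup>+s. ennreal (indicator {0<..<t} s * (1 / sqrt (t - s))) * energy2 s \<partial>lborel)"
proof -
  have "(\<integral>\<^sup>+x. ennreal (indicator {0..L} x * (1 * (P t x)\<^sup>2)) \<partial>lborel) = ennreal (LINT x|itv L. 1 * (P t x)\<^sup>2)"
    by (rule nn_integral_itv_continuous) (auto intro!: continuous_intros P_continuous[OF t])
  also have "\<dots> \<le> ennreal (L * B\<^sup>2)"
  proof (rule ennreal_leI)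
    have "(LINT x|itv L. 1 * (P t x)\<^sup>2) \<le> (LINT x|itv L. (g x)\<^sup>2)"
      using dirichlet_semigroup_square_le[OF L p t, of g B] g_bound by (simp add: P_def borel_measurable_itvI)
    also have "\<dots> \<le> (LINT x|itv L. B\<^sup>2)"
    proof (rule integral_mono)
      show le: "(g x)\<^sup>2 \<le> B\<^sup>2" for x using power_mono[OF g_bound[of x], of 2] by simp
      show "integrable (itv L) (\<lambda>x. (g x)\<^sup>2)"
        by (rule integrable_itv_bounded[of _ _ "B\<^sup>2"]) (auto intro!: borel_measurable_itvI le)
      show "integrable (itv L) (\<lambda>x. B\<^sup>2)" by (intro integrable_itv_continuous continuous_intros)
    qed
    also have "\<dots> = L * B\<^sup>2" by (rule integral_itv_const[OF L])
    finally show "(LINT x|itv L. 1 * (P t x)\<^sup>2) \<le> L * B\<^sup>2" .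
  qed
  finally have 1: "(\<integral>\<^sup>+x. ennreal (indicator {0..L} x * (1 * (P t x)\<^sup>2)) \<partial>lborel) \<le> ennreal (L * B\<^sup>2)" .
  have "(\<integral>\<^sup>+s. \<integral>\<^sup>+y. ennreal (indicator {0<..<t} s * indicator {0<..<L} y) * moment\<sigma> s y *
      mass (\<lambda>_. 1) (t - s) y \<partial>lborel \<partial>lborel)
    \<le> (\<integral>\<^sup>+s. ennreal (K\<^sup>2) * (ennreal (indicator {0<..<t} s * (1 / sqrt (t - s))) * energy2 s) \<partial>lborel)"
  proof (rule nn_integral_mono)
    fix s :: real
    have "(\<integral>\<^sup>+y. ennreal (indicator {0<..<t} s * indicator {0<..<L} y) * moment\<sigma> s y *
        mass (\<lambda>_. 1) (t - s) y \<partial>lborel)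
      \<le> (\<integral>\<^sup>+y. ennreal (K\<^sup>2) * ennreal (indicator {0<..<t} s * (1 / sqrt (t - s)))
          * (ennreal (indicator {0..L} y * 1) * moment s y) \<partial>lborel)"
    proof (rule nn_integral_mono)
      fix y :: real
      show "ennreal (indicator {0<..<t} s * indicator {0<..<L} y) * moment\<sigma> s y *
          mass (\<lambda>_. 1) (t - s) y
        \<le> ennreal (K\<^sup>2) * ennreal (indicator {0<..<t} s * (1 / sqrt (t - s))) * (ennreal (indicator {0..L} y
            * 1) * moment s y)"
      proof (cases "s \<in> {0<..<t} \<and> y \<in> {0<..<L}")
        case True
        then have st: "s < t" "y \<in> {0..L}" by auto
        have "mass (\<lambda>_. 1) (t - s) y \<le> ennreal (1 / sqrt (t - s))"
          by (subst mass_eq[OF st]) (use dirichlet_heat_kernel_square_le[OF L p, of "t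
              - s" y] st in \<open>auto intro!: ennreal_leI\<close>)
        then have "moment\<sigma> s y * mass (\<lambda>_. 1) (t - s) y
            \<le> (ennreal (K\<^sup>2) * moment s y) * ennreal (1 / sqrt (t - s))"
          using moment\<sigma>_bounds(2) by (intro mult_mono) auto
        then show ?thesis using True by (simp add: mult_ac)
      qed (auto simp: indicator_def)
    qed
    also have "\<dots> = ennreal (K\<^sup>2) * (ennreal (indicator {0<..<t} s * (1 / sqrt (t - s))) * energy2 s)"
      unfolding wmoment_def by (subst nn_integral_cmult) (auto simp: mult.assoc)
    finally show "(\<integral>\<^sup>+y. ennreal (indicator {0<..<t} s * indicator {0<..<L} y) * moment\<sigma> s y *
        mass (\<lambda>_. 1) (t - s) y \<partial>lborel)
      \<le> ennreal (K\<^sup>2) * (ennreal (indicator {0<..<t} s * (1 / sqrt (t - s))) * energy2 s)" .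
  qed
  also have "\<dots> = ennreal (K\<^sup>2) * (\<integral>\<^sup>+s. ennreal (indicator {0<..<t} s * (1 / sqrt (t - s)))
      * energy2 s \<partial>lborel)"
    by (rule nn_integral_cmult) measurable
  finally show ?thesis
    unfolding wmoment_eq[OF t borel_measurable_const zero_le_one]
    using 1 by (simp add: ennreal_mult mult.assoc add_mono mult_left_mono)
qed

text \<open>The weighted kernel estimate returns the weight at \<open>y\<close>, so the inequality
  closes in \<open>inner_energy2\<close>. The integral is confined to the last \<open>r0\<close>
  units of time, where that estimate holds.\<close>

lemma inner_energy2_ge:
  assumes t: "t > 0"
    and c: "c > 0" "\<And>r y. 0 < r \<Longrightarrow> r \<le> r0 \<Longrightarrow> y \<in> {0..L} \<Longrightarrow>
      c / sqrt r * (dsin L 1 y)\<^sup>2 \<le> (LINT x|itv L. (dsin L 1 x * p r x y)\<^sup>2)"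
  shows "ennreal (exp (- 2 * rate L 1 * t) * (LINT x|itv L. g x * dsin L 1 x)\<^sup>2 / L) + ennreal (lam\<^sup>2 * l\<^sup>2
      * c) *
    (\<integral>\<^sup>+s. ennreal (indicator ({0<..<t} \<inter> {t - r0..}) s * (1 / sqrt (t - s))) * inner_energy2 s \<partial>lborel)
        \<le> inner_energy2 t"
proof -
  let ?b = "LINT x|itv L. g x * dsin L 1 x" and ?\<phi> = "\<lambda>x. (dsin L 1 x)\<^sup>2"
  have cP: "continuous_on {0..L} (\<lambda>x. dsin L 1 x * P t x)" by (intro continuous_intros P_continuous t)
  have "(exp (- rate L 1 * t) * ?b)\<^sup>2 = (\<Sum>i\<in>{()}. (LINT x|itv L. (dsin L 1 x * P t x) * 1)\<^sup>2)"
    using dirichlet_semigroup_dsin[OF L p t, of g B 1] g_bound by (simp add: P_def borel_measurable_itvI)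
  \<comment> \<open>Cauchy-Schwarz, read as Bessel's inequality for the constant function 1 of
    squared norm \<open>L\<close>.\<close>
  also have "\<dots> \<le> L * (LINT x|itv L. (dsin L 1 x * P t x)\<^sup>2)"
    by (rule bessel_inequality[where \<phi> = "\<lambda>_ _. 1"])
       (use L cP in \<open>auto intro!: integrable_itv_continuous continuous_intros simp: measure_restrict_space\<close>)
  finally have "(exp (- rate L 1 * t) * ?b)\<^sup>2 / L \<le> (LINT x|itv L. ?\<phi> x * (P t x)\<^sup>2)"
    using L by (simp add: field_simps power_mult_distrib)
  moreover have "(exp (- rate L 1 * t) * ?b)\<^sup>2 = exp (- 2 * rate L 1 * t) * ?b\<^sup>2"
    by (simp add: power_mult_distrib exp_double[symmetric])
  moreover have "(\<integral>\<^sup>+x. ennreal (indicator {0..L} x * (?\<phi> x * (P t x)\<^sup>2)) \<partial>lborel)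
      = ennreal (LINT x|itv L. ?\<phi> x * (P t x)\<^sup>2)"
    by (rule nn_integral_itv_continuous) (auto intro!: continuous_intros P_continuous[OF t])
  ultimately have 1: "ennreal (exp (- 2 * rate L 1 * t) * ?b\<^sup>2 / L)
      \<le> (\<integral>\<^sup>+x. ennreal (indicator {0..L} x * (?\<phi> x * (P t x)\<^sup>2)) \<partial>lborel)"
    by (simp add: ennreal_leI)
  let ?I = "\<lambda>s. ennreal (indicator ({0<..<t} \<inter> {t - r0..}) s * (1 / sqrt (t - s)))"
  have "ennreal (l\<^sup>2 * c) * (\<integral>\<^sup>+s. ?I s * inner_energy2 s \<partial>lborel)
      = (\<integral>\<^sup>+s. ennreal (l\<^sup>2 * c) * (?I s * inner_energy2 s) \<partial>lborel)"
    by (rule nn_integral_cmult[symmetric]) measurable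
  also have "\<dots> \<le> (\<integral>\<^sup>+s. \<integral>\<^sup>+y. ennreal (indicator {0<..<t} s * indicator {0<..<L} y) * moment\<sigma> s y *
      mass ?\<phi> (t - s) y \<partial>lborel \<partial>lborel)"
  proof (rule nn_integral_mono)
    fix s :: real
    have "ennreal (l\<^sup>2 * c) * (?I s * inner_energy2 s)
        = (\<integral>\<^sup>+y. ennreal (l\<^sup>2 * c) * ?I s * (ennreal (indicator {0..L} y * ?\<phi> y) * moment s y) \<partial>lborel)"
      unfolding wmoment_def by (subst nn_integral_cmult) (auto simp: mult.assoc)
    also have "\<dots> \<le> (\<integral>\<^sup>+y. ennreal (indicator {0<..<t} s * indicator {0<..<L} y) * moment\<sigma> s y *
      mass ?\<phi> (t - s) y \<partial>lborel)"
    proof (rule nn_integral_mono)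
      fix y :: real
      show "ennreal (l\<^sup>2 * c) * ?I s * (ennreal (indicator {0..L} y * ?\<phi> y) * moment s y)
        \<le> ennreal (indicator {0<..<t} s * indicator {0<..<L} y) * moment\<sigma> s y *
          mass ?\<phi> (t - s) y"
      proof (cases "s \<in> {0<..<t} \<and> t - s \<le> r0 \<and> y \<in> {0<..<L}")
        case True
        then have st: "s < t" "y \<in> {0..L}" by auto
        have "ennreal (c * (1 / sqrt (t - s)) * ?\<phi> y) \<le> mass ?\<phi> (t - s) y"
          by (subst mass_eq[OF st])
             (use c(2)[of "t - s" y] True in \<open>auto intro!: ennreal_leI continuous_intros simp:
                 power_mult_distrib\<close>)
        then have "(ennreal (l\<^sup>2) * moment s y) * ennreal (c * (1 / sqrt (t - s)) * ?\<phi> y)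
          \<le> moment\<sigma> s y * mass ?\<phi> (t - s) y"
          using moment\<sigma>_bounds(1) by (intro mult_mono) auto
        moreover have "0 \<le> c" "0 \<le> 1 / sqrt (t - s)" "0 \<le> ?\<phi> y" using c(1) True by auto
        note ennreal_mult[OF mult_nonneg_nonneg[OF this(1,2)] this(3)] ennreal_mult[OF this(1,2)]
        then have "ennreal (l\<^sup>2 * c) * ?I s * (ennreal (indicator {0..L} y * ?\<phi> y) * moment s y) =
          (ennreal (l\<^sup>2) * moment s y) * ennreal (c * (1 / sqrt (t - s)) * ?\<phi> y)"
          using True c(1) by (simp add: ennreal_mult mult_ac)
        ultimately show ?thesis using True by simp
      next
        case False
        \<comment> \<open>At \<open>y = 0\<close> and \<open>y = L\<close>, where the indicators of
          the open and the closed interval differ, the weight vanishes.\<close>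
        then have "?I s * (ennreal (indicator {0..L} y * ?\<phi> y)) = 0"
          using L by (cases "y = 0 \<or> y = L") (auto simp: indicator_def)
        then show ?thesis by (auto simp: mult_ac)
      qed
    qed
    finally show "ennreal (l\<^sup>2 * c) * (?I s * inner_energy2 s)
        \<le> (\<integral>\<^sup>+y. ennreal (indicator {0<..<t} s * indicator {0<..<L} y) * moment\<sigma> s y *
      mass ?\<phi> (t - s) y \<partial>lborel)" .
  qed
  finally have "ennreal (lam\<^sup>2) * (ennreal (l\<^sup>2 * c) * (\<integral>\<^sup>+s. ?I s * inner_energy2 s \<partial>lborel)) \<le>
     ennreal (lam\<^sup>2) * (\<integral>\<^sup>+s. \<integral>\<^sup>+y. ennreal (indicator {0<..<t} s * indicator {0<..<L} y) * moment\<sigma> s y *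
      mass ?\<phi> (t - s) y \<partial>lborel \<partial>lborel)"
    by (rule mult_left_mono) simp
  moreover have "ennreal (lam\<^sup>2 * l\<^sup>2 * c) = ennreal (lam\<^sup>2) * ennreal (l\<^sup>2 * c)"
    using c(1) by (simp add: ennreal_mult[symmetric] mult.assoc)
  moreover have "inner_energy2 t = (\<integral>\<^sup>+x. ennreal (indicator {0..L} x * (?\<phi> x * (P t x)\<^sup>2))
      \<partial>lborel) + ennreal (lam\<^sup>2) *
    (\<integral>\<^sup>+s. \<integral>\<^sup>+y. ennreal (indicator {0<..<t} s * indicator {0<..<L} y) * moment\<sigma> s y *
      mass ?\<phi> (t - s) y \<partial>lborel \<partial>lborel)"
    by (rule wmoment_eq[OF t]) auto
  ultimately show ?thesis using 1 by (simp add: mult.assoc add_mono)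
qed

end

section \<open>Exponential growth of the energy\<close>

context mild
begin

lemma moment_bounded:
  assumes T: "T > 0"
  shows "\<exists>C<\<infinity>. \<forall>s y. 0 < s \<longrightarrow> s \<le> T \<longrightarrow> y \<in> {0..L} \<longrightarrow> moment s y \<le> C"
proof (intro exI conjI allI impI)
  let ?C = "SUP x\<in>{0..L}. SUP t\<in>{0..T}. \<integral>\<^sup>+\<omega>. ennreal (\<bar>u t x \<omega>\<bar> powr 2) \<partial>M"
  have "\<forall>T>0. \<forall>k\<ge>2. (SUP x\<in>{0..L}. SUP t\<in>{0..T}. \<integral>\<^sup>+\<omega>. ennreal (\<bar>u t x \<omega>\<bar> powr k) \<partial>M) < \<infinity>"
    using mild unfolding mild_solution_def by blast
  from this[rule_format, OF T order_refl] show "?C < \<infinity>" .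
  fix s y assume *: "0 < s" "s \<le> T" "y \<in> {0..L}"
  have "moment s y = (\<integral>\<^sup>+\<omega>. ennreal (\<bar>u s y \<omega>\<bar> powr 2) \<partial>M)"
    unfolding moment_def by (rule nn_integral_cong) (use * in \<open>simp add: field_def\<close>)
  also have "\<dots> \<le> ?C" using * by (intro SUP_upper2[of y] SUP_upper2[of s]) auto
  finally show "moment s y \<le> ?C" .
qed

lemma energy2_bounded:
  assumes T: "T > 0"
  shows "\<exists>C<\<infinity>. \<forall>s. 0 < s \<longrightarrow> s \<le> T \<longrightarrow> energy2 s \<le> C"
proof -
  obtain C where C: "C < \<infinity>" "\<And>s y. 0 < s \<Longrightarrow> s \<le> T \<Longrightarrow> y \<in> {0..L} \<Longrightarrow> moment s y \<le> C"
    using moment_bounded[OF T] by blast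
  have "energy2 s \<le> C * ennreal L" if s: "0 < s" "s \<le> T" for s
  proof -
    have "energy2 s \<le> (\<integral>\<^sup>+x. C * indicator {0..L} x \<partial>lborel)"
      unfolding wmoment_def by (rule nn_integral_mono) (use C(2)[OF s] in \<open>auto simp: indicator_def\<close>)
    also have "\<dots> = C * ennreal L" using L by (subst nn_integral_cmult_indicator) auto
    finally show ?thesis .
  qed
  moreover have "C * ennreal L < \<infinity>" using C(1) by (simp add: ennreal_mult_less_top)
  ultimately show ?thesis by blast
qed

text \<open>A supremum weighted by \<open>exp (- \<beta> * s)\<close> turns the renewal inequality
  into \<open>N \<le> L * B^2 + N / 2\<close>.\<close>

lemma energy2_upper:
  assumes T: "T > 0"
  shows "energy2 T \<le> ennreal (2 * (L * B\<^sup>2) * exp (36 * lam ^ 4 * K ^ 4 * T))"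
proof -
  \<comment> \<open>Chosen so that \<open>lam^2 * K^2 * (3 / sqrt \<beta>)\<close> equals 1/2; the
    fourth power of \<open>lam\<close> in the upper bound comes from here.\<close>
  define \<beta> where "\<beta> = 36 * lam ^ 4 * K ^ 4"
  have \<beta>: "\<beta> > 0" using lam K_pos by (simp add: \<beta>_def)
  have s\<beta>: "sqrt \<beta> = 6 * (lam\<^sup>2 * K\<^sup>2)"
    by (rule real_sqrt_unique) (simp_all add: \<beta>_def power_mult_distrib flip: power_mult)
  define N where "N = (SUP s\<in>{0<..T}. ennreal (exp (- \<beta> * s)) * energy2 s)"
  obtain C where C: "C < \<infinity>" "\<And>s. 0 < s \<Longrightarrow> s \<le> T \<Longrightarrow> energy2 s \<le> C" using energy2_bounded[OF T] by blast
  have "N \<le> C" unfolding N_def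
  proof (rule SUP_least)
    fix s assume "s \<in> {0<..T}"
    then have "ennreal (exp (- \<beta> * s)) * energy2 s \<le> 1 * C"
      using \<beta> C(2) by (intro mult_mono) (auto simp: ennreal_le_1)
    then show "ennreal (exp (- \<beta> * s)) * energy2 s \<le> C" by simp
  qed
  \<comment> \<open>An infinite \<open>N\<close> would satisfy the inequality derived below, so
    finiteness is what allows half of \<open>N\<close> to be absorbed.\<close>
  then have Nfin: "N < \<infinity>" using C(1) by (rule le_less_trans)
  have le: "energy2 s \<le> ennreal (exp (\<beta> * s)) * N" if "s \<in> {0<..T}" for s
  proof -
    have "energy2 s = ennreal (exp (\<beta> * s)) * (ennreal (exp (- \<beta> * s)) * energy2 s)"
      by (simp add: mult.assoc[symmetric] ennreal_mult[symmetric] exp_add[symmetric])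
    also have "\<dots> \<le> ennreal (exp (\<beta> * s)) * N"
      unfolding N_def using that by (intro mult_left_mono SUP_upper) auto
    finally show ?thesis .
  qed
  have "N \<le> ennreal (L * B\<^sup>2) + ennreal (1 / 2) * N"
    unfolding N_def
  proof (rule SUP_least, fold N_def)
    fix r assume r: "r \<in> {0<..T}"
    then have r0: "r > 0" by simp
    let ?k = "\<lambda>s. ennreal (indicator {0<..<r} s * (1 / sqrt (r - s)))"
    have "(\<integral>\<^sup>+s. ?k s * energy2 s \<partial>lborel) \<le> (\<integral>\<^sup>+s. ennreal (exp (\<beta> * r)) * N
        * ennreal (indicator {0<..<r} s * (1 / sqrt (r - s) * exp (- \<beta> * (r - s)))) \<partial>lborel)"
    proof (rule nn_integral_mono)
      fix s
      show "?k s * energy2 s \<le> ennreal (exp (\<beta> * r)) * N * ennreal (indicator {0<..<r} s * (1 / sqrt (r - s)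
          * exp (- \<beta> * (r - s))))"
      proof (cases "s \<in> {0<..<r}")
        case True
        have "?k s * energy2 s \<le> ?k s * (ennreal (exp (\<beta> * s)) * N)"
          using True r by (intro mult_left_mono le) auto
        also have "ennreal (exp (\<beta> * s)) = ennreal (exp (\<beta> * r)) * ennreal (exp (- \<beta> * (r - s)))"
          by (simp add: ennreal_mult[symmetric] exp_add[symmetric] algebra_simps)
        finally show ?thesis
          using True ennreal_mult[of "1 / sqrt (r - s)" "exp (- \<beta> * (r - s))"] by (simp add: mult_ac)
      qed simp
    qed
    also have "\<dots> = ennreal (exp (\<beta> * r)) * N * (\<integral>\<^sup>+s. ennreal (indicator {0<..<r} s * (1 / sqrt (r - s)
        * exp (- \<beta> * (r - s)))) \<partial>lborel)"
      by (rule nn_integral_cmult) measurable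
    also have "\<dots> \<le> ennreal (exp (\<beta> * r)) * N * ennreal (3 / sqrt \<beta>)"
      by (intro mult_left_mono nn_integral_inverse_sqrt_exp_le \<beta>) simp
    finally have i: "(\<integral>\<^sup>+s. ?k s * energy2 s \<partial>lborel) \<le> ennreal (exp (\<beta> * r)) * N * ennreal (3 / sqrt \<beta>)" .
    have "ennreal (exp (- \<beta> * r)) * energy2 r \<le> ennreal (exp (- \<beta> * r)) *
        (ennreal (L * B\<^sup>2) + ennreal (lam\<^sup>2 * K\<^sup>2) * (ennreal (exp (\<beta> * r)) * N * ennreal (3 / sqrt \<beta>)))"
      by (intro mult_left_mono order_trans[OF energy2_le[OF r0] add_left_mono[OF mult_left_mono[OF i]]])
          simp_all
    also have "\<dots> = ennreal (exp (- \<beta> * r)) * ennreal (L * B\<^sup>2) +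
        (ennreal (exp (- \<beta> * r)) * ennreal (exp (\<beta> * r))) * (ennreal (lam\<^sup>2 * K\<^sup>2) * ennreal (3 / sqrt \<beta>)) * N"
      by (simp add: distrib_left mult_ac)
    also have "ennreal (exp (- \<beta> * r)) * ennreal (exp (\<beta> * r)) = 1"
      by (simp add: ennreal_mult[symmetric] exp_add[symmetric])
    also have "ennreal (lam\<^sup>2 * K\<^sup>2) * ennreal (3 / sqrt \<beta>) = ennreal (1 / 2)"
      using lam K_pos by (subst ennreal_mult[symmetric]) (auto simp: s\<beta>)
    also have "ennreal (exp (- \<beta> * r)) * ennreal (L * B\<^sup>2) + 1 * ennreal (1 / 2) * N
        \<le> ennreal (L * B\<^sup>2) + ennreal (1 / 2) * N"
      using \<beta> r0 L by (auto simp: ennreal_mult[symmetric] intro!: add_right_mono ennreal_leI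
          mult_left_le_one_le)
    finally show "ennreal (exp (- \<beta> * r)) * energy2 r \<le> ennreal (L * B\<^sup>2) + ennreal (1 / 2) * N" .
  qed
  moreover obtain N' where N': "N = ennreal N'" "N' \<ge> 0" using Nfin by (cases N) auto
  moreover have "0 \<le> L * B\<^sup>2" "0 \<le> 1 / 2 * N'" "0 \<le> (1 / 2 :: real)" using L N' by auto
  note ennreal_plus[OF this(1,2)] ennreal_mult[OF this(3) N'(2)]
  ultimately have "ennreal N' \<le> ennreal (L * B\<^sup>2 + 1 / 2 * N')" by metis
  then have "N' \<le> L * B\<^sup>2 + 1 / 2 * N'" using L N' by (subst (asm) ennreal_le_iff) auto
  then have N2: "N' \<le> 2 * (L * B\<^sup>2)" by simp
  have "energy2 T \<le> ennreal (exp (\<beta> * T)) * N" using le T by simp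
  also have "\<dots> \<le> ennreal (exp (\<beta> * T)) * ennreal (2 * (L * B\<^sup>2))"
    unfolding N' by (intro mult_left_mono ennreal_leI N2) simp
  also have "\<dots> = ennreal (2 * (L * B\<^sup>2) * exp (36 * lam ^ 4 * K ^ 4 * T))"
    using L by (simp add: ennreal_mult[symmetric] \<beta>_def mult.commute)
  finally show ?thesis .
qed

text \<open>Each further window of length \<open>\<delta>\<close> doubles the lower bound: over it
  the inverse square root integrates to \<open>2 * sqrt \<delta>\<close>, and
  \<open>lam^2 * l^2 * c * 2 * sqrt \<delta> = 2\<close>. The exponential is evaluated at the final
  time \<open>T\<close>, so the constant is the same for all \<open>t\<close> in the induction. The
  condition \<open>\<delta> \<le> r0\<close> keeps the window within the range of the kernel
  estimate.\<close>

lemma inner_energy2_lower: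
  assumes c: "c > 0" "\<And>r y. 0 < r \<Longrightarrow> r \<le> r0 \<Longrightarrow> y \<in> {0..L} \<Longrightarrow>
      c / sqrt r * (dsin L 1 y)\<^sup>2 \<le> (LINT x|itv L. (dsin L 1 x * p r x y)\<^sup>2)"
    and \<delta>: "\<delta> = 1 / (lam\<^sup>2 * l\<^sup>2 * c)\<^sup>2" "\<delta> \<le> r0"
    and t: "0 < t" "t \<le> T" "real n * \<delta> \<le> t"
  shows "ennreal (exp (- 2 * rate L 1 * T) * (LINT x|itv L. g x * dsin L 1 x)\<^sup>2 / L * 2 ^ n) \<le> inner_energy2 t"
  using t
proof (induction n arbitrary: t)
  case 0
  have "exp (- 2 * rate L 1 * T) * (LINT x|itv L. g x * dsin L 1 x)\<^sup>2 / L
      \<le> exp (- 2 * rate L 1 * t) * (LINT x|itv L. g x * dsin L 1 x)\<^sup>2 / L"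
    using 0 L rate_pos[OF L] by (intro divide_right_mono mult_right_mono) auto
  then have "ennreal (exp (- 2 * rate L 1 * T) * (LINT x|itv L. g x * dsin L 1 x)\<^sup>2 / L * 2 ^ 0)
      \<le> ennreal (exp (- 2 * rate L 1 * t) * (LINT x|itv L. g x * dsin L 1 x)\<^sup>2 / L)"
    by (intro ennreal_leI) simp
  \<comment> \<open>The base case keeps only the deterministic part of the solution.\<close>
  also have "\<dots> \<le> inner_energy2 t"
    using inner_energy2_ge[OF 0(1) c] by (rule order_trans[OF add_increasing2[OF zero_le order_refl]])
  finally show ?case .
next
  case (Suc n)
  define A where "A = exp (- 2 * rate L 1 * T) * (LINT x|itv L. g x * dsin L 1 x)\<^sup>2 / L"
  define \<gamma> where "\<gamma> = lam\<^sup>2 * l\<^sup>2 * c"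
  have A: "A \<ge> 0" using L by (simp add: A_def)
  have \<gamma>: "\<gamma> > 0" using lam l c by (simp add: \<gamma>_def)
  have d: "\<delta> > 0" "sqrt \<delta> = 1 / \<gamma>" using \<gamma> by (simp_all add: \<delta>(1) \<gamma>_def[symmetric] real_sqrt_divide)
  let ?I = "\<lambda>s. ennreal (indicator ({0<..<t} \<inter> {t - r0..}) s * (1 / sqrt (t - s)))"
  let ?J = "\<lambda>s. ennreal (indicator {t - \<delta>..t} s * (1 / sqrt (t - s)))"
  have n\<delta>: "real n * \<delta> \<le> t - \<delta>" using Suc.prems(3) by (simp add: algebra_simps)
  have "ennreal (A * 2 ^ n) * ennreal (2 * sqrt \<delta>) = (\<integral>\<^sup>+s. ennreal (A * 2 ^ n) * ?J s \<partial>lborel)"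
    using nn_integral_inverse_sqrt[of \<delta> t] d by (subst nn_integral_cmult) auto
  also have "\<dots> \<le> (\<integral>\<^sup>+s. ?I s * inner_energy2 s \<partial>lborel)"
  proof (rule nn_integral_mono_AE)
    \<comment> \<open>The left endpoint is excluded because it can be time 0, outside the reach of
      the induction hypothesis; at \<open>s = t\<close> the totalised \<open>1 / sqrt 0\<close> is
      0.\<close>
    have "AE s in lborel. s \<noteq> t - \<delta>" by (rule AE_lborel_singleton)
    then show "AE s in lborel. ennreal (A * 2 ^ n) * ?J s \<le> ?I s * inner_energy2 s"
    proof eventually_elim
      case (elim s)
      show ?case
      proof (cases "t - \<delta> < s \<and> s < t")
        case True
        have s0: "real n * \<delta> \<le> s" "0 \<le> real n * \<delta>" using True n\<delta> d by auto
        have "0 < s" using True n\<delta> s0(2) by linarith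
        then have "ennreal (A * 2 ^ n) \<le> inner_energy2 s"
          unfolding A_def using Suc.IH[of s] True Suc.prems s0 by simp
        then have "ennreal (A * 2 ^ n) * ?I s \<le> inner_energy2 s * ?I s" by (rule mult_right_mono) simp
        moreover have "?J s = ?I s" using True \<open>0 < s\<close> \<delta>(2) by simp
        ultimately show ?thesis by (simp only: mult.commute)
      next
        case False
        then have "?J s = 0" using elim by (cases "s = t") (auto simp: indicator_def)
        then show ?thesis by simp
      qed
    qed
  qed
  finally have "ennreal \<gamma> * (ennreal (A * 2 ^ n) * ennreal (2 * sqrt \<delta>))
      \<le> ennreal \<gamma> * (\<integral>\<^sup>+s. ?I s * inner_energy2 s \<partial>lborel)"
    by (rule mult_left_mono) simp
  moreover have "ennreal (A * 2 ^ Suc n) = ennreal \<gamma> * (ennreal (A * 2 ^ n) * ennreal (2 * sqrt \<delta>))"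
    using A \<gamma> by (simp add: d ennreal_mult[symmetric])
  ultimately have "ennreal (A * 2 ^ Suc n) \<le> ennreal \<gamma> * (\<integral>\<^sup>+s. ?I s * inner_energy2 s \<partial>lborel)" by simp
  also have "\<dots> \<le> inner_energy2 t"
    using inner_energy2_ge[OF Suc.prems(1) c] unfolding \<gamma>_def
        by (rule order_trans[OF add_increasing[OF zero_le order_refl]])
  finally show ?case by (simp add: A_def)
qed

lemma inner_energy2_le: "inner_energy2 t \<le> energy2 t"
  unfolding wmoment_def
proof (rule nn_integral_mono)
  fix x :: real
  have "(dsin L 1 x)\<^sup>2 \<le> 1" using abs_dsin_le_1 by (simp add: abs_square_le_1)
  then show "ennreal (indicator {0..L} x * (dsin L 1 x)\<^sup>2) * moment t x
      \<le> ennreal (indicator {0..L} x * 1) * moment t x"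
    by (intro mult_right_mono ennreal_leI) (auto simp: indicator_def)
qed

text \<open>\<open>energy\<close> is an iterated Bochner integral, and such an integral is 0 for a
  function that is not integrable; the finiteness from \<open>energy2_upper\<close> ensures that it
  is the true second moment.\<close>

lemma energy_eq:
  assumes t: "t > 0"
  shows "energy M L u t = sqrt (enn2real (energy2 t))"
proof -
  interpret P: pair_sigma_finite lborel M
    by (intro pair_sigma_finite.intro sigma_finite_measure_axioms) (rule sigma_finite_lborel)
  let ?f = "\<lambda>x \<omega>. indicator {0..L} x * (field t x \<omega>)\<^sup>2"
  have m: "case_prod ?f \<in> borel_measurable (lborel \<Otimes>\<^sub>M M)" by (simp add: case_prod_unfold)
  have eq: "(\<integral>\<^sup>+z. ennreal (case_prod ?f z) \<partial>(lborel \<Otimes>\<^sub>M M)) = energy2 t"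
  proof -
    have "(\<integral>\<^sup>+z. ennreal (case_prod ?f z) \<partial>(lborel \<Otimes>\<^sub>M M)) = (\<integral>\<^sup>+x. \<integral>\<^sup>+\<omega>. ennreal (?f x \<omega>) \<partial>M \<partial>lborel)"
      using m by (subst nn_integral_fst[symmetric]) auto
    also have "\<dots> = energy2 t"
      unfolding wmoment_def moment_def
      by (intro nn_integral_cong, subst nn_integral_cmult[symmetric]) (auto intro!: nn_integral_cong simp:
          ennreal_mult)
    finally show ?thesis .
  qed
  have fin: "energy2 t < \<infinity>" using energy2_upper[OF t] by (rule le_less_trans) simp
  have i: "integrable (lborel \<Otimes>\<^sub>M M) (case_prod ?f)"
    by (rule integrableI_nonneg[OF m]) (use eq fin in auto)
  have "energy M L u t = sqrt (\<integral>\<omega>. (LINT x|lborel. ?f x \<omega>) \<partial>M)"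
    unfolding energy_def set_lebesgue_integral_def
    by (intro arg_cong[of _ _ sqrt] Bochner_Integration.integral_cong refl)
       (use t in \<open>auto simp: field_def indicator_def\<close>)
  also have "(\<integral>\<omega>. (LINT x|lborel. ?f x \<omega>) \<partial>M) = integral\<^sup>L (lborel \<Otimes>\<^sub>M M) (case_prod ?f)"
    by (rule P.integral_snd[OF i])
  also have "\<dots> = enn2real (energy2 t)"
  proof -
    have "AE z in lborel \<Otimes>\<^sub>M M. 0 \<le> case_prod ?f z" by (rule AE_I2) (simp add: case_prod_unfold)
    then show ?thesis using integral_eq_nn_integral[OF m] eq by simp
  qed
  finally show ?thesis .
qed

lemma energy_square_upper:
  assumes T: "T > 0"
  shows "(energy M L u T)\<^sup>2 \<le> 2 * (L * B\<^sup>2) * exp (36 * K ^ 4 * T * lam ^ 4)"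
proof -
  have "enn2real (energy2 T) \<le> enn2real (ennreal (2 * (L * B\<^sup>2) * exp (36 * lam ^ 4 * K ^ 4 * T)))"
    by (rule enn2real_mono[OF energy2_upper[OF T]]) simp
  then show ?thesis using L by (simp add: energy_eq[OF T] mult_ac)
qed

lemma energy_square_lower:
  assumes T: "T > 0"
    and c: "c > 0" "\<And>r y. 0 < r \<Longrightarrow> r \<le> r0 \<Longrightarrow> y \<in> {0..L} \<Longrightarrow>
      c / sqrt r * (dsin L 1 y)\<^sup>2 \<le> (LINT x|itv L. (dsin L 1 x * p r x y)\<^sup>2)"
    and small: "1 / (lam\<^sup>2 * l\<^sup>2 * c)\<^sup>2 \<le> r0"
  shows "exp (- 2 * rate L 1 * T) * (LINT x|itv L. g x * dsin L 1 x)\<^sup>2 / (2 * L) * exp (ln 2 * T * l ^ 4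
      * c\<^sup>2 * lam ^ 4)
    \<le> (energy M L u T)\<^sup>2"
proof -
  define A where "A = exp (- 2 * rate L 1 * T) * (LINT x|itv L. g x * dsin L 1 x)\<^sup>2 / L"
  have A: "A \<ge> 0" using L by (simp add: A_def)
  define \<gamma> where "\<gamma> = lam\<^sup>2 * l\<^sup>2 * c"
  have \<gamma>: "\<gamma> > 0" using lam l c by (simp add: \<gamma>_def)
  \<comment> \<open>As \<open>\<gamma>^2\<close> is \<open>1 / \<delta>\<close>, this is the number
    of whole windows that fit before \<open>T\<close>; rounding down costs the factor 2 next to
    \<open>L\<close> in the statement.\<close>
  define n where "n = nat \<lfloor>T * \<gamma>\<^sup>2\<rfloor>"
  have n1: "real n \<le> T * \<gamma>\<^sup>2" using T by (simp add: n_def)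
  have n2: "T * \<gamma>\<^sup>2 - 1 \<le> real n" by (simp add: n_def) linarith
  have "ennreal (A * 2 ^ n) \<le> inner_energy2 T"
    unfolding A_def
  proof (rule inner_energy2_lower[OF c refl small T order_refl])
    show "real n * (1 / (lam\<^sup>2 * l\<^sup>2 * c)\<^sup>2) \<le> T"
      using n1 \<gamma> unfolding \<gamma>_def[symmetric] by (simp add: field_simps)
  qed
  also have "\<dots> \<le> energy2 T" by (rule inner_energy2_le)
  finally have "enn2real (ennreal (A * 2 ^ n)) \<le> enn2real (energy2 T)"
    using energy2_upper[OF T] by (intro enn2real_mono) (auto intro: le_less_trans)
  then have le: "A * 2 ^ n \<le> (energy M L u T)\<^sup>2" using A by (simp add: energy_eq[OF T])
  have "exp (ln 2 * (T * \<gamma>\<^sup>2)) / 2 = exp (ln 2 * (T * \<gamma>\<^sup>2 - 1))"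
    by (simp add: right_diff_distrib exp_diff)
  also have "\<dots> \<le> exp (ln 2 * real n)" using n2 by (simp add: mult_left_mono)
  also have "\<dots> = 2 ^ n" by (simp add: mult.commute[of "ln 2"] exp_of_nat_mult)
  finally have "A * (exp (ln 2 * (T * \<gamma>\<^sup>2)) / 2) \<le> A * 2 ^ n" using A by (rule mult_left_mono)
  also note le
  finally have "A * (exp (ln 2 * (T * \<gamma>\<^sup>2)) / 2) \<le> (energy M L u T)\<^sup>2" .
  moreover have "\<gamma>\<^sup>2 = l ^ 4 * c\<^sup>2 * lam ^ 4"
    by (simp add: \<gamma>_def power_mult_distrib mult_ac flip: power_mult)
  ultimately show ?thesis by (simp add: A_def mult_ac)
qed

end

section \<open>From energy bounds to the excitation index\<close>

lemma loglog_exp_power4_tendsto: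
  fixes f :: "real \<Rightarrow> real"
  assumes k: "a1 > 0" "a2 > 0" "k1 > 0" "k2 > 0"
    and f: "\<And>x. f x \<ge> 0"
    and lower: "eventually (\<lambda>x. a1 * exp (k1 * x ^ 4) \<le> (f x)\<^sup>2) at_top"
    and upper: "eventually (\<lambda>x. (f x)\<^sup>2 \<le> a2 * exp (k2 * x ^ 4)) at_top"
  shows "((\<lambda>x. loglog (f x) / ereal (ln x)) \<longlongrightarrow> 4) at_top"
proof -
  \<comment> \<open>Both bounds on \<open>f\<close> take this form after two logarithms. Since
    \<open>ln (k * x ^ 4 / 2)\<close> is \<open>4 * ln x\<close> up to a constant, the limit is 4
    for every \<open>a\<close> and every positive \<open>k\<close>.\<close>
  define h where "h a k x = ln ((ln a + k * x ^ 4) / 2) / ln x" for a k x :: real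
  have h: "((\<lambda>x. h a k x) \<longlongrightarrow> 4) at_top" if "k > 0" for a k
    unfolding h_def using that by real_asymp
  \<comment> \<open>Beyond 2, half of the expression exceeds 1; then \<open>ln (f x) > 1\<close>, so
    \<open>loglog\<close> is in its finite branch and the outer logarithm acts on positive
    numbers.\<close>
  have big: "eventually (\<lambda>x. ln a1 + k1 * x ^ 4 > 2) at_top" using k by real_asymp
  have gt1: "eventually (\<lambda>x::real. x > 1) at_top" by (rule eventually_gt_at_top)
  have ev: "eventually (\<lambda>x. loglog (f x) / ereal (ln x) = ereal (ln (ln (f x)) / ln x) \<and>
      h a1 k1 x \<le> ln (ln (f x)) / ln x \<and> ln (ln (f x)) / ln x \<le> h a2 k2 x) at_top"
    using lower upper big gt1
  proof eventually_elim
    case (elim x)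
    have p: "a1 * exp (k1 * x ^ 4) > 0" using k by simp
    then have f2: "(f x)\<^sup>2 > 0" using elim(1) by linarith
    then have fp: "f x > 0" using f[of x] by (auto simp: less_le)
    have lf: "ln ((f x)\<^sup>2) = 2 * ln (f x)" using fp by (simp add: ln_realpow)
    have "ln (a1 * exp (k1 * x ^ 4)) \<le> ln ((f x)\<^sup>2)" using elim(1) p f2 by (subst ln_le_cancel_iff) auto
    then have l1: "(ln a1 + k1 * x ^ 4) / 2 \<le> ln (f x)" using k by (simp add: ln_mult lf)
    have "ln ((f x)\<^sup>2) \<le> ln (a2 * exp (k2 * x ^ 4))" using elim(2) k f2 by (subst ln_le_cancel_iff) auto
    then have l2: "ln (f x) \<le> (ln a2 + k2 * x ^ 4) / 2" using k by (simp add: ln_mult lf)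
    have "1 < (ln a1 + k1 * x ^ 4) / 2" using elim(3) by simp
    then have lpos: "1 < ln (f x)" using l1 by (rule less_le_trans)
    then have "f x > 1" using fp by (metis ln_gt_zero_iff zero_less_one less_trans)
    then have "loglog (f x) / ereal (ln x) = ereal (ln (ln (f x)) / ln x)" using elim(4)
        by (simp add: loglog_def)
    moreover have "h a1 k1 x \<le> ln (ln (f x)) / ln x"
      unfolding h_def using l1 elim(3,4) lpos by (intro divide_right_mono) (auto intro!: ln_mono)
    moreover have "ln (ln (f x)) / ln x \<le> h a2 k2 x"
      unfolding h_def using l2 elim(4) lpos by (intro divide_right_mono) (auto intro!: ln_mono)
    ultimately show ?case by blast
  qed
  have "((\<lambda>x. ln (ln (f x)) / ln x) \<longlongrightarrow> 4) at_top"
  proof (rule tendsto_sandwich[OF _ _ h[OF k(3), of a1] h[OF k(4), of a2]])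
    show "\<forall>\<^sub>F x in at_top. h a1 k1 x \<le> ln (ln (f x)) / ln x" using ev by eventually_elim blast
    show "\<forall>\<^sub>F x in at_top. ln (ln (f x)) / ln x \<le> h a2 k2 x" using ev by eventually_elim blast
  qed
  then have "((\<lambda>x. ereal (ln (ln (f x)) / ln x)) \<longlongrightarrow> ereal 4) at_top" by (rule tendsto_ereal)
  then have "((\<lambda>x. loglog (f x) / ereal (ln x)) \<longlongrightarrow> ereal 4) at_top"
    by (rule Lim_transform_eventually) (use ev in \<open>eventually_elim, simp\<close>)
  then show ?thesis by simp
qed

lemma admissible_coefficientE:
  assumes "admissible_coefficient \<sigma>"
  obtains l K where "l > 0" "\<And>x. l * \<bar>x\<bar> \<le> \<bar>\<sigma> x\<bar>" "\<And>x. \<bar>\<sigma> x\<bar> \<le> K * \<bar>x\<bar>" "\<sigma> \<in> borel_measurable borel"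
proof -
  have \<sigma>: "\<exists>C. C-lipschitz_on UNIV \<sigma>" "\<sigma> 0 = 0" "0 < lower_slope \<sigma>" "upper_slope \<sigma> < \<infinity>"
    using assms by (auto simp: admissible_coefficient_def)
  \<comment> \<open>A value strictly between 0 and the extended-real infimum is finite, so it can
    serve as a real slope.\<close>
  obtain l' where l': "0 < l'" "l' < lower_slope \<sigma>" using \<sigma>(3) dense by blast
  then obtain l where l: "l' = ereal l" by (cases l') auto
  have 1: "l * \<bar>x\<bar> \<le> \<bar>\<sigma> x\<bar>" for x
  proof (cases "x = 0")
    case False
    then have "lower_slope \<sigma> \<le> ereal \<bar>\<sigma> x / x\<bar>" unfolding lower_slope_def by (intro INF_lower) auto
    then have "l \<le> \<bar>\<sigma> x / x\<bar>" using l' l by (metis ereal_less_eq(3) less_imp_le order_trans)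
    then show ?thesis using False by (simp add: abs_divide field_simps)
  qed simp
  obtain K where K: "upper_slope \<sigma> < ereal K" using \<sigma>(4) less_PInf_Ex_of_nat by auto
  have 2: "\<bar>\<sigma> x\<bar> \<le> K * \<bar>x\<bar>" for x
  proof (cases "x = 0")
    case False
    then have "ereal \<bar>\<sigma> x / x\<bar> \<le> upper_slope \<sigma>" unfolding upper_slope_def by (intro SUP_upper) auto
    then have "\<bar>\<sigma> x / x\<bar> \<le> K" using K by (metis ereal_less_eq(3) less_imp_le order_trans)
    then show ?thesis using False by (simp add: abs_divide field_simps)
  qed (simp add: \<sigma>)
  have "continuous_on UNIV \<sigma>" using \<sigma>(1) lipschitz_on_continuous_on by blast
  then show ?thesis using l' l 1 2 by (intro that) (auto intro: borel_measurable_continuous_onI)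
qed

text \<open>A Lebesgue measurable function agrees almost everywhere with a Borel one, and integrals
  against continuous functions do not notice the change. The first sine is positive inside the
  interval, so a nonnegative datum that is not almost everywhere zero has a positive first
  coefficient; this starts the lower bound.\<close>

lemma admissible_initialE:
  assumes L: "L > 0" and u0: "admissible_initial L u0"
  obtains g B where "g \<in> borel_measurable borel" "\<And>x. \<bar>g x\<bar> \<le> B" "B > 0"
    "\<And>h. continuous_on {0..L} h \<Longrightarrow> (LINT y:{0..L}|lebesgue. u0 y * h y) = (LINT y|itv L. g y * h y)"
    "(LINT y|itv L. g y * dsin L 1 y) > 0"
proof -
  have u: "\<And>x. x \<in> {0..L} \<Longrightarrow> 0 \<le> u0 x" "bounded (u0 ` {0..L})" "u0 \<in> borel_measurable (lebesgue_on {0..L})"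
    "\<not> (AE x in lebesgue_on {0..L}. u0 x = 0)"
    using u0 by (auto simp: admissible_initial_def)
  obtain B where "\<forall>y\<in>u0 ` {0..L}. norm y \<le> B" using u(2) unfolding bounded_iff by blast
  then have B: "\<And>x. x \<in> {0..L} \<Longrightarrow> \<bar>u0 x\<bar> \<le> B" by simp
  have B0: "B \<ge> 0" using B[of 0] L by auto
  define v where "v x = indicator {0..L} x * u0 x" for x
  have mv: "v \<in> borel_measurable (completion lborel)"
    using u(3) by (subst (asm) borel_measurable_restrict_space_iff) (auto simp: v_def[abs_def])
  obtain v' where v': "v' \<in> borel_measurable lborel" "AE x in lborel. v x = v' x"
    using completion_ex_borel_measurable_real[OF mv] by auto
  \<comment> \<open>Truncation to values between 0 and \<open>B\<close> preserves the
    almost-everywhere equality on \<open>{0..L}\<close> and makes sign and bound hold at every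
    point.\<close>
  define g where "g x = max 0 (min B (v' x))" for x
  have g [measurable]: "g \<in> borel_measurable borel" using v'(1) by (simp add: g_def[abs_def])
  have vg: "AE x in lborel. v x = g x"
    using v'(2)
  proof eventually_elim
    case (elim x)
    then show ?case using u(1)[of x] B[of x] B0 by (cases "x \<in> {0..L}") (auto simp: g_def v_def)
  qed
  have vg': "AE x in lebesgue. v x = g x" using vg by (rule AE_completion)
  have int: "(LINT y:{0..L}|lebesgue. u0 y * h y) = (LINT y|itv L. g y * h y)"
      if h: "continuous_on {0..L} h" for h
  proof -
    have [measurable]: "(\<lambda>y. indicator {0..L} y * h y) \<in> borel_measurable borel"
      using borel_measurable_continuous_on_indicator[OF _ h] by simp
    have "(LINT y:{0..L}|lebesgue. u0 y * h y) = (LINT y|lebesgue. v y * (indicator {0..L} y * h y))"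
      unfolding set_lebesgue_integral_def by (intro Bochner_Integration.integral_cong) (auto simp: v_def
          indicator_def)
    also have "\<dots> = (LINT y|lebesgue. g y * (indicator {0..L} y * h y))"
    proof (rule integral_cong_AE)
      have 1: "g \<in> borel_measurable lebesgue" "(\<lambda>y. indicator {0..L} y * h y) \<in> borel_measurable lebesgue"
        by (intro measurable_completion; simp)+
      show "(\<lambda>y. v y * (indicator {0..L} y * h y)) \<in> borel_measurable lebesgue"
        "(\<lambda>y. g y * (indicator {0..L} y * h y)) \<in> borel_measurable lebesgue"
        using 1 mv by (auto intro!: borel_measurable_times)
    qed (use vg' in eventually_elim, simp)
    also have "\<dots> = (LINT y|lborel. g y * (indicator {0..L} y * h y))"
      by (rule integral_completion) simp
    also have "\<dots> = (LINT y|itv L. g y * h y)"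
      unfolding integral_itv set_lebesgue_integral_def by (intro Bochner_Integration.integral_cong) auto
    finally show ?thesis .
  qed
  have gB: "\<bar>g x\<bar> \<le> B + 1" "0 \<le> g x" for x using B0 by (auto simp: g_def)
  have i: "integrable (itv L) (\<lambda>x. g x * dsin L 1 x)"
  proof (rule integrable_itv_bounded)
    show "(\<lambda>x. g x * dsin L 1 x) \<in> borel_measurable (itv L)" by (intro borel_measurable_itvI) simp
    show "\<bar>g x * dsin L 1 x\<bar> \<le> (B + 1) * 1" for x
      unfolding abs_mult by (intro mult_mono gB abs_dsin_le_1) (use B0 in auto)
  qed
  have spos: "dsin L 1 x > 0" if "x \<in> {0<..<L}" for x
  proof -
    have "0 < pi / L * x" "pi / L * x < pi" using that L by (auto simp: field_simps)
    then show ?thesis by (simp add: dsin_def sin_gt_zero)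
  qed
  have s0: "dsin L 1 x \<ge> 0" if "x \<in> {0..L}" for x
    using spos[of x] that L by (cases "x = 0 \<or> x = L") auto
  have nn: "AE x in itv L. 0 \<le> g x * dsin L 1 x"
    using gB(2) s0 by (intro AE_I2) (auto simp: space_restrict_space)
  have "(LINT y|itv L. g y * dsin L 1 y) \<noteq> 0"
  proof
    assume "(LINT y|itv L. g y * dsin L 1 y) = 0"
    then have "AE x in itv L. g x * dsin L 1 x = 0" using integral_nonneg_eq_0_iff_AE[OF i nn] by simp
    then have "AE x in lborel. x \<in> {0..L} \<longrightarrow> g x * dsin L 1 x = 0" by (simp add: AE_restrict_space_iff)
    moreover have "AE x in lborel. x \<noteq> 0" "AE x in lborel. x \<noteq> L" by (rule AE_lborel_singleton)+
    ultimately have "AE x in lborel. x \<in> {0..L} \<longrightarrow> u0 x = 0"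
      using vg
    proof eventually_elim
      case (elim x)
      show ?case
      proof
        assume x: "x \<in> {0..L}"
        then have "dsin L 1 x \<noteq> 0" using spos[of x] elim by auto
        then show "u0 x = 0" using elim x by (simp add: v_def)
      qed
    qed
    then have "AE x in lebesgue. x \<in> {0..L} \<longrightarrow> u0 x = 0" by (rule AE_completion)
    then have "AE x in lebesgue_on {0..L}. u0 x = 0" by (simp add: AE_restrict_space_iff)
    then show False using u(4) by simp
  qed
  moreover have "(LINT y|itv L. g y * dsin L 1 y) \<ge> 0" using nn by (rule integral_nonneg_AE)
  \<comment> \<open>Taking \<open>B + 1\<close> makes the bound strictly positive, as the prefactor
    of the upper energy estimate must be.\<close>
  ultimately show ?thesis using int gB B0 by (intro that[of g "B + 1"]) (auto simp: less_le)
qed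

theorem theorem1p3:
  fixes M :: "'w measure"
    and L :: real
    and W :: "(real \<times> real) set \<Rightarrow> 'w \<Rightarrow> real"
    and p\<^sub>D :: "real \<Rightarrow> real \<Rightarrow> real \<Rightarrow> real"
    and \<sigma> u0 :: "real \<Rightarrow> real"
    and u :: "real \<Rightarrow> real \<Rightarrow> real \<Rightarrow> 'w \<Rightarrow> real"
  assumes "L > 0"
    and "prob_space M"
    and "white_noise M L W"
    and "dirichlet_heat_kernel L p\<^sub>D"
    and "admissible_coefficient \<sigma>"
    and "admissible_initial L u0"
    and "\<And>lam. lam > 0 \<Longrightarrow> mild_solution M L W p\<^sub>D \<sigma> u0 lam (u lam)"
  shows "\<forall>t>0. upper_excitation_index M L u t = 4 \<and> lower_excitation_index M L u t = 4"
proof (intro allI impI)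
  fix t :: real assume t: "t > 0"
  obtain l K where \<sigma>: "l > 0" "\<And>x. l * \<bar>x\<bar> \<le> \<bar>\<sigma> x\<bar>" "\<And>x. \<bar>\<sigma> x\<bar> \<le> K * \<bar>x\<bar>" "\<sigma> \<in> borel_measurable borel"
    using admissible_coefficientE[OF assms(5)] by blast
  obtain g B where g: "g \<in> borel_measurable borel" "\<And>x. \<bar>g x\<bar> \<le> B" "B > 0"
    "\<And>h. continuous_on {0..L} h \<Longrightarrow> (LINT y:{0..L}|lebesgue. u0 y * h y) = (LINT y|itv L. g y * h y)"
    "(LINT y|itv L. g y * dsin L 1 y) > 0"
    using admissible_initialE[OF assms(1,6)] by blast
  obtain r0 c where r: "r0 > 0" and c: "c > 0" "\<And>r y. 0 < r \<Longrightarrow> r \<le> r0 \<Longrightarrow> y \<in> {0..L} \<Longrightarrow>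
      c / sqrt r * (dsin L 1 y)\<^sup>2 \<le> (LINT x|itv L. (dsin L 1 x * p\<^sub>D r x y)\<^sup>2)"
    using dirichlet_heat_kernel_weighted_square_ge[OF assms(1,4)] by blast
  have mild: "mild M L W p\<^sub>D \<sigma> u0 g lam l K B (u lam)" if "lam > 0" for lam
    by (intro mild.intro noise.intro noise_axioms.intro mild_axioms.intro assms that \<sigma> g
        dirichlet_heat_kernel_continuous_section[OF assms(4)])
  have K: "K > 0" by (rule mild.K_pos[OF mild[of 1]]) simp
  let ?a1 = "exp (- 2 * rate L 1 * t) * (LINT x|itv L. g x * dsin L 1 x)\<^sup>2 / (2 * L)"
  have "((\<lambda>lam. loglog (energy M L (u lam) t) / ereal (ln lam)) \<longlongrightarrow> 4) at_top"
  proof (rule loglog_exp_power4_tendsto[where ?a1.0 = ?a1 and ?k1.0 = "ln 2 * t * l ^ 4 * c\<^sup>2" and ?a2.0 = "2 * (L * B\<^sup>2)" and ?k2.0 = "36 * K ^ 4 * t"])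
    show "?a1 > 0" "ln 2 * t * l ^ 4 * c\<^sup>2 > 0" "2 * (L * B\<^sup>2) > 0" "36 * K ^ 4 * t > 0"
      using assms(1) g t \<sigma>(1) c(1) K by auto
    show "energy M L (u lam) t \<ge> 0" for lam
      unfolding energy_def set_lebesgue_integral_def by (intro real_sqrt_ge_zero integral_nonneg_AE AE_I2) auto
    \<comment> \<open>For large noise the window length, of order lam^(-4), falls below
      \<open>r0\<close>.\<close>
    have "\<forall>\<^sub>F lam in at_top. 1 / (lam\<^sup>2 * l\<^sup>2 * c)\<^sup>2 \<le> r0" using r c(1) \<sigma>(1) by real_asymp
    then show "\<forall>\<^sub>F lam in at_top. ?a1 * exp (ln 2 * t * l ^ 4 * c\<^sup>2 * lam ^ 4) \<le> (energy M L (u lam) t)\<^sup>2"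
      using eventually_gt_at_top[of 0]
      by eventually_elim (rule mild.energy_square_lower[OF mild t c])
    show "\<forall>\<^sub>F lam in at_top. (energy M L (u lam) t)\<^sup>2 \<le> 2 * (L * B\<^sup>2) * exp (36 * K ^ 4 * t * lam ^ 4)"
      using eventually_gt_at_top[of 0]
      by eventually_elim (rule mild.energy_square_upper[OF mild t])
  qed
  then show "upper_excitation_index M L u t = 4 \<and> lower_excitation_index M L u t = 4"
    unfolding upper_excitation_index_def lower_excitation_index_def
    by (intro conjI lim_imp_Limsup lim_imp_Liminf) auto
qed

end
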